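(* Let $B$ be a tame stellar ball. Then $B$ admits a starring consisting only of strongly internal moves; that is, there are stellar moves $\delta_0,\dots,\delta_k$ such that for each $i\le k$ the move $\delta_i$ is internal and strongly internal for $\delta_{i-1}\cdots\delta_0B$, and $\delta_k\cdots\delta_0B=[\{v\}]\star\partial B$ for some element $v$.
   Context: Complexes: families of finite non-empty sets closed under non-empty subsets; $\mathrm{dom}(C)=\bigcup C$. For a finite set $\sigma$, $[\sigma]$ is the set of non-empty subsets of $\sigma$ and $\partial[\sigma]=[\sigma]\setminus\{\sigma\}$. Join of complexes with disjoint domains: $A\star B=A\cup B\cup\{\sigma\cup\tau:\sigma\in A,\tau\in B\}$, with the convention $A\star\emptyset=\emptyset\star A=\emptyset$. $\mathrm{st}(\sigma,A)=\{\tau\in A:\sigma\subseteq\tau\}$, $\mathrm{lk}(\sigma,A)=\{\tau\in A:\tau\cap\sigma=\emptyset,\sigma\cup\tau\in A\}$. Stellar subdivision: $(\sigma,a)A=(A\setminus\mathrm{st}(\sigma,A))\cup([\{a\}]\star\partial[\sigma]\star\mathrm{lk}(\sigma,A))$ if $\sigma\in A$ and $a\notin\mathrm{dom}(A)$, else $A$. Stellar weld: $(\sigma,a)^{-1}A=(A\setminus\mathrm{st}(\{a\},A))\cup([\sigma]\star L)$ if $\sigma\notin A$, $a\in\mathrm{dom}(A)$ and $\mathrm{lk}(\{a\},A)=\partial[\sigma]\star L$ for some complex $L$, else $A$. Both are stellar moves, based on $\sigma$ with vertex $a$; a move is essential for $A$ if the first clause applies. Stellar equivalence is generated by moves; a stellar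 $n$-ball (resp. $(n-1)$-sphere) is a complex stellar equivalent to $[\{0,\dots,n\}]$ (resp. $\partial[\{0,\dots,n\}]$). A stellar $n$-manifold is a complex in which the link of each vertex is a stellar $(n-1)$-sphere or $(n-1)$-ball; its boundary $\partial M$ is the subcomplex of faces whose link is not a stellar sphere. A move $\delta$ is internal for a stellar ball $B$ if it is essential for $B$ but not for $\partial B$. A starring of $B$ is a sequence of moves each internal for the complex obtained by the previous ones, ending in a complex of the form $[\{v\}]\star\partial B$. A stellar ball $B$ is tame if $\partial B$ is an induced subcomplex: $\sigma\in B$ and $\sigma\subseteq\mathrm{dom}(\partial B)$ imply $\sigma\in\partial B$. A stellar move based on $\sigma$ is strongly internal for a stellar manifold $M$ if $\sigma\not\subseteq\mathrm{dom}(\partial M)$.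
   Formalization: The join with the empty complex is taken from the displayed formula, A⋆∅ = ∅⋆A = A, instead of the stated convention A⋆∅ = ∅, which contradicts that formula and would make ∅ a tame stellar ball for which no move is essential. *)

theory Defs
  imports "HOL-Library.Infinite_Typeclass"
begin

definition is_complex :: "'a set set \<Rightarrow> bool" where
  "is_complex A \<longleftrightarrow>
     (\<forall>\<sigma>\<in>A. finite \<sigma> \<and> \<sigma> \<noteq> {} \<and> (\<forall>\<tau>. \<tau> \<subseteq> \<sigma> \<longrightarrow> \<tau> \<noteq> {} \<longrightarrow> \<tau> \<in> A))"

definition verts :: "'a set set \<Rightarrow> 'a set" where
  "verts A = \<Union>A"

definition simplex :: "'a set \<Rightarrow> 'a set set" where
  "simplex \<sigma> = {\<tau>. \<tau> \<subseteq> \<sigma> \<and> \<tau> \<noteq> {}}"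

definition simplex_bd :: "'a set \<Rightarrow> 'a set set" where
  "simplex_bd \<sigma> = simplex \<sigma> - {\<sigma>}"

text \<open>
  The empty face is not a member of a complex, so the empty complex is the neutral element of
  the join: \<open>A \<star> \<emptyset> = \<emptyset> \<star> A = A\<close>. This is what makes
  subdivision at a facet (empty link) or at a vertex (empty boundary) behave correctly. If these
  joins were empty instead, subdividing at a facet would just delete it, and every finite complex
  would be stellar equivalent to the empty one. The join is only meant for complexes with
  disjoint sets of vertices; that condition is stated wherever it is not automatic.
\<close>
definition join :: "'a set set \<Rightarrow> 'a set set \<Rightarrow> 'a set set" (infixl \<open>\<star>\<close> 68) where
  "A \<star> B = A \<union> B \<union> {\<sigma> \<union> \<tau> |\<sigma> \<tau>. \<sigma> \<in> A \<and> \<tau> \<in> B}"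

definition star :: "'a set \<Rightarrow> 'a set set \<Rightarrow> 'a set set" where
  "star \<sigma> A = {\<tau> \<in> A. \<sigma> \<subseteq> \<tau>}"

definition link :: "'a set \<Rightarrow> 'a set set \<Rightarrow> 'a set set" where
  "link \<sigma> A = {\<tau> \<in> A. \<tau> \<inter> \<sigma> = {} \<and> \<sigma> \<union> \<tau> \<in> A}"

text \<open>
  \<open>Subdiv \<sigma> a\<close> is the subdivision \<open>(\<sigma>, a)\<close> and \<open>Weld \<sigma> a\<close> is the weld
  \<open>(\<sigma>, a)\<^sup>-\<^sup>1\<close>.
\<close>
datatype 'a move = Subdiv (base: "'a set") (apex: 'a) | Weld (base: "'a set") (apex: 'a)

text \<open>
  \<open>L\<close> witnesses that the link of \<open>a\<close> is a join of \<open>L\<close> with the boundary of \<open>\<sigma>\<close>.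
  The condition that \<open>L\<close> and \<open>\<sigma>\<close> are disjoint is part of the join being defined.
  There is at most one such \<open>L\<close>; see \<open>weld_cofactor_unique\<close>.
\<close>
definition weld_cofactor :: "'a set \<Rightarrow> 'a \<Rightarrow> 'a set set \<Rightarrow> 'a set set \<Rightarrow> bool" where
  "weld_cofactor \<sigma> a A L \<longleftrightarrow>
     is_complex L \<and> verts L \<inter> \<sigma> = {} \<and> link {a} A = simplex_bd \<sigma> \<star> L"

text \<open>
  Bases of moves are finite and nonempty. For subdivisions this follows from \<open>\<sigma> \<in> A\<close>.
\<close>
fun essential :: "'a move \<Rightarrow> 'a set set \<Rightarrow> bool" where
  "essential (Subdiv \<sigma> a) A \<longleftrightarrow> \<sigma> \<in> A \<and> a \<notin> verts A"
| "essential (Weld \<sigma> a) A \<longleftrightarrow>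
     finite \<sigma> \<and> \<sigma> \<noteq> {} \<and> \<sigma> \<notin> A \<and> a \<in> verts A \<and> (\<exists>L. weld_cofactor \<sigma> a A L)"

fun apply_move :: "'a move \<Rightarrow> 'a set set \<Rightarrow> 'a set set" where
  "apply_move (Subdiv \<sigma> a) A =
     (if essential (Subdiv \<sigma> a) A
      then (A - star \<sigma> A) \<union> (simplex {a} \<star> simplex_bd \<sigma> \<star> link \<sigma> A)
      else A)"
| "apply_move (Weld \<sigma> a) A =
     (if essential (Weld \<sigma> a) A
      then (A - star {a} A) \<union> (simplex \<sigma> \<star> (THE L. weld_cofactor \<sigma> a A L))
      else A)"

primrec apply_moves :: "(nat \<Rightarrow> 'a move) \<Rightarrow> nat \<Rightarrow> 'a set set \<Rightarrow> 'a set set" where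
  "apply_moves \<delta> 0 A = A"
| "apply_moves \<delta> (Suc i) A = apply_move (\<delta> i) (apply_moves \<delta> i A)"

definition stellar_step :: "'a set set \<Rightarrow> 'a set set \<Rightarrow> bool" where
  "stellar_step A A' \<longleftrightarrow> is_complex A \<and> is_complex A' \<and> (\<exists>\<delta>. A' = apply_move \<delta> A)"

abbreviation stellar_equiv :: "'a set set \<Rightarrow> 'a set set \<Rightarrow> bool" where
  "stellar_equiv \<equiv> equivclp stellar_step"

text \<open>
  Vertices come from an arbitrary type, so a set of \<open>n + 1\<close> vertices replaces
  \<open>{0, \<dots>, n}\<close>. The choice of this set is immaterial, and over the natural numbers one gets
  \<open>{0..n}\<close>; see \<open>stellar_ball_iff\<close>, \<open>stellar_ball_nat\<close> and their analogues for spheres.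
  The empty complex is the sphere of dimension \<open>-1\<close> (\<open>n = 0\<close>).
\<close>
definition stellar_ball :: "nat \<Rightarrow> 'a set set \<Rightarrow> bool" where
  "stellar_ball n A \<longleftrightarrow>
     (\<exists>\<sigma>. finite \<sigma> \<and> card \<sigma> = n + 1 \<and> stellar_equiv (simplex \<sigma>) A)"

definition stellar_sphere :: "int \<Rightarrow> 'a set set \<Rightarrow> bool" where
  "stellar_sphere d A \<longleftrightarrow>
     (\<exists>n \<sigma>. d = int n - 1 \<and> finite \<sigma> \<and> card \<sigma> = n + 1 \<and> stellar_equiv (simplex_bd \<sigma>) A)"

definition boundary :: "'a set set \<Rightarrow> 'a set set" where
  "boundary M = {\<sigma> \<in> M. \<not> (\<exists>d. stellar_sphere d (link \<sigma> M))}"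

definition internal :: "'a move \<Rightarrow> 'a set set \<Rightarrow> bool" where
  "internal \<delta> B \<longleftrightarrow> essential \<delta> B \<and> \<not> essential \<delta> (boundary B)"

definition strongly_internal :: "'a move \<Rightarrow> 'a set set \<Rightarrow> bool" where
  "strongly_internal \<delta> M \<longleftrightarrow> \<not> base \<delta> \<subseteq> verts (boundary M)"

definition tame :: "'a set set \<Rightarrow> bool" where
  "tame B \<longleftrightarrow> (\<forall>\<sigma>\<in>B. \<sigma> \<subseteq> verts (boundary B) \<longrightarrow> \<sigma> \<in> boundary B)"


lemma join_empty [simp]: "A \<star> {} = A" "{} \<star> A = A"
  by (auto simp: join_def)

lemma weld_cofactor_unique:
  assumes "weld_cofactor \<sigma> a A L" and "weld_cofactor \<sigma> a A L'"
  shows "L = L'"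
proof -
  have *: "K = {\<tau> \<in> link {a} A. \<tau> \<inter> \<sigma> = {}}" if "weld_cofactor \<sigma> a A K" for K
  proof -
    from that have K: "is_complex K" "verts K \<inter> \<sigma> = {}" "link {a} A = simplex_bd \<sigma> \<star> K"
      by (auto simp: weld_cofactor_def)
    have "\<tau> \<inter> \<sigma> = {}" if "\<tau> \<in> K" for \<tau>
      using K(2) that by (auto simp: verts_def)
    moreover have "\<tau> \<inter> \<sigma> \<noteq> {}" if "\<tau> \<in> simplex_bd \<sigma>" for \<tau>
      using that by (auto simp: simplex_bd_def simplex_def)
    ultimately show ?thesis
      unfolding K(3) join_def by fast
  qed
  show ?thesis
    using *[OF assms(1)] *[OF assms(2)] by simp
qed

lemma is_complex_join:
  assumes "is_complex A" and "is_complex B"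
  shows "is_complex (A \<star> B)"
proof -
  have fin: "finite \<sigma> \<and> \<sigma> \<noteq> {}" if "is_complex C" "\<sigma> \<in> C" for C :: "'a set set" and \<sigma>
    using that unfolding is_complex_def by blast
  have down: "\<rho> \<in> C" if "is_complex C" "\<sigma> \<in> C" "\<rho> \<subseteq> \<sigma>" "\<rho> \<noteq> {}" for C :: "'a set set" and \<sigma> \<rho>
    using that unfolding is_complex_def by blast
  have "\<rho> \<in> A \<star> B" if "\<sigma> \<in> A" "\<tau> \<in> B" "\<rho> \<subseteq> \<sigma> \<union> \<tau>" "\<rho> \<noteq> {}" for \<rho> \<sigma> \<tau>
  proof -
    have *: "\<rho> = (\<rho> \<inter> \<sigma>) \<union> (\<rho> \<inter> \<tau>)"
      using that by blast
    have "\<rho> \<inter> \<sigma> \<noteq> {} \<Longrightarrow> \<rho> \<inter> \<sigma> \<in> A" "\<rho> \<inter> \<tau> \<noteq> {} \<Longrightarrow> \<rho> \<inter> \<tau> \<in> B"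
      using down[OF assms(1) that(1), of "\<rho> \<inter> \<sigma>"] down[OF assms(2) that(2), of "\<rho> \<inter> \<tau>"] by auto
    then show ?thesis
      using * that(4) unfolding join_def
      by (cases "\<rho> \<inter> \<sigma> = {}"; cases "\<rho> \<inter> \<tau> = {}") auto
  qed
  note closed = this
  have "finite \<mu>" "\<mu> \<noteq> {}" if "\<mu> \<in> A \<star> B" for \<mu>
    using that fin[OF assms(1)] fin[OF assms(2)] by (auto simp: join_def)
  moreover have "\<rho> \<in> A \<star> B" if \<mu>: "\<mu> \<in> A \<star> B" and \<rho>: "\<rho> \<subseteq> \<mu>" "\<rho> \<noteq> {}" for \<mu> \<rho>
  proof -
    consider "\<mu> \<in> A" | "\<mu> \<in> B" | \<sigma> \<tau> where "\<mu> = \<sigma> \<union> \<tau>" "\<sigma> \<in> A" "\<tau> \<in> B"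
      using \<mu> by (auto simp: join_def)
    then show ?thesis
    proof cases
      case 1
      then show ?thesis
        using down[OF assms(1) _ \<rho>] by (simp add: join_def)
    next
      case 2
      then show ?thesis
        using down[OF assms(2) _ \<rho>] by (simp add: join_def)
    next
      case 3
      then show ?thesis
        using closed[of \<sigma> \<tau> \<rho>] \<rho> by simp
    qed
  qed
  ultimately show ?thesis
    unfolding is_complex_def by (intro ballI conjI allI impI)
qed

lemma is_complex_Un: "is_complex A \<Longrightarrow> is_complex B \<Longrightarrow> is_complex (A \<union> B)"
  unfolding is_complex_def by blast

lemma is_complex_simplex: "finite \<sigma> \<Longrightarrow> is_complex (simplex \<sigma>)"
  by (auto simp: is_complex_def simplex_def intro: finite_subset)

lemma is_complex_simplex_bd: "finite \<sigma> \<Longrightarrow> is_complex (simplex_bd \<sigma>)"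
  by (auto simp: is_complex_def simplex_bd_def simplex_def intro: finite_subset)

lemma is_complex_link:
  assumes "is_complex A"
  shows "is_complex (link \<sigma> A)"
proof -
  have "\<rho> \<in> link \<sigma> A" if "\<tau> \<in> link \<sigma> A" "\<rho> \<subseteq> \<tau>" "\<rho> \<noteq> {}" for \<tau> \<rho>
  proof -
    have "\<tau> \<in> A" "\<tau> \<inter> \<sigma> = {}" "\<sigma> \<union> \<tau> \<in> A"
      using that by (auto simp: link_def)
    moreover have "\<sigma> \<union> \<rho> \<subseteq> \<sigma> \<union> \<tau>" "\<sigma> \<union> \<rho> \<noteq> {}"
      using that by auto
    ultimately show ?thesis
      using assms that unfolding is_complex_def link_def by blast
  qed
  moreover have "finite \<tau>" "\<tau> \<noteq> {}" if "\<tau> \<in> link \<sigma> A" for \<tau>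
    using assms that unfolding is_complex_def link_def by blast+
  ultimately show ?thesis
    unfolding is_complex_def by (intro ballI conjI allI impI)
qed

lemma is_complex_diff_star: "is_complex A \<Longrightarrow> is_complex (A - star \<sigma> A)"
  unfolding is_complex_def star_def by blast

lemma is_complex_apply_move:
  assumes "is_complex A"
  shows "is_complex (apply_move \<delta> A)"
proof (cases \<delta>)
  case (Subdiv \<sigma> a)
  have "finite \<sigma>" if "\<sigma> \<in> A"
    using assms that unfolding is_complex_def by blast
  then show ?thesis
    using assms unfolding Subdiv
    by (auto intro!: is_complex_Un is_complex_join is_complex_diff_star is_complex_link
        is_complex_simplex is_complex_simplex_bd)
next
  case (Weld \<sigma> a)
  have "is_complex (THE L. weld_cofactor \<sigma> a A L)" if L: "weld_cofactor \<sigma> a A L" for L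
  proof -
    have "(THE L. weld_cofactor \<sigma> a A L) = L"
      by (rule the_equality, rule L, rule weld_cofactor_unique[OF _ L])
    then show ?thesis
      using L by (simp add: weld_cofactor_def)
  qed
  then show ?thesis
    using assms unfolding Weld
    by (auto intro!: is_complex_Un is_complex_join is_complex_diff_star is_complex_simplex)
qed

lemma subdiv_vertex_simplex:
  assumes "x \<in> \<sigma>" and "y \<notin> \<sigma>"
  shows "apply_move (Subdiv {x} y) (simplex \<sigma>) = simplex (insert y (\<sigma> - {x}))"
proof -
  have bd: "simplex_bd {x} = {}" and sy: "simplex {y} = {{y}}"
    by (auto simp: simplex_bd_def simplex_def)
  have ess: "essential (Subdiv {x} y) (simplex \<sigma>)"
    using assms by (auto simp: simplex_def verts_def)
  have lk: "link {x} (simplex \<sigma>) = simplex (\<sigma> - {x})"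
    using assms by (auto simp: link_def simplex_def)
  have rest: "simplex \<sigma> - star {x} (simplex \<sigma>) = simplex (\<sigma> - {x})"
    by (auto simp: star_def simplex_def)
  have "simplex (\<sigma> - {x}) \<union> ({{y}} \<star> simplex (\<sigma> - {x})) = simplex (insert y (\<sigma> - {x}))"
    (is "?l = ?r")
  proof
    show "?l \<subseteq> ?r"
      by (auto simp: join_def simplex_def)
    show "?r \<subseteq> ?l"
    proof
      fix \<tau> assume \<tau>: "\<tau> \<in> ?r"
      show "\<tau> \<in> ?l"
      proof (cases "y \<in> \<tau> \<and> \<tau> \<noteq> {y}")
        case True
        then have "\<tau> = {y} \<union> (\<tau> - {y})" "\<tau> - {y} \<in> simplex (\<sigma> - {x})"
          using \<tau> by (auto simp: simplex_def)
        then show ?thesis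
          unfolding join_def by blast
      next
        case False
        then show ?thesis
          using \<tau> by (auto simp: simplex_def join_def)
      qed
    qed
  qed
  then show ?thesis
    using ess by (simp add: bd sy lk rest)
qed

lemma subdiv_vertex_simplex_bd:
  assumes "x \<in> \<sigma>" and "y \<notin> \<sigma>"
  shows "apply_move (Subdiv {x} y) (simplex_bd \<sigma>) = simplex_bd (insert y (\<sigma> - {x}))"
proof (cases "\<sigma> = {x}")
  case True
  then show ?thesis
    by (auto simp: simplex_bd_def simplex_def)
next
  case False
  have bd: "simplex_bd {x} = {}" and sy: "simplex {y} = {{y}}"
    by (auto simp: simplex_bd_def simplex_def)
  have ess: "essential (Subdiv {x} y) (simplex_bd \<sigma>)"
    using assms False by (auto simp: simplex_def simplex_bd_def verts_def)
  have lk: "link {x} (simplex_bd \<sigma>) = simplex_bd (\<sigma> - {x})"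
    using assms by (auto simp: link_def simplex_def simplex_bd_def)
  have rest: "simplex_bd \<sigma> - star {x} (simplex_bd \<sigma>) = simplex (\<sigma> - {x})"
    using assms by (auto simp: star_def simplex_def simplex_bd_def)
  have "simplex (\<sigma> - {x}) \<union> ({{y}} \<star> simplex_bd (\<sigma> - {x})) = simplex_bd (insert y (\<sigma> - {x}))"
    (is "?l = ?r")
  proof
    show "?l \<subseteq> ?r"
      using assms False by (auto simp: join_def simplex_def simplex_bd_def)
    show "?r \<subseteq> ?l"
    proof
      fix \<tau> assume \<tau>: "\<tau> \<in> ?r"
      show "\<tau> \<in> ?l"
      proof (cases "y \<in> \<tau> \<and> \<tau> \<noteq> {y}")
        case True
        then have "\<tau> = {y} \<union> (\<tau> - {y})" "\<tau> - {y} \<in> simplex_bd (\<sigma> - {x})"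
          using \<tau> by (auto simp: simplex_def simplex_bd_def)
        then show ?thesis
          unfolding join_def by blast
      next
        case False
        then show ?thesis
          using \<tau> by (auto simp: simplex_def simplex_bd_def join_def)
      qed
    qed
  qed
  then show ?thesis
    using ess by (simp add: bd sy lk rest)
qed

lemma stellar_equiv_relabel:
  assumes "finite \<sigma>" and "finite \<tau>" and "card \<sigma> = card \<tau>"
  shows "stellar_equiv (simplex \<sigma>) (simplex \<tau>)"
    and "stellar_equiv (simplex_bd \<sigma>) (simplex_bd \<tau>)"
proof -
  have "stellar_equiv (simplex \<sigma>) (simplex \<tau>) \<and> stellar_equiv (simplex_bd \<sigma>) (simplex_bd \<tau>)"
    using assms
  proof (induction "card (\<sigma> - \<tau>)" arbitrary: \<sigma>)
    case 0
    then have "\<sigma> = \<tau>"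
      by (simp add: card_subset_eq)
    then show ?case
      by simp
  next
    case (Suc m)
    obtain x where x: "x \<in> \<sigma>" "x \<notin> \<tau>"
      using Suc.hyps(2) by (metis Diff_eq_empty_iff card.empty nat.distinct(1) subsetI)
    obtain y where y: "y \<in> \<tau>" "y \<notin> \<sigma>"
      using Suc.prems x by (metis card_subset_eq subsetI)
    let ?\<rho> = "insert y (\<sigma> - {x})"
    have "?\<rho> - \<tau> = (\<sigma> - \<tau>) - {x}"
      using y by auto
    then have "m = card (?\<rho> - \<tau>)"
      using Suc.hyps(2) Suc.prems(1) x by simp
    moreover have "card ?\<rho> = card \<tau>"
      using Suc.prems x y by (simp add: card_Suc_Diff1 del: card_Diff_insert card_Diff_singleton)
    ultimately have IH: "stellar_equiv (simplex ?\<rho>) (simplex \<tau>)"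
        "stellar_equiv (simplex_bd ?\<rho>) (simplex_bd \<tau>)"
      using Suc.hyps(1)[of ?\<rho>] Suc.prems by auto
    have "stellar_step (simplex \<sigma>) (simplex ?\<rho>)" "stellar_step (simplex_bd \<sigma>) (simplex_bd ?\<rho>)"
      unfolding stellar_step_def
      using Suc.prems subdiv_vertex_simplex[OF x(1) y(2)] subdiv_vertex_simplex_bd[OF x(1) y(2)]
      by (metis finite.insertI finite_Diff is_complex_simplex,
          metis finite.insertI finite_Diff is_complex_simplex_bd)
    then show ?case
      using IH by (meson equivclp_trans r_into_equivclp)
  qed
  then show "stellar_equiv (simplex \<sigma>) (simplex \<tau>)"
    "stellar_equiv (simplex_bd \<sigma>) (simplex_bd \<tau>)" by simp_all
qed

lemma stellar_ball_iff:
  assumes "finite \<sigma>" and "card \<sigma> = n + 1"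
  shows "stellar_ball n A \<longleftrightarrow> stellar_equiv (simplex \<sigma>) A"
  unfolding stellar_ball_def
  using assms by (metis stellar_equiv_relabel(1) equivclp_trans)

lemma stellar_sphere_iff:
  assumes "finite \<sigma>" and "card \<sigma> = n + 1"
  shows "stellar_sphere (int n - 1) A \<longleftrightarrow> stellar_equiv (simplex_bd \<sigma>) A"
proof -
  have "stellar_sphere (int n - 1) A \<longleftrightarrow>
      (\<exists>\<tau>. finite \<tau> \<and> card \<tau> = n + 1 \<and> stellar_equiv (simplex_bd \<tau>) A)"
    by (auto simp: stellar_sphere_def)
  then show ?thesis
    using assms by (metis stellar_equiv_relabel(2) equivclp_trans)
qed

lemma stellar_ball_nat: "stellar_ball n A \<longleftrightarrow> stellar_equiv (simplex {0..n}) A"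
  by (rule stellar_ball_iff) simp_all

lemma stellar_sphere_nat: "stellar_sphere (int n - 1) A \<longleftrightarrow> stellar_equiv (simplex_bd {0..n}) A"
  by (rule stellar_sphere_iff) simp_all

end

theory Submission
  imports Defs "HOL-Combinatorics.Transposition"
begin

text \<open>
  Let \<open>S\<close> be the boundary of the ball \<open>B\<close>. Call two complexes equivalent rel \<open>V\<close> if they are
  connected by subdivisions and welds whose bases are not contained in \<open>V\<close> and whose apices lie
  outside \<open>V\<close>; the goal is that \<open>B\<close> is equivalent rel \<open>verts S\<close> to a cone on \<open>S\<close>. Such moves
  can be carried out in any complex obtained by glueing something to \<open>B\<close> along vertices in \<open>V\<close>.

  For a tame ball the links of boundary faces are again tame balls, so by induction on the dimension
  they can be starred. Hence the star of a boundary face \<open>A\<close> of \<open>B\<close> can be replaced by a cone on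
  its boundary sphere, which turns \<open>B\<close> into the ball subdivided at \<open>A\<close> with a prism over the
  subdivided star glued on. Consequently, being starrable is invariant under subdivisions of the
  boundary and under adding or removing collars, as long as all balls in question are tame.

  The balls in a sequence of moves from a simplex to \<open>B\<close> need not be tame. They become tame
  after adding a collar whose outer boundary contains no old vertex, and then every move of the ball is
  a strongly internal move or a subdivision of the outer boundary. So starrability with a collar passes
  along the whole sequence, starting with the simplex, and the collar of \<open>B\<close> can be removed at the end.
\<close>

section \<open>Augmented complexes\<close>

text \<open>Moves of \<open>eqv V\<close> neither create nor destroy a face inside \<open>V\<close>:
  such a face contains no admissible base and no new apex. In the cone on \<open>S\<close> the only
  faces inside \<open>verts S\<close> are those of \<open>S\<close>, so tameness is forced, and it
  turns out to be the only obstruction. It also passes to links of boundary faces, which makes the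
  induction possible. The obstacle is that a chain of moves from a simplex to \<open>B\<close>
  disregards the boundary. What is carried along the chain is \<open>collar_starrable\<close>, and
  this works only because the choice of the collar is immaterial: two collars are compared by
  splitting pushes and changing their order. Most comparisons of two triangulations are flips, that
  is, two subdivisions with a common result; this reduces the geometry to membership conditions. The
  boundary is computed from the parity of links. Joining with the boundary of a simplex keeps the
  parity, so this boundary commutes with subdivision before anything is known about the links; for
  balls it is the boundary of the definition.\<close>

text \<open>
  In contrast to \<open>is_complex\<close>, the complexes used here contain the empty face. Subdivision and
  links are then given by membership conditions without exceptions for empty faces.
\<close>

definition cpx :: "'a set set \<Rightarrow> bool" where
  "cpx K \<longleftrightarrow> finite K \<and> {} \<in> K \<and> (\<forall>\<tau>\<in>K. finite \<tau> \<and> (\<forall>\<rho>. \<rho> \<subseteq> \<tau> \<longrightarrow> \<rho> \<in> K))"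

text \<open>Membership is tested face by face, so subdivision commutes with unions and renamings,
  and for fresh \<open>s\<close> a base that lies in no face changes nothing. A face through
  \<open>s\<close> is tested by what it spans with \<sigma>: its part off \<open>s\<close> then lies
  in the join of \<partial>\<sigma> with the link of \<sigma>.\<close>

definition subdiv :: "'a set \<Rightarrow> 'a \<Rightarrow> 'a set set \<Rightarrow> 'a set set" where
  "subdiv \<sigma> s K = {\<tau>. \<not> \<sigma> \<subseteq> \<tau> \<and> (if s \<in> \<tau> then (\<tau> - {s}) \<union> \<sigma> \<in> K else \<tau> \<in> K)}"

definition lk :: "'a set \<Rightarrow> 'a set set \<Rightarrow> 'a set set" where
  "lk A K = {\<tau>. \<tau> \<inter> A = {} \<and> \<tau> \<union> A \<in> K}"

text \<open>For \<open>A \<in> S\<close> and \<open>a \<notin> verts S\<close> this is the join of the full simplex on \<open>A \<union> {a}\<close> with the link of \<open>A\<close> in \<open>S\<close>.\<close>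

definition prism :: "'a set \<Rightarrow> 'a \<Rightarrow> 'a set set \<Rightarrow> 'a set set" where
  "prism A a S = {\<tau>. (\<tau> - {a}) \<union> A \<in> S}"

definition cone :: "'a \<Rightarrow> 'a set set \<Rightarrow> 'a set set" where
  "cone v S = {\<tau>. \<tau> - {v} \<in> S}"

text \<open>The join of the boundary of the simplex \<open>\<kappa>\<close> with \<open>L\<close>, for \<open>\<kappa>\<close> disjoint from the vertices of \<open>L\<close>.\<close>

definition join_bd :: "'a set \<Rightarrow> 'a set set \<Rightarrow> 'a set set" where
  "join_bd \<kappa> L = {\<tau>. \<tau> - \<kappa> \<in> L \<and> \<not> \<kappa> \<subseteq> \<tau>}"

text \<open>The condition \<open>\<not> \<sigma> \<subseteq> V\<close> also excludes the empty base,
  and \<open>cpx K\<close> ensures that a chain starting at a complex never leaves the finite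
  complexes.\<close>

definition step :: "'a set \<Rightarrow> 'a set set \<Rightarrow> 'a set set \<Rightarrow> bool" where
  "step V K K' \<longleftrightarrow> cpx K \<and> (\<exists>\<sigma> s. \<sigma> \<in> K \<and> \<not> \<sigma> \<subseteq> V \<and> s \<notin> V \<and> s \<notin> verts K \<and> K' = subdiv \<sigma> s K)"

abbreviation eqv :: "'a set \<Rightarrow> 'a set set \<Rightarrow> 'a set set \<Rightarrow> bool" where
  "eqv V \<equiv> equivclp (step V)"

text \<open>Preimages are used because the membership conditions of \<open>subdiv\<close>,
  \<open>lk\<close>, \<open>cone\<close> and \<open>prism\<close> then commute with a bijection by
  rewriting. For bijections this is the image, see \<open>relabel_eq_image\<close>.\<close>

definition relabel :: "('a \<Rightarrow> 'a) \<Rightarrow> 'a set set \<Rightarrow> 'a set set" where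
  "relabel f K = {\<tau>. f -` \<tau> \<in> K}"

section \<open>Closure properties, vertices and links of the basic constructions\<close>

lemma cpx_down: "cpx K \<Longrightarrow> \<tau> \<in> K \<Longrightarrow> \<rho> \<subseteq> \<tau> \<Longrightarrow> \<rho> \<in> K"
  unfolding cpx_def by blast

lemma cpx_finite_face: "cpx K \<Longrightarrow> \<tau> \<in> K \<Longrightarrow> finite \<tau>"
  unfolding cpx_def by blast

lemma cpx_empty: "cpx K \<Longrightarrow> {} \<in> K"
  unfolding cpx_def by blast

lemma finite_verts: "cpx K \<Longrightarrow> finite (verts K)"
  unfolding cpx_def verts_def by blast

lemma face_verts: "\<tau> \<in> K \<Longrightarrow> \<tau> \<subseteq> verts K"
  unfolding verts_def by blast

lemma in_verts_iff: "cpx K \<Longrightarrow> x \<in> verts K \<longleftrightarrow> {x} \<in> K"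
  unfolding verts_def using cpx_down[of K _ "{x}"] by blast

lemma cpxI:
  assumes "finite X" "\<And>\<tau>. \<tau> \<in> K \<Longrightarrow> \<tau> \<subseteq> X" "{} \<in> K"
    "\<And>\<tau> \<rho>. \<tau> \<in> K \<Longrightarrow> \<rho> \<subseteq> \<tau> \<Longrightarrow> \<rho> \<in> K"
  shows "cpx K"
proof -
  have "K \<subseteq> Pow X" using assms(2) by blast
  then show ?thesis
    unfolding cpx_def using assms finite_subset finite_Pow_iff by metis
qed

lemma cpx_Un: "cpx K \<Longrightarrow> cpx L \<Longrightarrow> cpx (K \<union> L)"
  unfolding cpx_def by blast

lemma verts_Un: "verts (K \<union> L) = verts K \<union> verts L"
  unfolding verts_def by blast

lemma verts_mono: "K \<subseteq> L \<Longrightarrow> verts K \<subseteq> verts L"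
  unfolding verts_def by blast

lemma ex_fresh:
  fixes F :: "'a::infinite set"
  assumes "finite F"
  obtains a where "a \<notin> F"
  using ex_new_if_finite[OF infinite_UNIV assms] by blast

lemma subdiv_Un: "subdiv \<sigma> s (K \<union> L) = subdiv \<sigma> s K \<union> subdiv \<sigma> s L"
  unfolding subdiv_def by auto

lemma subdiv_id:
  assumes "\<And>\<tau>. \<tau> \<in> K \<Longrightarrow> \<not> \<sigma> \<subseteq> \<tau>" "s \<notin> verts K"
  shows "subdiv \<sigma> s K = K"
  using assms unfolding subdiv_def verts_def by auto

lemma cpx_subdiv:
  assumes K: "cpx K" and "\<sigma> \<noteq> {}"
  shows "cpx (subdiv \<sigma> s K)"
proof (rule cpxI)
  show "finite (insert s (verts K))" using finite_verts[OF K] by simp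
  show "\<tau> \<subseteq> insert s (verts K)" if "\<tau> \<in> subdiv \<sigma> s K" for \<tau>
    using that face_verts[of \<tau> K] face_verts[of "\<tau> - {s} \<union> \<sigma>" K]
    unfolding subdiv_def by (auto split: if_splits)
  show "{} \<in> subdiv \<sigma> s K" using assms cpx_empty[OF K] unfolding subdiv_def by auto
  show "\<rho> \<in> subdiv \<sigma> s K" if "\<tau> \<in> subdiv \<sigma> s K" "\<rho> \<subseteq> \<tau>" for \<tau> \<rho>
  proof -
    have "\<rho> - {s} \<union> \<sigma> \<subseteq> \<tau> - {s} \<union> \<sigma>" "s \<notin> \<rho> \<Longrightarrow> \<rho> \<subseteq> \<tau> - {s} \<union> \<sigma>" using that by auto
    then show ?thesis using that cpx_down[OF K] unfolding subdiv_def by (auto split: if_splits)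
  qed
qed

lemma verts_subdiv_subset: "verts (subdiv \<sigma> s K) \<subseteq> insert s (verts K)"
  unfolding verts_def subdiv_def by (auto split: if_splits)

lemma new_vertex_subdiv:
  assumes "\<sigma> \<in> K" "\<sigma> \<noteq> {}" "s \<notin> \<sigma>"
  shows "s \<in> verts (subdiv \<sigma> s K)"
proof -
  have "{s} \<in> subdiv \<sigma> s K" using assms unfolding subdiv_def by auto
  then show ?thesis unfolding verts_def by blast
qed

lemma face_not_fresh: "\<sigma> \<in> K \<Longrightarrow> s \<notin> verts K \<Longrightarrow> s \<notin> \<sigma>"
  unfolding verts_def by blast

lemma cpx_prism:
  assumes S: "cpx S" and "A \<in> S"
  shows "cpx (prism A a S)"
proof (rule cpxI)
  show "finite (insert a (verts S))" using finite_verts[OF S] by simp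
  show "\<tau> \<subseteq> insert a (verts S)" if "\<tau> \<in> prism A a S" for \<tau>
    using that face_verts[of "\<tau> - {a} \<union> A" S] unfolding prism_def by auto
  show "{} \<in> prism A a S" using assms unfolding prism_def by auto
  show "\<rho> \<in> prism A a S" if "\<tau> \<in> prism A a S" "\<rho> \<subseteq> \<tau>" for \<tau> \<rho>
    using that cpx_down[OF S, of "\<tau> - {a} \<union> A" "\<rho> - {a} \<union> A"] unfolding prism_def by auto
qed

lemma verts_prism_subset: "verts (prism A a S) \<subseteq> insert a (verts S)"
  unfolding verts_def prism_def by auto

lemma cpx_cone:
  assumes S: "cpx S"
  shows "cpx (cone v S)"
proof (rule cpxI)
  show "finite (insert v (verts S))" using finite_verts[OF S] by simp
  show "\<tau> \<subseteq> insert v (verts S)" if "\<tau> \<in> cone v S" for \<tau>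
    using that face_verts[of "\<tau> - {v}" S] unfolding cone_def by auto
  show "{} \<in> cone v S" using cpx_empty[OF S] unfolding cone_def by auto
  show "\<rho> \<in> cone v S" if "\<tau> \<in> cone v S" "\<rho> \<subseteq> \<tau>" for \<tau> \<rho>
    using that cpx_down[OF S, of "\<tau> - {v}" "\<rho> - {v}"] unfolding cone_def by auto
qed

lemma verts_cone: "cpx S \<Longrightarrow> verts (cone v S) = insert v (verts S)"
proof -
  assume S: "cpx S"
  have "{v} \<in> cone v S" using cpx_empty[OF S] unfolding cone_def by simp
  moreover have "S \<subseteq> cone v S" using cpx_down[OF S] unfolding cone_def by auto
  moreover have "verts (cone v S) \<subseteq> insert v (verts S)" unfolding verts_def cone_def by auto
  ultimately show ?thesis unfolding verts_def by blast
qed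

lemma cpx_lk:
  assumes K: "cpx K" and A: "A \<in> K"
  shows "cpx (lk A K)"
proof (rule cpxI)
  show "finite (verts K)" using finite_verts[OF K] by simp
  show "\<tau> \<subseteq> verts K" if "\<tau> \<in> lk A K" for \<tau>
    using that face_verts[of "\<tau> \<union> A" K] unfolding lk_def by auto
  show "{} \<in> lk A K" using A unfolding lk_def by auto
  show "\<rho> \<in> lk A K" if "\<tau> \<in> lk A K" "\<rho> \<subseteq> \<tau>" for \<tau> \<rho>
    using that cpx_down[OF K, of "\<tau> \<union> A" "\<rho> \<union> A"] unfolding lk_def by auto
qed

lemma verts_lk_subset: "verts (lk A K) \<subseteq> verts K - A"
  unfolding verts_def lk_def by auto

lemma lk_Un: "lk A (K \<union> L) = lk A K \<union> lk A L"
  unfolding lk_def by auto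

lemma lk_lk: "\<tau> \<inter> A = {} \<Longrightarrow> lk \<tau> (lk A K) = lk (A \<union> \<tau>) K"
proof (rule set_eqI)
  fix \<rho> assume *: "\<tau> \<inter> A = {}"
  have e: "\<rho> \<union> \<tau> \<union> A = \<rho> \<union> (A \<union> \<tau>)" by blast
  show "\<rho> \<in> lk \<tau> (lk A K) \<longleftrightarrow> \<rho> \<in> lk (A \<union> \<tau>) K"
    unfolding lk_def mem_Collect_eq e using * by blast
qed

text \<open>Joining \<open>A\<close> to a face turns each test in \<open>subdiv\<close> with
  \<sigma> into the same test in the link with \<open>\<sigma> - A\<close>.\<close>

lemma lk_subdiv:
  assumes "\<not> \<sigma> \<subseteq> A" "s \<notin> A"
  shows "lk A (subdiv \<sigma> s K) = subdiv (\<sigma> - A) s (lk A K)"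
proof (rule set_eqI)
  fix \<tau>
  have e: "(\<tau> \<union> A - {s}) \<union> \<sigma> = (\<tau> - {s} \<union> (\<sigma> - A)) \<union> A" "\<sigma> \<subseteq> \<tau> \<union> A \<longleftrightarrow> \<sigma> - A \<subseteq> \<tau>"
    "s \<in> \<tau> \<union> A \<longleftrightarrow> s \<in> \<tau>" "(\<tau> - {s} \<union> (\<sigma> - A)) \<inter> A = {} \<longleftrightarrow> \<tau> \<inter> A = {}"
    using assms(2) by blast+
  show "\<tau> \<in> lk A (subdiv \<sigma> s K) \<longleftrightarrow> \<tau> \<in> subdiv (\<sigma> - A) s (lk A K)"
    unfolding lk_def subdiv_def mem_Collect_eq e if_bool_eq_conj by argo
qed

section \<open>Equivalence rel a set of vertices\<close>

lemma step_cpx: "step V K K' \<Longrightarrow> cpx K \<and> cpx K'"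
  unfolding step_def by (auto intro!: cpx_subdiv)

lemma stepI: "cpx K \<Longrightarrow> \<sigma> \<in> K \<Longrightarrow> \<not> \<sigma> \<subseteq> V \<Longrightarrow> s \<notin> V \<Longrightarrow> s \<notin> verts K \<Longrightarrow> step V K (subdiv \<sigma> s K)"
  unfolding step_def by blast

lemma stepE:
  assumes "step V K K'"
  obtains \<sigma> s where "cpx K" "\<sigma> \<in> K" "\<not> \<sigma> \<subseteq> V" "s \<notin> V" "s \<notin> verts K" "K' = subdiv \<sigma> s K"
  using assms unfolding step_def by blast

lemma eqv_subdiv: "cpx K \<Longrightarrow> \<sigma> \<in> K \<Longrightarrow> \<not> \<sigma> \<subseteq> V \<Longrightarrow> s \<notin> V \<Longrightarrow> s \<notin> verts K \<Longrightarrow> eqv V K (subdiv \<sigma> s K)"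
  by (rule r_into_equivclp, rule stepI)

lemma eqv_cpx:
  assumes "eqv V K K'"
  shows "cpx K \<longleftrightarrow> cpx K'"
  using assms by (induction rule: equivclp_induct) (auto dest: step_cpx)

text \<open>A weld is a subdivision read backwards, so in the third case the property passes from
  the subdivided complex to the coarser one.\<close>

lemma eqv_induct [consumes 2, case_names base subdiv weld]:
  assumes "eqv V K K'" "cpx K" "P K"
    "\<And>L \<sigma> s. eqv V K L \<Longrightarrow> cpx L \<Longrightarrow> \<sigma> \<in> L \<Longrightarrow> \<not> \<sigma> \<subseteq> V \<Longrightarrow> s \<notin> V \<Longrightarrow> s \<notin> verts L \<Longrightarrow> P L \<Longrightarrow> P (subdiv \<sigma> s L)"
    "\<And>L \<sigma> s. eqv V K L \<Longrightarrow> cpx L \<Longrightarrow> \<sigma> \<in> L \<Longrightarrow> \<not> \<sigma> \<subseteq> V \<Longrightarrow> s \<notin> V \<Longrightarrow> s \<notin> verts L \<Longrightarrow> P (subdiv \<sigma> s L) \<Longrightarrow> P L"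
  shows "P K'"
  using assms(1)
proof (induction rule: equivclp_induct)
  case base
  then show ?case by (rule assms(3))
next
  case (step y z)
  have yz: "eqv V K z" using step(1,2) by (metis equivclp_into_equivclp)
  from step(2) show ?case
  proof
    assume "step V y z"
    then show ?thesis using assms(4)[OF step(1)] step(3) unfolding step_def by blast
  next
    assume "step V z y"
    then show ?thesis using assms(5)[OF yz] step(3) unfolding step_def by blast
  qed
qed

lemma equivclp_map:
  assumes "equivclp r a b" "\<And>x y. r x y \<Longrightarrow> q (f x) (f y)"
  shows "equivclp q (f a) (f b)"
  using assms(1)
proof (induction rule: equivclp_induct)
  case (step y z)
  then show ?case using assms(2) by (metis equivclp_into_equivclp)
qed simp

lemma eqv_mono:
  assumes "eqv V K K'" "V' \<subseteq> V"
  shows "eqv V' K K'"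
proof -
  have "step V L L' \<Longrightarrow> step V' L L'" for L L'
    unfolding step_def using assms(2) by blast
  then show ?thesis
    using assms(1) equivclp_map[of "step V" K K' "step V'" "\<lambda>x. x"] by blast
qed

text \<open>A base not inside \<open>V\<close> is contained in no face of \<open>Q\<close>, and an
  apex outside \<open>V\<close> is no vertex of \<open>Q\<close>, so each move leaves
  \<open>Q\<close> as it is. This is the purpose of both conditions on \<open>V\<close> in
  \<open>step\<close>.\<close>

lemma eqv_glue:
  assumes "eqv V K K'" "cpx K" "cpx Q" "verts Q \<subseteq> V"
  shows "eqv V (K \<union> Q) (K' \<union> Q)"
proof -
  have *: "eqv V (L \<union> Q) (subdiv \<sigma> s L \<union> Q)"
    if "cpx L" "\<sigma> \<in> L" "\<not> \<sigma> \<subseteq> V" "s \<notin> V" "s \<notin> verts L" for L \<sigma> s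
  proof -
    have "subdiv \<sigma> s Q = Q"
      by (rule subdiv_id) (use that assms(4) in \<open>auto simp: verts_def\<close>)
    moreover have "eqv V (L \<union> Q) (subdiv \<sigma> s (L \<union> Q))"
      by (rule eqv_subdiv) (use that assms in \<open>auto simp: cpx_Un verts_Un\<close>)
    ultimately show ?thesis by (simp add: subdiv_Un)
  qed
  have "eqv V (L \<union> Q) (L' \<union> Q)" if "step V L L'" for L L'
    using that by (elim stepE) (auto intro: *)
  with assms(1) show ?thesis
  proof (induction rule: equivclp_induct)
    case (step y z)
    then show ?case by (metis equivclp_sym equivclp_trans)
  qed simp
qed

section \<open>Renaming of vertices\<close>

lemma bij_vimage_image: "bij f \<Longrightarrow> f -` (f ` X) = X"
  by (simp add: bij_is_inj inj_vimage_image_eq)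

lemma relabel_eq_image: "bij f \<Longrightarrow> relabel f K = (`) f ` K"
proof
  assume f: "bij f"
  show "relabel f K \<subseteq> (`) f ` K"
  proof
    fix \<tau> assume "\<tau> \<in> relabel f K"
    then have "f -` \<tau> \<in> K" "\<tau> = f ` (f -` \<tau>)" using f by (auto simp: relabel_def bij_is_surj)
    then show "\<tau> \<in> (`) f ` K" by blast
  qed
  show "(`) f ` K \<subseteq> relabel f K" using f by (auto simp: relabel_def bij_vimage_image)
qed

lemma verts_relabel: "bij f \<Longrightarrow> verts (relabel f K) = f ` verts K"
  unfolding verts_def by (auto simp: relabel_eq_image)

lemma cpx_relabel:
  assumes "bij f" "cpx K"
  shows "cpx (relabel f K)"
proof (rule cpxI)
  show "finite (f ` verts K)" using finite_verts[OF assms(2)] by simp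
  show "\<tau> \<subseteq> f ` verts K" if "\<tau> \<in> relabel f K" for \<tau>
    using that verts_relabel[OF assms(1), of K] face_verts[of \<tau> "relabel f K"] by simp
  show "{} \<in> relabel f K" using cpx_empty[OF assms(2)] unfolding relabel_def by simp
  show "\<rho> \<in> relabel f K" if "\<tau> \<in> relabel f K" "\<rho> \<subseteq> \<tau>" for \<tau> \<rho>
    using that cpx_down[OF assms(2), of "f -` \<tau>" "f -` \<rho>"] unfolding relabel_def by auto
qed

lemma vimage_singleton: "bij f \<Longrightarrow> f -` {f s} = {s}"
  using bij_vimage_image[of f "{s}"] by simp

lemma image_subset_vimage: "f ` \<sigma> \<subseteq> \<tau> \<longleftrightarrow> \<sigma> \<subseteq> f -` \<tau>"
  by auto

lemma relabel_subdiv: "bij f \<Longrightarrow> relabel f (subdiv \<sigma> s K) = subdiv (f ` \<sigma>) (f s) (relabel f K)"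
  unfolding relabel_def subdiv_def
  by (simp add: image_subset_vimage vimage_Diff vimage_Un vimage_singleton bij_vimage_image)

lemma relabel_cone: "bij f \<Longrightarrow> relabel f (cone v K) = cone (f v) (relabel f K)"
  unfolding relabel_def cone_def by (simp add: vimage_Diff vimage_singleton)

lemma relabel_prism: "bij f \<Longrightarrow> relabel f (prism A a K) = prism (f ` A) (f a) (relabel f K)"
  unfolding relabel_def prism_def by (simp add: vimage_Diff vimage_Un vimage_singleton bij_vimage_image)

lemma relabel_lk: "bij f \<Longrightarrow> relabel f (lk A K) = lk (f ` A) (relabel f K)"
proof -
  assume f: "bij f"
  have "f -` \<tau> \<inter> A = {} \<longleftrightarrow> \<tau> \<inter> f ` A = {}" for \<tau> by auto
  then show ?thesis unfolding relabel_def lk_def using f by (simp add: vimage_Un bij_vimage_image)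
qed

lemma relabel_Un: "relabel f (K \<union> L) = relabel f K \<union> relabel f L"
  unfolding relabel_def by auto

lemma relabel_fix:
  assumes "bij f" "\<And>x. x \<in> verts K \<Longrightarrow> f x = x"
  shows "relabel f K = K"
proof -
  have "f ` \<tau> = \<tau>" if "\<tau> \<in> K" for \<tau>
    using face_verts[OF that] assms(2) by (simp add: subset_iff)
  then show ?thesis unfolding relabel_eq_image[OF assms(1)] by auto
qed

lemma eqv_relabel:
  assumes "bij f" "eqv V K K'"
  shows "eqv (f ` V) (relabel f K) (relabel f K')"
proof -
  have "step (f ` V) (relabel f L) (relabel f L')" if "step V L L'" for L L'
  proof -
    from that obtain \<sigma> s where *: "cpx L" "\<sigma> \<in> L" "\<not> \<sigma> \<subseteq> V" "s \<notin> V" "s \<notin> verts L" "L' = subdiv \<sigma> s L"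
      unfolding step_def by blast
    have "inj f" using assms(1) by (simp add: bij_is_inj)
    then have "step (f ` V) (relabel f L) (subdiv (f ` \<sigma>) (f s) (relabel f L))"
    proof (intro stepI)
      show "f ` \<sigma> \<in> relabel f L" using * assms(1) by (simp add: relabel_def bij_vimage_image)
    qed (use * assms(1) in \<open>simp_all add: cpx_relabel verts_relabel inj_image_mem_iff inj_image_subset_iff\<close>)
    then show ?thesis using * assms(1) by (simp add: relabel_subdiv)
  qed
  then show ?thesis
    using assms(2) by (rule equivclp_map[rotated])
qed

text \<open>A chain consists of finitely many moves on finite complexes, so it involves finitely
  many vertices; these make up \<open>Y\<close>. Protecting any other vertex affects no base and no
  apex of the chain.\<close>

lemma eqv_avoid:
  assumes "eqv W K K'" "cpx K"
  shows "\<exists>Y. finite Y \<and> (\<forall>z. z \<notin> Y \<longrightarrow> eqv (insert z W) K K')"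
  using assms
proof (induction rule: eqv_induct)
  case base
  show ?case by (rule exI[of _ "{}"]) simp
next
  case (subdiv L \<sigma> s)
  then obtain Y where Y: "finite Y" "\<And>z. z \<notin> Y \<Longrightarrow> eqv (insert z W) K L" by blast
  have "eqv (insert z W) K (subdiv \<sigma> s L)" if "z \<notin> Y \<union> verts L \<union> {s}" for z
    using subdiv that Y(2)[of z]
    by (intro equivclp_trans[OF Y(2)] eqv_subdiv) (auto dest: face_verts)
  then show ?case using Y finite_verts[OF \<open>cpx L\<close>]
    by (intro exI[of _ "Y \<union> verts L \<union> {s}"]) auto
next
  case (weld L \<sigma> s)
  then obtain Y where Y: "finite Y" "\<And>z. z \<notin> Y \<Longrightarrow> eqv (insert z W) K (subdiv \<sigma> s L)" by blast
  have "eqv (insert z W) K L" if "z \<notin> Y \<union> verts L \<union> {s}" for z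
    using weld that Y(2)[of z]
    by (intro equivclp_trans[OF Y(2)] equivclp_sym[OF eqv_subdiv]) (auto dest: face_verts)
  then show ?case using Y finite_verts[OF \<open>cpx L\<close>]
    by (intro exI[of _ "Y \<union> verts L \<union> {s}"]) auto
qed

text \<open>New vertices can always be renamed, so an equivalence can be made to avoid further vertices.\<close>

lemma eqv_freshen1:
  fixes K :: "'a::infinite set set"
  assumes "eqv W K K'" "cpx K" "finite W" "z \<notin> verts K" "z \<notin> verts K'"
  shows "eqv (insert z W) K K'"
proof (cases "z \<in> W")
  case True
  then show ?thesis using assms by (simp add: insert_absorb)
next
  case False
  obtain Y where Y: "finite Y" "\<And>z. z \<notin> Y \<Longrightarrow> eqv (insert z W) K K'"
    using eqv_avoid[OF assms(1,2)] by blast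
  have K': "cpx K'" using eqv_cpx[OF assms(1)] assms(2) by simp
  have "finite (Y \<union> W \<union> verts K \<union> verts K' \<union> {z})"
    using Y assms(3) finite_verts[OF assms(2)] finite_verts[OF K'] by simp
  then obtain z1 where z1: "z1 \<notin> Y \<union> W \<union> verts K \<union> verts K' \<union> {z}" by (rule ex_fresh)
  \<comment> \<open>The chain may protect \<open>z1\<close>; swapping it with \<open>z\<close> gives
    a chain that protects \<open>z\<close>, while the two ends and \<open>W\<close> are fixed by the
    swap.\<close>
  let ?f = "transpose z z1"
  have f: "bij ?f" by simp
  have "eqv (?f ` insert z1 W) (relabel ?f K) (relabel ?f K')"
    by (rule eqv_relabel[OF f Y(2)]) (use z1 in simp)
  moreover have "?f x = x" if "x \<in> W \<union> verts K \<union> verts K'" for x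
    using that z1 False assms(4,5) by (metis UnE UnCI transpose_apply_other)
  then have "relabel ?f K = K" "relabel ?f K' = K'" "?f ` W = W"
    by (auto intro!: relabel_fix[OF f])
  ultimately show ?thesis by simp
qed

lemma eqv_freshen:
  fixes K :: "'a::infinite set set"
  assumes "eqv W K K'" "cpx K" "finite V" "W \<subseteq> V" "V \<inter> verts K \<subseteq> W" "V \<inter> verts K' \<subseteq> W"
  shows "eqv V K K'"
proof -
  have fin: "finite (V - W)" "finite W" using assms finite_subset by auto
  have "eqv (W \<union> Z) K K'" if "finite Z" "Z \<subseteq> V - W" for Z
    using that
  proof (induction Z rule: finite_induct)
    case empty
    then show ?case using assms by simp
  next
    case (insert z Z)
    then have "eqv (insert z (W \<union> Z)) K K'"
      using assms fin by (intro eqv_freshen1) auto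
    then show ?case by simp
  qed
  from this[OF fin(1)] show ?thesis using assms(4) by (simp add: Un_absorb1)
qed

text \<open>
  The hypotheses say that \<open>K'\<close> arises from \<open>K\<close> by replacing the star \<open>\<alpha> \<star> \<partial>\<beta> \<star> M\<close> of \<open>\<alpha>\<close> by
  \<open>\<partial>\<alpha> \<star> \<beta> \<star> M\<close>: both complexes have the same subdivision.
\<close>

lemma flip_eqv:
  assumes K: "cpx K" "cpx K'" and al: "\<alpha> \<in> K" "\<not> \<alpha> \<subseteq> V" and be: "\<beta> \<in> K'" "\<not> \<beta> \<subseteq> V" and "finite V"
    and h1: "\<And>\<rho>. \<not> \<alpha> \<subseteq> \<rho> \<and> \<rho> \<in> K \<longleftrightarrow> \<not> \<beta> \<subseteq> \<rho> \<and> \<rho> \<in> K'"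
    and h2: "\<And>\<rho>. \<not> \<alpha> \<subseteq> \<rho> \<and> \<rho> \<union> \<alpha> \<in> K \<longleftrightarrow> \<not> \<beta> \<subseteq> \<rho> \<and> \<rho> \<union> \<beta> \<in> K'"
  shows "eqv V K (K' :: 'a::infinite set set)"
proof -
  have "finite (V \<union> verts K \<union> verts K')" using assms finite_verts by blast
  then obtain s where s: "s \<notin> V \<union> verts K \<union> verts K'" by (rule ex_fresh)
  have sn: "s \<notin> \<alpha>" "s \<notin> \<beta>" using s al be face_verts by blast+
  have "\<tau> \<in> subdiv \<alpha> s K \<longleftrightarrow> \<tau> \<in> subdiv \<beta> s K'" for \<tau>
  proof -
    have "\<alpha> \<subseteq> \<tau> \<longleftrightarrow> \<alpha> \<subseteq> \<tau> - {s}" "\<beta> \<subseteq> \<tau> \<longleftrightarrow> \<beta> \<subseteq> \<tau> - {s}" using sn by auto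
    then show ?thesis
      unfolding subdiv_def mem_Collect_eq if_bool_eq_conj using h1[of \<tau>] h2[of "\<tau> - {s}"] by argo
  qed
  then have "subdiv \<alpha> s K = subdiv \<beta> s K'" by blast
  moreover have "eqv V K (subdiv \<alpha> s K)" "eqv V K' (subdiv \<beta> s K')"
    using assms s by (auto intro!: eqv_subdiv)
  ultimately show ?thesis by (metis equivclp_sym equivclp_trans)
qed

section \<open>Starring the star of a boundary face\<close>

definition starrable :: "'a set set \<Rightarrow> 'a set set \<Rightarrow> bool" where
  "starrable K S \<longleftrightarrow> (\<exists>v. v \<notin> verts S \<and> eqv (verts S) K (cone v S))"

definition tame_rel :: "'a set set \<Rightarrow> 'a set set \<Rightarrow> bool" where
  "tame_rel K S \<longleftrightarrow> (\<forall>\<tau>\<in>K. \<tau> \<subseteq> verts S \<longrightarrow> \<tau> \<in> S)"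

section \<open>Cones and the freedom in the choice of the apex\<close>

lemma cone_rename:
  assumes S: "cpx S" and v: "v \<notin> verts S" "v' \<notin> verts S" "v \<noteq> v'"
  shows "subdiv {v} v' (cone v S) = cone v' S"
proof (rule set_eqI)
  fix \<tau>
  have n: "v \<notin> X" "v' \<notin> X" if "X \<in> S" for X using that v face_verts by blast+
  have e: "(\<tau> - {v'} \<union> {v}) - {v} = \<tau> - {v'} - {v}" by blast
  have f: "v \<notin> \<tau> \<Longrightarrow> \<tau> - {v'} - {v} = \<tau> - {v'}" "v' \<notin> \<tau> \<Longrightarrow> \<tau> - {v'} = \<tau>" "v \<notin> \<tau> \<Longrightarrow> \<tau> - {v} = \<tau>" by blast+
  show "\<tau> \<in> subdiv {v} v' (cone v S) \<longleftrightarrow> \<tau> \<in> cone v' S"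
  proof (cases "v \<in> \<tau>")
    case True
    then have "v \<in> \<tau> - {v'}" using v by blast
    then have "\<tau> - {v'} \<notin> S" using n by blast
    with True show ?thesis unfolding subdiv_def cone_def by simp
  next
    case False
    then show ?thesis unfolding subdiv_def cone_def mem_Collect_eq e using f by auto
  qed
qed

lemma eqv_cone_rename:
  assumes S: "cpx S" and v: "v \<notin> V" "v' \<notin> V" "verts S \<subseteq> V"
  shows "eqv V (cone v S) (cone v' S)"
proof (cases "v = v'")
  case False
  have "eqv V (cone v S) (subdiv {v} v' (cone v S))"
  proof (rule eqv_subdiv[OF cpx_cone[OF S]])
    show "{v} \<in> cone v S" using cpx_empty[OF S] by (simp add: cone_def)
    show "v' \<notin> verts (cone v S)" using v False by (auto simp: verts_cone[OF S])
  qed (use v in auto)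
  moreover have "subdiv {v} v' (cone v S) = cone v' S" by (rule cone_rename[OF S]) (use v False in auto)
  ultimately show ?thesis by simp
qed simp

text \<open>The definition of \<open>starrable\<close> leaves the apex open and protects only
  \<open>verts S\<close>. Renaming the apex and the vertices introduced by the chain allows any apex
  outside any finite \<open>V\<close> that meets \<open>K\<close> only in \<open>verts S\<close>.
  This is the form needed before gluing.\<close>

lemma starrable_at:
  fixes K :: "'a::infinite set set"
  assumes "starrable K S" "cpx K" "cpx S" "finite V" "V \<inter> verts K = verts S" "v' \<notin> V"
  shows "eqv V K (cone v' S)"
proof -
  obtain v where v: "v \<notin> verts S" "eqv (verts S) K (cone v S)" using assms(1) unfolding starrable_def by blast
  have subdiv: "verts S \<subseteq> V" using assms(5) by blast
  have "eqv (verts S) (cone v S) (cone v' S)"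
    by (rule eqv_cone_rename) (use assms v subdiv in auto)
  then have "eqv (verts S) K (cone v' S)" using v(2) by (metis equivclp_trans)
  then show ?thesis
    by (rule eqv_freshen) (use assms subdiv in \<open>auto simp: verts_cone\<close>)
qed

lemma starrable_eqv: "eqv (verts S) K K' \<Longrightarrow> starrable K' S \<longleftrightarrow> starrable K S"
  unfolding starrable_def by (metis equivclp_sym equivclp_trans)

lemma starrable_cone: "v \<notin> verts S \<Longrightarrow> starrable (cone v S) S"
  unfolding starrable_def by (intro exI[of _ v]) simp

lemma starrable_relabel:
  assumes "bij f" "starrable K S"
  shows "starrable (relabel f K) (relabel f S)"
proof -
  obtain v where v: "v \<notin> verts S" "eqv (verts S) K (cone v S)" using assms(2) unfolding starrable_def by blast
  have "eqv (f ` verts S) (relabel f K) (relabel f (cone v S))" using eqv_relabel[OF assms(1) v(2)] .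
  moreover have "f v \<notin> f ` verts S" using v(1) assms(1) by (simp add: bij_is_inj inj_image_mem_iff)
  ultimately show ?thesis unfolding starrable_def by (auto simp: relabel_cone verts_relabel assms(1))
qed

lemma relabel_transpose_twice: "relabel (transpose y z) (relabel (transpose y z) K) = K"
  unfolding relabel_def by (simp add: vimage_comp)

text \<open>A move based at a vertex is just a renaming. This is why singleton bases are always
  treated separately, by transport along a transposition.\<close>

lemma subdiv_singleton_relabel:
  assumes "z \<notin> verts K"
  shows "subdiv {y} z K = relabel (transpose y z) K"
proof (cases "y = z")
  case True
  have "X \<in> K \<Longrightarrow> z \<notin> X" for X using assms face_verts by blast
  then show ?thesis unfolding True subdiv_def relabel_def by auto
next
  case False
  show ?thesis
  proof (rule set_eqI)
    fix \<tau>
    have n: "z \<notin> X" if "X \<in> K" for X using assms face_verts that by blast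
    have v: "transpose y z -` \<tau> = (\<tau> - {y,z}) \<union> (if z \<in> \<tau> then {y} else {}) \<union> (if y \<in> \<tau> then {z} else {})"
      using False by (auto simp: transpose_def split: if_splits)
    show "\<tau> \<in> subdiv {y} z K \<longleftrightarrow> \<tau> \<in> relabel (transpose y z) K"
    proof (cases "y \<in> \<tau>")
      case True
      then show ?thesis using n unfolding subdiv_def relabel_def mem_Collect_eq v by auto
    next
      case yt: False
      have "z \<in> \<tau> \<Longrightarrow> \<tau> - {z} \<union> {y} = \<tau> - {y,z} \<union> {y}" "z \<notin> \<tau> \<Longrightarrow> \<tau> - {y,z} = \<tau>"
        using yt by auto
      then show ?thesis using yt unfolding subdiv_def relabel_def mem_Collect_eq v by auto
    qed
  qed
qed

text \<open>For chains inside a link: the apex chosen there may already be a vertex elsewhere in the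
  ambient complex and then has to be exchanged.\<close>

lemma relabel_subdiv_fresh:
  assumes "t \<notin> verts K" "t' \<notin> verts K" "\<sigma> \<in> K"
  shows "relabel (transpose t t') (subdiv \<sigma> t K) = subdiv \<sigma> t' K"
proof -
  have f: "bij (transpose t t')" by simp
  have fx: "transpose t t' x = x" if "x \<in> verts K" for x
    using that assms by (metis transpose_apply_other)
  have "transpose t t' ` \<sigma> = \<sigma>" using fx face_verts[OF assms(3)] by (simp add: subset_iff)
  moreover have "relabel (transpose t t') K = K" by (rule relabel_fix[OF f fx])
  ultimately show ?thesis by (simp add: relabel_subdiv[OF f])
qed

text \<open>
  If \<open>L = lk A K\<close> is a ball with boundary \<open>lk A S\<close>, then the complex on the right is \<open>K\<close> with
  the star of \<open>A\<close> replaced by the cone with apex \<open>a\<close> on its boundary. The property is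
  transferred along the moves that star \<open>L\<close>.
\<close>

definition star_replaceable :: "'a set \<Rightarrow> 'a set set \<Rightarrow> 'a set \<Rightarrow> 'a set set \<Rightarrow> bool" where
  "star_replaceable A S V L \<longleftrightarrow> (\<forall>K a. cpx K \<longrightarrow> A \<in> K \<longrightarrow> lk A K = L \<longrightarrow> a \<notin> V \<longrightarrow> a \<notin> verts K \<longrightarrow>
     eqv V K (subdiv A a K \<union> prism A a S))"

lemma star_replaceable_D: "star_replaceable A S V L \<Longrightarrow> cpx K \<Longrightarrow> A \<in> K \<Longrightarrow> lk A K = L \<Longrightarrow> a \<notin> V \<Longrightarrow> a \<notin> verts K \<Longrightarrow>
     eqv V K (subdiv A a K \<union> prism A a S)"
  unfolding star_replaceable_def by blast

text \<open>The transposition moves nothing in \<open>V\<close>, so it fixes \<open>A\<close>,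
  \<open>S\<close> and \<open>V\<close>. A complex whose link is the renamed \<open>L\<close> is
  renamed back, replaced, and renamed again.\<close>

lemma star_replaceable_relabel:
  assumes star_replaceable: "star_replaceable A S V L" and A: "A \<in> S" and V: "verts S \<subseteq> V" and y: "y \<notin> V" "z \<notin> V"
  shows "star_replaceable A S V (relabel (transpose y z) L)"
  unfolding star_replaceable_def
proof (intro allI impI)
  fix K a assume K: "cpx K" "A \<in> K" "lk A K = relabel (transpose y z) L" "a \<notin> V" "a \<notin> verts K"
  let ?f = "transpose y z"
  have f: "bij ?f" by simp
  have fx: "?f x = x" if "x \<in> V" for x using that y by (metis transpose_apply_other)
  have AV: "A \<subseteq> V" using A V face_verts by blast
  have fA: "?f ` A = A" using fx AV by (simp add: subset_iff)
  have fV: "?f ` V = V" using fx by simp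
  have fS: "relabel ?f S = S" by (rule relabel_fix[OF f]) (use fx V in blast)
  have "eqv V (relabel ?f K) (subdiv A (?f a) (relabel ?f K) \<union> prism A (?f a) S)"
  proof (rule star_replaceable_D[OF star_replaceable])
    show "cpx (relabel ?f K)" by (rule cpx_relabel[OF f K(1)])
    show "A \<in> relabel ?f K" using K(2) bij_vimage_image[OF f, of A] unfolding relabel_def fA by simp
    show "lk A (relabel ?f K) = L" using relabel_lk[OF f, of A K] fA K(3) relabel_transpose_twice by metis
    show "?f a \<notin> V" using K(4) fV by (metis image_eqI transpose_involutory)
    show "?f a \<notin> verts (relabel ?f K)" using K(5) by (simp add: verts_relabel[OF f] inj_image_mem_iff)
  qed
  from eqv_relabel[OF f this] show "eqv V K (subdiv A a K \<union> prism A a S)"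
    by (simp add: fV relabel_Un relabel_subdiv[OF f] relabel_prism[OF f] fA fS relabel_transpose_twice)
qed

text \<open>The star of \<open>A\<close> is the join of \<open>A\<close>, \<open>w\<close> and
  \<open>lk A S\<close>, so one subdivision at \<open>A \<union> {w}\<close> suffices: the boundary
  of this simplex consists of \<open>A\<close>, which yields the prism, and of the join of
  \<open>w\<close> with \<partial>A, which yields the subdivided star.\<close>

lemma star_replaceable_cone:
  assumes S: "cpx S" and A: "A \<in> S" "A \<noteq> {}" and V: "verts S \<subseteq> V" and w: "w \<notin> V"
  shows "star_replaceable A S V (cone w (lk A S))"
  unfolding star_replaceable_def
proof (intro allI impI)
  fix K a assume K: "cpx K" "A \<in> K" "lk A K = cone w (lk A S)" "a \<notin> V" "a \<notin> verts K"
  have wA: "w \<notin> A" using w V A face_verts by blast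
  have aA: "a \<notin> A" using K face_verts by blast
  have k: "X \<in> K \<longleftrightarrow> X - {w} \<in> S" if "A \<subseteq> X" for X
  proof -
    have "X - A \<in> lk A K \<longleftrightarrow> X - A \<in> cone w (lk A S)" using K(3) by simp
    moreover have "X - A \<union> A = X" "X - A - {w} \<union> A = X - {w}" using that wA by blast+
    ultimately show ?thesis unfolding lk_def cone_def by auto
  qed
  have n: "w \<notin> X" "a \<notin> X" if "X \<in> S" for X using that w K(4) V face_verts by blast+
  have "A \<union> {w} - {w} = A" using wA by blast
  then have Aw: "A \<union> {w} \<in> K" using k[of "A \<union> {w}"] A by auto
  then have "eqv V K (subdiv (A \<union> {w}) a K)" using K w by (intro eqv_subdiv) auto
  moreover have "subdiv (A \<union> {w}) a K = subdiv A a K \<union> prism A a S"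
  proof (rule set_eqI)
    fix \<tau>
    have aw: "a \<noteq> w" using Aw K(5) face_verts by blast
    have e: "\<tau> - {a} \<union> A - {w} = \<tau> - {a} - {w} \<union> A" "(\<tau> - {a} \<union> (A \<union> {w})) - {w} = \<tau> - {a} - {w} \<union> A"
      using wA by blast+
    have k1: "\<tau> - {a} \<union> (A \<union> {w}) \<in> K \<longleftrightarrow> \<tau> - {a} - {w} \<union> A \<in> S"
      "\<tau> - {a} \<union> A \<in> K \<longleftrightarrow> \<tau> - {a} - {w} \<union> A \<in> S" "A \<subseteq> \<tau> \<Longrightarrow> \<tau> \<in> K \<longleftrightarrow> \<tau> - {w} \<in> S"
      "\<tau> \<union> A \<in> K \<longleftrightarrow> \<tau> \<union> A - {w} \<in> S"
      using k[of "\<tau> - {a} \<union> (A \<union> {w})"] k[of "\<tau> - {a} \<union> A"] k[of \<tau>] k[of "\<tau> \<union> A"] unfolding e by blast+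
    have k2: "\<tau> - {a} \<union> A \<in> S \<Longrightarrow> w \<notin> \<tau>" using n[of "\<tau> - {a} \<union> A"] aw by blast
    have k3: "w \<notin> \<tau> \<Longrightarrow> \<tau> - {a} - {w} \<union> A = \<tau> - {a} \<union> A" "w \<notin> \<tau> \<Longrightarrow> \<tau> - {w} = \<tau>" by blast+
    have k4: "A \<union> {w} \<subseteq> \<tau> \<longleftrightarrow> A \<subseteq> \<tau> \<and> w \<in> \<tau>" by blast
    have k5: "a \<notin> \<tau> \<Longrightarrow> \<tau> - {a} = \<tau>" "A \<subseteq> \<tau> \<Longrightarrow> \<tau> \<union> A = \<tau>" by blast+
    have k6: "\<tau> \<union> A \<in> S \<Longrightarrow> \<tau> \<in> K"
    proof -
      assume h: "\<tau> \<union> A \<in> S"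
      then have "\<tau> \<union> A - {w} = \<tau> \<union> A" using n(1) by blast
      then have "\<tau> \<union> A \<in> K" using h k1(4) by simp
      then show "\<tau> \<in> K" using cpx_down[OF K(1)] by blast
    qed
    show "\<tau> \<in> subdiv (A \<union> {w}) a K \<longleftrightarrow> \<tau> \<in> subdiv A a K \<union> prism A a S"
    proof (cases "a \<in> \<tau>")
      case True
      then show ?thesis unfolding subdiv_def prism_def mem_Collect_eq Un_iff k4
        using k1(1,2) k2 k3 by (cases "w \<in> \<tau>") auto
    next
      case False
      then show ?thesis unfolding subdiv_def prism_def mem_Collect_eq Un_iff k4
        using k1(3) k2 k3 k5 k6 by (cases "w \<in> \<tau>"; cases "A \<subseteq> \<tau>") auto
    qed
  qed
  ultimately show "eqv V K (subdiv A a K \<union> prism A a S)" by simp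
qed

text \<open>Once \<open>A\<close> is starred with \<open>a\<close>, what remains of the star of
  \<open>A \<union> \<tau>\<close> are faces through \<open>a\<close> and \<tau>; so the
  corresponding base is \<open>insert a \<tau>\<close>.\<close>

lemma subdiv_subdiv_cone:
  assumes "a \<noteq> t" "a \<notin> \<tau> \<union> A" "t \<notin> \<tau> \<union> A" "\<tau> \<inter> A = {}" "\<tau> \<noteq> {}"
  shows "subdiv A a (subdiv (A \<union> \<tau>) t K) = subdiv (insert a \<tau>) t (subdiv A a K)"
proof (rule set_eqI)
  fix \<rho>
  have e: "A \<subseteq> \<rho> - {t} \<union> insert a \<tau> \<longleftrightarrow> A \<subseteq> \<rho>" "t \<in> \<rho> - {a} \<union> A \<longleftrightarrow> t \<in> \<rho>"
    "a \<in> \<rho> - {t} \<union> insert a \<tau> \<longleftrightarrow> True" "A \<union> \<tau> \<subseteq> \<rho> - {a} \<union> A \<longleftrightarrow> \<tau> \<subseteq> \<rho>" "insert a \<tau> \<subseteq> \<rho> \<longleftrightarrow> a \<in> \<rho> \<and> \<tau> \<subseteq> \<rho>"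
    "A \<union> \<tau> \<subseteq> \<rho> \<longleftrightarrow> A \<subseteq> \<rho> \<and> \<tau> \<subseteq> \<rho>" "\<rho> - {a} \<union> A - {t} \<union> (A \<union> \<tau>) = \<rho> - {t} \<union> insert a \<tau> - {a} \<union> A"
    using assms by blast+
  have "a \<notin> \<rho> \<Longrightarrow> \<rho> - {t} \<union> (A \<union> \<tau>) = \<rho> - {t} \<union> insert a \<tau> - {a} \<union> A"
    using assms by blast
  then have e8: "a \<notin> \<rho> \<longrightarrow> (\<rho> - {t} \<union> (A \<union> \<tau>) \<in> K \<longleftrightarrow> \<rho> - {t} \<union> insert a \<tau> - {a} \<union> A \<in> K)"
    by simp
  show "\<rho> \<in> subdiv A a (subdiv (A \<union> \<tau>) t K) \<longleftrightarrow> \<rho> \<in> subdiv (insert a \<tau>) t (subdiv A a K)"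
    unfolding subdiv_def mem_Collect_eq e if_bool_eq_conj using e8 by argo
qed

lemma D_subdiv:
  assumes S: "cpx S" and V: "verts S \<subseteq> V" and t: "t \<notin> V" "\<not> \<tau> \<subseteq> V"
    and "a \<noteq> t" "a \<notin> \<tau> \<union> A" "t \<notin> \<tau> \<union> A" "\<tau> \<inter> A = {}"
  shows "subdiv A a (subdiv (A \<union> \<tau>) t K) \<union> prism A a S = subdiv (insert a \<tau>) t (subdiv A a K \<union> prism A a S)"
proof -
  have "subdiv (insert a \<tau>) t (prism A a S) = prism A a S"
  proof (rule subdiv_id)
    have *: "verts (prism A a S) \<subseteq> insert a V" using verts_prism_subset[of A a S] V by blast
    then show "t \<notin> verts (prism A a S)" using assms by blast
    show "\<not> insert a \<tau> \<subseteq> \<rho>" if "\<rho> \<in> prism A a S" for \<rho>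
      using face_verts[OF that] * assms by blast
  qed
  moreover have "\<tau> \<noteq> {}" using t by blast
  ultimately show ?thesis using assms by (simp add: subdiv_Un subdiv_subdiv_cone)
qed

text \<open>A subdivision of the link at \<tau> is induced by the subdivision of \<open>K\<close> at
  \<open>A \<union> \<tau>\<close>. After the star has been replaced, it is undone by a weld with
  base \<open>insert a \<tau>\<close>.\<close>

lemma star_replaceable_subdiv:
  fixes L :: "'a::infinite set set"
  assumes S: "cpx S" and A: "A \<in> S" "A \<noteq> {}" and V: "verts S \<subseteq> V" "finite V"
    and L: "\<tau> \<in> L" "\<not> \<tau> \<subseteq> V" "t \<notin> V" "t \<notin> verts L" and star_replaceable: "star_replaceable A S V (subdiv \<tau> t L)"
  shows "star_replaceable A S V L"
  unfolding star_replaceable_def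
proof (intro allI impI)
  fix K a assume K: "cpx K" "A \<in> K" "lk A K = L" "a \<notin> V" "a \<notin> verts K"
  have "finite (V \<union> verts K \<union> {a, t})" using V finite_verts[OF K(1)] by simp
  \<comment> \<open>The vertex \<open>t\<close> is not in the link but may occur elsewhere in
    \<open>K\<close>, hence a fresh name.\<close>
  then obtain t' where t': "t' \<notin> V \<union> verts K \<union> {a, t}" by (rule ex_fresh)
  have vL: "verts L \<subseteq> verts K - A" using verts_lk_subset[of A K] K(3) by simp
  have \<tau>: "\<tau> \<inter> A = {}" "\<tau> \<union> A \<in> K" using L(1) K(3) unfolding lk_def by blast+
  have "relabel (transpose t t') (subdiv \<tau> t L) = subdiv \<tau> t' L"
    by (rule relabel_subdiv_fresh) (use L t' vL in auto)
  then have PA': "star_replaceable A S V (subdiv \<tau> t' L)" using star_replaceable_relabel[OF star_replaceable A(1) V(1), of t t'] L t' by simp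
  let ?K1 = "subdiv (A \<union> \<tau>) t' K"
  have tn: "t' \<notin> \<tau> \<union> A" "a \<notin> \<tau> \<union> A" using t' \<tau>(2) K(5) face_verts by blast+
  have K1: "cpx ?K1" using K(1) A by (intro cpx_subdiv) auto
  have s1: "eqv V K ?K1" using K \<tau> t' L(2) by (intro eqv_subdiv) (auto simp: Un_commute)
  have "\<not> A \<union> \<tau> \<subseteq> A" using \<tau>(1) L(2) by blast
  then have "lk A ?K1 = subdiv (A \<union> \<tau> - A) t' (lk A K)" by (rule lk_subdiv) (use tn in auto)
  moreover have "A \<union> \<tau> - A = \<tau>" using \<tau>(1) by blast
  ultimately have l1: "lk A ?K1 = subdiv \<tau> t' L" using K(3) by simp
  have A1: "A \<in> ?K1" using K(2) tn \<open>\<not> A \<union> \<tau> \<subseteq> A\<close> unfolding subdiv_def by auto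
  have a1: "a \<notin> verts ?K1" using verts_subdiv_subset[of "A \<union> \<tau>" t' K] K(5) t' by blast
  have s2: "eqv V ?K1 (subdiv A a ?K1 \<union> prism A a S)" by (rule star_replaceable_D[OF PA' K1 A1 l1 K(4) a1])
  have e: "subdiv A a ?K1 \<union> prism A a S = subdiv (insert a \<tau>) t' (subdiv A a K \<union> prism A a S)"
    by (rule D_subdiv[OF S V(1)]) (use t' L tn \<tau> in auto)
  have "cpx (subdiv A a K \<union> prism A a S)" by (intro cpx_Un cpx_subdiv[OF K(1) A(2)] cpx_prism[OF S A(1)])
  moreover have "insert a \<tau> \<in> subdiv A a K"
    using A tn \<tau> unfolding subdiv_def by (auto simp: Diff_insert_absorb)
  moreover have "t' \<notin> verts (subdiv A a K \<union> prism A a S)"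
    using verts_subdiv_subset[of A a K] verts_prism_subset[of A a S] t' V(1) unfolding verts_Un by blast
  ultimately have "eqv V (subdiv A a K \<union> prism A a S) (subdiv (insert a \<tau>) t' (subdiv A a K \<union> prism A a S))"
    using t' L(2) by (intro eqv_subdiv) auto
  then show "eqv V K (subdiv A a K \<union> prism A a S)"
    using s1 s2 e by (metis equivclp_sym equivclp_trans)
qed

lemma mem_subdiv: "\<tau> \<in> subdiv \<sigma> s K \<longleftrightarrow> \<not> \<sigma> \<subseteq> \<tau> \<and> (if s \<in> \<tau> then \<tau> - {s} \<union> \<sigma> \<in> K else \<tau> \<in> K)"
  unfolding subdiv_def by simp

text \<open>
  A face welded in the link may already exist elsewhere in \<open>K\<close>. Replacing one of its vertices \<open>y\<close>
  inside the star of \<open>A\<close> by a new vertex \<open>y'\<close> (subdivide \<open>A \<union> {y}\<close>) prevents this.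
\<close>

lemma star_replaceable_weld:
  fixes L1 :: "'a::infinite set set"
  assumes S: "cpx S" and A: "A \<in> S" "A \<noteq> {}" and V: "verts S \<subseteq> V" "finite V"
    and L: "cpx L1" "\<tau> \<in> L1" "\<not> \<tau> \<subseteq> V" "t \<notin> V" "t \<notin> verts L1" and star_replaceable: "star_replaceable A S V L1"
  shows "star_replaceable A S V (subdiv \<tau> t L1)"
proof (cases "\<exists>y. \<tau> = {y}")
  case True
  then obtain y where y: "\<tau> = {y}" by blast
  then have "subdiv \<tau> t L1 = relabel (transpose y t) L1" using subdiv_singleton_relabel[OF L(5)] by simp
  moreover have "y \<notin> V" using y L by simp
  ultimately show ?thesis using star_replaceable_relabel[OF star_replaceable A(1) V(1)] L(4) by simp
next
  case big: False
  obtain y where y: "y \<in> \<tau>" "y \<notin> V" using L(3) by blast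
  have tt: "t \<notin> \<tau>" using face_not_fresh[OF L(2,5)] .
  have \<tau>y: "\<not> \<tau> \<subseteq> {x}" for x using big y(1) by blast
  show ?thesis
    unfolding star_replaceable_def
  proof (intro allI impI)
    fix K a assume K: "cpx K" "A \<in> K" "lk A K = subdiv \<tau> t L1" "a \<notin> V" "a \<notin> verts K"
    let ?L = "subdiv \<tau> t L1"
    have "finite (V \<union> verts K \<union> {a, t} \<union> verts L1)" using V finite_verts[OF K(1)] finite_verts[OF L(1)] by simp
    then obtain y' where y': "y' \<notin> V \<union> verts K \<union> {a, t} \<union> verts L1" by (rule ex_fresh)
    let ?f = "transpose y y'"
    have f: "bij ?f" by simp
    have vL: "verts ?L \<subseteq> verts K - A" using verts_lk_subset[of A K] K(3) by simp
    have vL1: "x \<in> verts ?L" if "x \<in> verts L1" for x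
    proof -
      have "{x} \<in> L1" "x \<noteq> t" using that L(5) in_verts_iff[OF L(1)] by auto
      then have "{x} \<in> ?L" using \<tau>y unfolding subdiv_def by auto
      then show ?thesis unfolding verts_def by blast
    qed
    have tL: "t \<in> verts ?L" by (rule new_vertex_subdiv) (use L tt in auto)
    have yL: "y \<in> verts ?L" using vL1 y L face_verts by blast
    have AV: "A \<subseteq> V" using A V face_verts by blast
    have at: "a \<noteq> t" "a \<noteq> y" "y \<noteq> t" "y' \<noteq> y" "y' \<noteq> a" "y' \<noteq> t" using tL yL vL K(5) tt y y' by auto
    let ?t = "?f ` \<tau>" let ?M = "relabel ?f L1" let ?K1 = "subdiv (A \<union> {y}) y' K"
    have y't: "y' \<in> ?t" using y(1) by (metis imageI transpose_apply_first)
    have ft: "?f t = t" using at by (metis transpose_apply_other)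
    have tnt: "t \<notin> ?t" using tt ft by (metis f bij_is_inj inj_image_mem_iff)
    have vM: "verts ?M \<subseteq> (verts ?L - {y}) \<union> {y'}"
    proof -
      have "?f x \<in> (verts ?L - {y}) \<union> {y'}" if "x \<in> verts L1" for x
        using vL1[OF that] that y' by (cases "x = y") (auto simp: transpose_def)
      then show ?thesis by (auto simp: verts_relabel[OF f])
    qed
    have tM: "t \<notin> verts ?M" using L(5) ft by (metis f bij_is_inj inj_image_mem_iff verts_relabel)
    have tauM: "?t \<in> ?M" using L(2) unfolding relabel_def by (simp add: bij_vimage_image[OF f])
    have cM: "cpx ?M" by (rule cpx_relabel[OF f L(1)])
    have Ay: "A \<union> {y} \<in> K"
    proof -
      have "{y} \<in> lk A K" using yL K(3) in_verts_iff[OF cpx_lk[OF K(1,2)]] by simp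
      then show ?thesis unfolding lk_def by (simp add: Un_commute)
    qed
    have nA: "y \<notin> A" "y' \<notin> A" "t \<notin> A" "a \<notin> A" using AV y y' L K by auto
    have K1: "cpx ?K1" by (rule cpx_subdiv[OF K(1)]) simp
    have s1: "eqv V K ?K1" by (rule eqv_subdiv[OF K(1) Ay]) (use y y' in auto)
    have vK1: "verts ?K1 \<subseteq> insert y' (verts K)" by (rule verts_subdiv_subset)
    have "lk A ?K1 = subdiv (A \<union> {y} - A) y' (lk A K)" by (rule lk_subdiv) (use nA in auto)
    also have "A \<union> {y} - A = {y}" using nA by blast
    also have "subdiv {y} y' (lk A K) = relabel ?f ?L" unfolding K(3) by (rule subdiv_singleton_relabel) (use vL y' in auto)
    also have "\<dots> = subdiv ?t t ?M" using relabel_subdiv[OF f, of \<tau> t L1] ft by simp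
    finally have l1: "lk A ?K1 = subdiv ?t t ?M" .
    have A1: "A \<in> ?K1" using K(2) nA unfolding subdiv_def by auto
    have MA: "verts ?M \<inter> A = {}" using vM vL nA by blast
    have tA: "?t \<inter> A = {}" using tauM MA face_verts by blast
    have MX: "X \<inter> A = {}" "t \<notin> X" if "X \<in> ?M" for X using MA tM face_verts[OF that] by blast+
    have f1: "X \<in> ?K1 \<longleftrightarrow> X - A \<in> subdiv ?t t ?M" if "A \<subseteq> X" for X
    proof -
      have "X - A \<in> lk A ?K1 \<longleftrightarrow> X - A \<in> subdiv ?t t ?M" using l1 by simp
      moreover have "X - A \<union> A = X" "(X - A) \<inter> A = {}" using that by blast+
      ultimately show ?thesis unfolding lk_def by auto
    qed
    \<comment> \<open>This is what the new name achieves: a face of \<open>?K1\<close> containing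
      \<open>?t\<close> contains \<open>y'\<close>, hence would give
      \<open>\<tau> \<union> A \<in> K\<close>, although \<tau> has been subdivided in the link of
      \<open>A\<close>.\<close>
    have f2: "\<not> ?t \<subseteq> \<rho>" if "\<rho> \<in> ?K1" for \<rho>
    proof
      assume "?t \<subseteq> \<rho>"
      then have "?t \<in> ?K1" using cpx_down[OF K1 that] by blast
      then have "?t - {y'} \<union> (A \<union> {y}) \<in> K" using y't unfolding subdiv_def by auto
      moreover have "?t - {y'} \<union> (A \<union> {y}) = \<tau> \<union> A"
      proof -
        have "y' \<notin> \<tau>" using y' L(2) face_verts by blast
        then have "?t = \<tau> - {y} \<union> {y'}" using y(1) by (auto simp: transpose_def)
        then show ?thesis using y(1) \<open>y' \<notin> \<tau>\<close> by blast
      qed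
      moreover have "\<tau> \<inter> A = {}" using vL1 L(2) vL face_verts by blast
      ultimately have "\<tau> \<in> lk A K" unfolding lk_def by simp
      then show False using K(3) unfolding subdiv_def by simp
    qed
    \<comment> \<open>The link of \<open>?al\<close> in \<open>?K1\<close> is the join of
      \<partial>\<open>?t\<close> with the link of \<open>?t\<close> in \<open>?M\<close>, so the
      flip from \<open>?al\<close> to \<open>?t\<close> undoes the subdivision of the link. It
      requires that \<open>?t\<close> is not yet a face, which is \<open>f2\<close>.\<close>
    let ?al = "insert t A"
    let ?K3 = "{\<rho>\<in>?K1. \<not> ?al \<subseteq> \<rho>} \<union> {\<rho>. ?t \<subseteq> \<rho> \<and> \<not> ?al \<subseteq> \<rho> \<and> \<rho> - ?al \<in> ?M}"
    have f3: "X - A \<in> subdiv ?t t ?M \<longleftrightarrow> \<not> ?t \<subseteq> X \<and> X - ?al \<union> ?t \<in> ?M" if "t \<in> X" for X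
    proof -
      have "?t \<subseteq> X - A \<longleftrightarrow> ?t \<subseteq> X" "X - A - {t} = X - ?al" "t \<in> X - A" using tA that nA by blast+
      then show ?thesis unfolding subdiv_def by simp
    qed
    have f3': "X - A \<in> subdiv ?t t ?M \<longleftrightarrow> \<not> ?t \<subseteq> X \<and> X - A \<in> ?M" if "t \<notin> X" for X
    proof -
      have "?t \<subseteq> X - A \<longleftrightarrow> ?t \<subseteq> X" "t \<notin> X - A" using tA that nA by blast+
      then show ?thesis unfolding subdiv_def by auto
    qed
    have alK1: "?al \<in> ?K1"
    proof -
      have "?al - ?al \<union> ?t = ?t" "\<not> ?t \<subseteq> ?al" using tnt tA y't by blast+
      then show ?thesis using f1[of ?al] f3[of ?al] tauM by auto
    qed
    have f4: "\<rho> \<in> ?K1" if "\<rho>' - ?al \<in> ?M" "?t \<subseteq> \<rho>'" "\<rho> \<subseteq> \<rho>'" "\<not> ?t \<subseteq> \<rho>" for \<rho> \<rho>'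
    proof -
      let ?X = "(\<rho> - ?al) \<union> ?al"
      have "?X - ?al \<union> ?t \<subseteq> \<rho>' - ?al" using that tnt tA by blast
      then have "?X - ?al \<union> ?t \<in> ?M" using cpx_down[OF cM that(1)] by blast
      moreover have "\<not> ?t \<subseteq> ?X" using that(4) tnt tA by blast
      ultimately have "?X \<in> ?K1" using f1[of ?X] f3[of ?X] by auto
      then show ?thesis using cpx_down[OF K1, of ?X \<rho>] by blast
    qed
    have K3: "cpx ?K3"
    proof (rule cpxI)
      show "finite (verts ?K1 \<union> verts ?M \<union> ?al)"
        using finite_verts[OF K1] finite_verts[OF cM] cpx_finite_face[OF S A(1)] by simp
      show "\<rho> \<subseteq> verts ?K1 \<union> verts ?M \<union> ?al" if "\<rho> \<in> ?K3" for \<rho>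
        using that face_verts[of \<rho> ?K1] face_verts[of "\<rho> - ?al" ?M] by blast
      show "{} \<in> ?K3" using cpx_empty[OF K1] by simp
      show "\<rho> \<in> ?K3" if "\<rho>' \<in> ?K3" "\<rho> \<subseteq> \<rho>'" for \<rho>' \<rho>
      proof (cases "\<rho>' \<in> ?K1")
        case True
        then show ?thesis using that cpx_down[OF K1 True that(2)] by blast
      next
        case False
        then have h: "?t \<subseteq> \<rho>'" "\<not> ?al \<subseteq> \<rho>'" "\<rho>' - ?al \<in> ?M" using that by auto
        show ?thesis
        proof (cases "?t \<subseteq> \<rho>")
          case True
          moreover have "\<rho> - ?al \<in> ?M" by (rule cpx_down[OF cM h(3)]) (use that in auto)
          ultimately show ?thesis using h that by auto
        next
          case False
          then show ?thesis using f4[OF h(3,1) that(2)] h that by auto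
        qed
      qed
    qed
    have tinK3: "?t \<in> ?K3"
    proof -
      have "?t - ?al = ?t" "\<not> ?al \<subseteq> ?t" using tnt tA by blast+
      then show ?thesis using tauM by simp
    qed
    have s2: "eqv V ?K1 ?K3"
    proof (rule flip_eqv[OF K1 K3 alK1 _ tinK3 _ V(2)])
      show "\<not> ?al \<subseteq> V" using L by simp
      show "\<not> ?t \<subseteq> V" using y't y' by blast
      show "\<not> ?al \<subseteq> \<rho> \<and> \<rho> \<in> ?K1 \<longleftrightarrow> \<not> ?t \<subseteq> \<rho> \<and> \<rho> \<in> ?K3" for \<rho>
        using f2[of \<rho>] by blast
      show "\<not> ?al \<subseteq> \<rho> \<and> \<rho> \<union> ?al \<in> ?K1 \<longleftrightarrow> \<not> ?t \<subseteq> \<rho> \<and> \<rho> \<union> ?t \<in> ?K3" for \<rho>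
      proof -
        have 1: "\<rho> \<union> ?al \<in> ?K1 \<longleftrightarrow> \<not> ?t \<subseteq> \<rho> \<union> ?al \<and> \<rho> \<union> ?al - ?al \<union> ?t \<in> ?M"
          using f1[of "\<rho> \<union> ?al"] f3[of "\<rho> \<union> ?al"] by auto
        have 2: "?t \<subseteq> \<rho> \<union> ?al \<longleftrightarrow> ?t \<subseteq> \<rho>" "\<rho> \<union> ?al - ?al \<union> ?t = \<rho> \<union> ?t - ?al"
          "?al \<subseteq> \<rho> \<union> ?t \<longleftrightarrow> ?al \<subseteq> \<rho>" using tnt tA by blast+
        have "\<rho> \<union> ?t \<notin> ?K1" using f2 by blast
        then have 3: "\<rho> \<union> ?t \<in> ?K3 \<longleftrightarrow> \<not> ?al \<subseteq> \<rho> \<union> ?t \<and> \<rho> \<union> ?t - ?al \<in> ?M" by blast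
        show ?thesis unfolding 1 2 3 by argo
      qed
    qed
    have l3: "lk A ?K3 = ?M"
    proof (rule set_eqI)
      fix \<rho>
      show "\<rho> \<in> lk A ?K3 \<longleftrightarrow> \<rho> \<in> ?M"
      proof (cases "\<rho> \<inter> A = {} \<and> t \<notin> \<rho>")
        case True
        then have e: "\<rho> \<union> A - A = \<rho>" "\<rho> \<union> A - ?al = \<rho>" "?t \<subseteq> \<rho> \<union> A \<longleftrightarrow> ?t \<subseteq> \<rho>" "t \<notin> \<rho> \<union> A"
          "\<not> ?al \<subseteq> \<rho> \<union> A" using tA nA by blast+
        have "\<rho> \<union> A \<in> ?K1 \<longleftrightarrow> \<not> ?t \<subseteq> \<rho> \<and> \<rho> \<in> ?M"
          using f1[of "\<rho> \<union> A"] f3'[OF e(4)] e by simp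
        then show ?thesis using True e unfolding lk_def by auto
      next
        case False
        then have "\<rho> \<notin> ?M" using MX by blast
        moreover have "\<rho> \<notin> lk A ?K3" using False unfolding lk_def by auto
        ultimately show ?thesis by blast
      qed
    qed
    have A3: "A \<in> ?K3" using A1 nA by simp
    have vK3: "verts ?K3 \<subseteq> insert y' (verts K)"
    proof -
      have "\<rho> \<subseteq> insert y' (verts K)" if "\<rho> \<in> ?K3" for \<rho>
      proof -
        have "verts ?M \<subseteq> insert y' (verts K)" using vM vL by blast
        moreover have "?al \<subseteq> insert y' (verts K)" using tL vL K(2) face_verts by blast
        ultimately show ?thesis
          using that vK1 face_verts[of \<rho> ?K1] face_verts[of "\<rho> - ?al" ?M] by blast
      qed
      then show ?thesis unfolding verts_def by blast
    qed
    have aK: "a \<notin> verts ?K1" "a \<notin> verts ?K3" using vK1 vK3 K(5) y' by blast+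
    have PA3: "star_replaceable A S V ?M" by (rule star_replaceable_relabel[OF star_replaceable A(1) V(1)]) (use y y' in auto)
    have s3: "eqv V ?K3 (subdiv A a ?K3 \<union> prism A a S)" by (rule star_replaceable_D[OF PA3 K3 A3 l3 K(4) aK(2)])
    let ?D = "\<lambda>K. subdiv A a K \<union> prism A a S"
    have cD: "cpx (?D K)" if "cpx K" for K by (intro cpx_Un cpx_subdiv[OF that A(2)] cpx_prism[OF S A(1)])
    have f5: "X \<in> ?K3 \<longleftrightarrow> X - A \<in> ?M" if "A \<subseteq> X" for X
    proof -
      have "X - A \<in> lk A ?K3 \<longleftrightarrow> X - A \<in> ?M" using l3 by simp
      moreover have "X - A \<union> A = X" "(X - A) \<inter> A = {}" using that by blast+
      ultimately show ?thesis unfolding lk_def by auto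
    qed
    have vpr: "\<rho> \<subseteq> insert a V" if "\<rho> \<in> prism A a S" for \<rho>
      using face_verts[OF that] verts_prism_subset[of A a S] V(1) by blast
    have prt: "t \<notin> \<rho>" "\<not> ?t \<subseteq> \<rho>" if "\<rho> \<in> prism A a S" for \<rho>
      using vpr[OF that] L at y't y' by auto
    have "a \<notin> (verts ?L - {y}) \<union> {y'}" using vL K(5) y' by auto
    then have "a \<notin> verts ?M" using vM by (rule contra_subsetD[rotated])
    then have anM: "a \<notin> ?t" using face_verts[OF tauM] by (rule contra_subsetD[rotated])
    \<comment> \<open>After \<open>A\<close> has been starred by \<open>a\<close>, the star of
      \<open>?t\<close> is the join of \<open>?t\<close>, \<partial>\<open>{a,t}\<close>,
      \<partial>A and a link. So the flip is reversed with \<open>{a,t}\<close> in the role of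
      \<open>?al\<close>.\<close>
    have s4: "eqv V (?D ?K3) (?D ?K1)"
    proof (rule flip_eqv[OF cD[OF K3] cD[OF K1] _ _ _ _ V(2), of "?t" "{a,t}"])
      have "\<not> A \<subseteq> ?t" using tA A(2) by blast
      then show "?t \<in> ?D ?K3" using tinK3 anM by (simp add: mem_subdiv[of _ A a])
      show "\<not> ?t \<subseteq> V" using y't y' by blast
      have "\<not> A \<subseteq> {a,t}" using nA A(2) by blast
      moreover have "{a,t} - {a} \<union> A = ?al" using at by blast
      ultimately show "{a,t} \<in> ?D ?K1" using alK1 by (simp add: mem_subdiv[of _ A a])
      show "\<not> {a,t} \<subseteq> V" using L by simp
      fix \<rho>
      have K1no: "\<rho> \<in> ?K1 \<Longrightarrow> \<not> ?t \<subseteq> \<rho>" by (rule f2)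
      have g1: "\<rho> - {a} \<union> A \<in> ?K3 \<longleftrightarrow> \<rho> - {a} - A \<in> ?M"
        using f5[of "\<rho> - {a} \<union> A"] by (simp add: Un_Diff)
      have g2: "t \<notin> \<rho> \<Longrightarrow> \<rho> - {a} \<union> A \<in> ?K1 \<longleftrightarrow> \<not> ?t \<subseteq> \<rho> \<and> \<rho> - {a} - A \<in> ?M"
      proof -
        assume "t \<notin> \<rho>"
        then have "t \<notin> \<rho> - {a} \<union> A" "?t \<subseteq> \<rho> - {a} \<union> A \<longleftrightarrow> ?t \<subseteq> \<rho>" "\<rho> - {a} \<union> A - A = \<rho> - {a} - A"
          using nA tA anM by blast+
        then show ?thesis using f1[of "\<rho> - {a} \<union> A"] f3'[of "\<rho> - {a} \<union> A"] by auto
      qed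
      have g3: "\<rho> - {a} - A \<in> ?M \<Longrightarrow> t \<notin> \<rho>" using MX[of "\<rho> - {a} - A"] nA at by blast
      have g4: "\<not> A \<subseteq> \<rho> \<Longrightarrow> \<not> ?t \<subseteq> \<rho> \<Longrightarrow> \<rho> \<in> ?K3 \<longleftrightarrow> \<rho> \<in> ?K1" by blast
      show "\<not> ?t \<subseteq> \<rho> \<and> \<rho> \<in> ?D ?K3 \<longleftrightarrow> \<not> {a, t} \<subseteq> \<rho> \<and> \<rho> \<in> ?D ?K1"
      proof (cases "\<rho> \<in> prism A a S")
        case True
        then show ?thesis using prt by auto
      next
        case npr: False
        show ?thesis
        proof (cases "a \<in> \<rho>")
          case True
          have 1: "\<rho> \<in> ?D ?K3 \<longleftrightarrow> \<not> A \<subseteq> \<rho> \<and> \<rho> - {a} - A \<in> ?M"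
            using npr True g1 by (simp add: mem_subdiv[of _ A a])
          have 2: "\<rho> \<in> ?D ?K1 \<longleftrightarrow> \<not> A \<subseteq> \<rho> \<and> \<rho> - {a} \<union> A \<in> ?K1"
            using npr True by (simp add: mem_subdiv[of _ A a])
          show ?thesis unfolding 1 2 using g2 g3 True by blast
        next
          case False
          have 1: "\<rho> \<in> ?D ?K3 \<longleftrightarrow> \<not> A \<subseteq> \<rho> \<and> \<rho> \<in> ?K3" using npr False by (simp add: mem_subdiv[of _ A a])
          have 2: "\<rho> \<in> ?D ?K1 \<longleftrightarrow> \<not> A \<subseteq> \<rho> \<and> \<rho> \<in> ?K1" using npr False by (simp add: mem_subdiv[of _ A a])
          show ?thesis unfolding 1 2 using g4 K1no False by blast
        qed
      qed
      have p1: "\<rho> \<union> ?t \<notin> prism A a S" "\<rho> \<union> {a,t} \<notin> prism A a S" using prt by blast+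
      have q: "A \<subseteq> \<rho> \<union> {a,t} \<longleftrightarrow> A \<subseteq> \<rho>" "A \<subseteq> \<rho> \<union> ?t \<longleftrightarrow> A \<subseteq> \<rho>" "a \<in> \<rho> \<union> ?t \<longleftrightarrow> a \<in> \<rho>"
        using nA tA anM by blast+
      have r1: "\<rho> \<union> {a,t} \<in> ?D ?K1 \<longleftrightarrow> \<not> A \<subseteq> \<rho> \<and> \<rho> \<union> {a,t} - {a} \<union> A \<in> ?K1"
        using p1 q(1) by (simp add: mem_subdiv[of _ A a])
      have r2: "\<rho> \<union> {a,t} - {a} \<union> A \<in> ?K1 \<longleftrightarrow> \<not> ?t \<subseteq> \<rho> \<and> \<rho> - {a} - ?al \<union> ?t \<in> ?M"
      proof -
        have "?t \<subseteq> \<rho> \<union> {a,t} - {a} \<union> A \<longleftrightarrow> ?t \<subseteq> \<rho>" "\<rho> \<union> {a,t} - {a} \<union> A - ?al \<union> ?t = \<rho> - {a} - ?al \<union> ?t"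
          "t \<in> \<rho> \<union> {a,t} - {a} \<union> A" using tA tnt anM at by blast+
        then show ?thesis using f1[of "\<rho> \<union> {a,t} - {a} \<union> A"] f3[of "\<rho> \<union> {a,t} - {a} \<union> A"] by auto
      qed
      show "\<not> ?t \<subseteq> \<rho> \<and> \<rho> \<union> ?t \<in> ?D ?K3 \<longleftrightarrow> \<not> {a, t} \<subseteq> \<rho> \<and> \<rho> \<union> {a, t} \<in> ?D ?K1"
      proof (cases "a \<in> \<rho>")
        case True
        have 1: "\<rho> \<union> ?t \<in> ?D ?K3 \<longleftrightarrow> \<not> A \<subseteq> \<rho> \<and> \<rho> \<union> ?t - {a} \<union> A \<in> ?K3"
          using True p1 q by (simp add: mem_subdiv[of _ A a])
        have 2: "\<rho> \<union> ?t - {a} \<union> A \<in> ?K3 \<longleftrightarrow> \<rho> \<union> ?t - {a} - A \<in> ?M"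
          using f5[of "\<rho> \<union> ?t - {a} \<union> A"] by (simp add: Un_Diff)
        have 3: "\<rho> \<union> ?t - {a} - A = \<rho> - {a} - A \<union> ?t" using tA anM by blast
        have 4: "\<rho> - {a} - A \<union> ?t \<in> ?M \<Longrightarrow> t \<notin> \<rho>" using MX(2)[of "\<rho> - {a} - A \<union> ?t"] nA at by blast
        have 5: "t \<notin> \<rho> \<Longrightarrow> \<rho> - {a} - A = \<rho> - {a} - ?al" by blast
        have 6: "\<not> {a, t} \<subseteq> \<rho> \<longleftrightarrow> t \<notin> \<rho>" using True by blast
        show ?thesis unfolding 1 2 3 r1 r2 6 using 4 5 by metis
      next
        case False
        have 1: "\<rho> \<union> ?t \<in> ?D ?K3 \<longleftrightarrow> \<not> A \<subseteq> \<rho> \<and> \<rho> \<union> ?t \<in> ?K3"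
          using False p1 q by (simp add: mem_subdiv[of _ A a])
        have 2: "\<rho> \<union> ?t \<in> ?K3 \<longleftrightarrow> \<not> ?al \<subseteq> \<rho> \<union> ?t \<and> \<rho> \<union> ?t - ?al \<in> ?M" using f2 by blast
        have 3: "\<rho> \<union> ?t - ?al = \<rho> - {a} - ?al \<union> ?t" using tA tnt False by blast
        have 4: "\<not> A \<subseteq> \<rho> \<Longrightarrow> \<not> ?al \<subseteq> \<rho> \<union> ?t" using tA by blast
        have 6: "\<not> {a, t} \<subseteq> \<rho>" using False by blast
        show ?thesis unfolding 1 2 3 r1 r2 using 4 6 by metis
      qed
    qed
    have e5: "?D ?K1 = subdiv (insert a {y}) y' (?D K)"
      by (rule D_subdiv[OF S V(1)]) (use y y' at nA in auto)
    have s5: "eqv V (?D K) (subdiv (insert a {y}) y' (?D K))"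
    proof (rule eqv_subdiv[OF cD[OF K(1)]])
      have "\<not> A \<subseteq> {a, y}" using nA A by blast
      moreover have "{a,y} - {a} \<union> A = A \<union> {y}" using at by blast
      ultimately show "{a, y} \<in> ?D K" using Ay unfolding subdiv_def by simp
      show "\<not> {a, y} \<subseteq> V" using y by simp
      show "y' \<notin> V" using y' by blast
      show "y' \<notin> verts (?D K)"
        using verts_subdiv_subset[of A a K] verts_prism_subset[of A a S] y' V(1) unfolding verts_Un by blast
    qed
    have s6: "eqv V (?D ?K1) (?D K)" unfolding e5 by (rule equivclp_sym[OF s5])
    show "eqv V K (?D K)"
      by (rule equivclp_trans[OF equivclp_trans[OF equivclp_trans[OF equivclp_trans[OF s1 s2] s3] s4] s6])
  qed
qed

text \<open>The link of \<open>A\<close> is starred by assumption; the chain is read from the cone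
  back to \<open>lk A K\<close>, and \<open>star_replaceable\<close> is transferred along it,
  starting from the one case that is a single subdivision.\<close>

lemma starring_boundary_face:
  fixes K :: "'a::infinite set set"
  assumes K: "cpx K" and S: "cpx S" "S \<subseteq> K" and A: "A \<in> S" "A \<noteq> {}"
    and V: "finite V" "V \<inter> verts K = verts S" and a: "a \<notin> V" "a \<notin> verts K"
    and tame: "tame_rel K S" and UA: "starrable (lk A K) (lk A S)"
  shows "eqv V K (subdiv A a K \<union> prism A a S)"
proof -
  have AK: "A \<in> K" using A S by blast
  have cl: "cpx (lk A K)" "cpx (lk A S)" using cpx_lk K S A AK by blast+
  have VS: "verts S \<subseteq> V" using V by blast
  have AV: "A \<subseteq> verts S" using A face_verts by blast
  \<comment> \<open>Tameness enters here: a protected vertex that spans a face with \<open>A\<close>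
    gives a face inside \<open>verts S\<close>, hence a face of \<open>S\<close>. So
    \<open>V\<close> meets the link only in its boundary.\<close>
  have vl: "V \<inter> verts (lk A K) = verts (lk A S)"
  proof
    show "V \<inter> verts (lk A K) \<subseteq> verts (lk A S)"
    proof
      fix x assume x: "x \<in> V \<inter> verts (lk A K)"
      then have "{x} \<in> lk A K" using in_verts_iff[OF cl(1)] by blast
      then have h: "x \<notin> A" "{x} \<union> A \<in> K" unfolding lk_def by auto
      then have "x \<in> verts S" using x V face_verts by blast
      then have "{x} \<union> A \<subseteq> verts S" using AV by blast
      then have "{x} \<union> A \<in> S" using tame h(2) unfolding tame_rel_def by blast
      then have "{x} \<in> lk A S" using h unfolding lk_def by simp
      then show "x \<in> verts (lk A S)" unfolding verts_def by blast
    qed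
    have "lk A S \<subseteq> lk A K" using S unfolding lk_def by blast
    then show "verts (lk A S) \<subseteq> V \<inter> verts (lk A K)"
      using verts_mono verts_lk_subset[of A S] VS by blast
  qed
  obtain w where w: "w \<notin> V" using ex_fresh[OF V(1)] by blast
  have "eqv V (lk A K) (cone w (lk A S))" by (rule starrable_at[OF UA cl V(1) vl w])
  then have "eqv V (cone w (lk A S)) (lk A K)" by (rule equivclp_sym)
  then have "star_replaceable A S V (lk A K)"
    using cpx_cone[OF cl(2)]
  proof (induction rule: eqv_induct)
    case base
    show ?case by (rule star_replaceable_cone[OF S(1) A VS w])
  next
    \<comment> \<open>The names cross over: if the chain from the cone subdivides, a complex with
      the subdivided link is first welded back.\<close>
    case (subdiv L \<sigma> s)
    then show ?case using star_replaceable_weld[OF S(1) A VS V(1)] by blast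
  next
    case (weld L \<sigma> s)
    then show ?case using star_replaceable_subdiv[OF S(1) A VS V(1)] by blast
  qed
  then show ?thesis using star_replaceable_D[OF _ K AK refl a] by blast
qed

section \<open>Pushing out vertices and subdividing the boundary\<close>

lemma subdiv_mono: "S \<subseteq> K \<Longrightarrow> subdiv A a S \<subseteq> subdiv A a K"
  unfolding subdiv_def by auto

lemma subdiv_undo:
  assumes "x' \<notin> verts S"
  shows "subdiv {x'} x (subdiv {x} x' S) = S"
proof -
  have f: "bij (transpose x x')" by simp
  have "x \<notin> transpose x x' ` verts S" using assms by (auto simp: transpose_def)
  then have "x \<notin> verts (relabel (transpose x x') S)" by (simp add: verts_relabel[OF f])
  then show ?thesis
    using subdiv_singleton_relabel[OF assms, of x] subdiv_singleton_relabel[of x "relabel (transpose x x') S" x']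
    by (simp add: transpose_commute[of x' x] relabel_transpose_twice)
qed

lemma verts_push:
  assumes "cpx S" "{x} \<in> S" "x' \<notin> verts S"
  shows "verts (subdiv {x} x' S) = insert x' (verts S - {x})"
proof -
  have f: "bij (transpose x x')" by simp
  have "x \<in> verts S" using assms in_verts_iff[OF assms(1)] by simp
  then have "transpose x x' ` verts S = insert x' (verts S - {x})"
    using assms(3) by (auto simp: transpose_def image_iff)
  then show ?thesis by (simp add: subdiv_singleton_relabel[OF assms(3)] verts_relabel[OF f])
qed

text \<open>A prism over a vertex is the join of the edge \<open>{x, x'}\<close> with the link of
  \<open>x\<close>; it looks the same from both ends of the edge.\<close>

lemma prism_swap:
  assumes "x \<noteq> x'"
  shows "prism {x'} x (subdiv {x} x' S) = prism {x} x' S"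
proof (rule set_eqI)
  fix \<tau>
  have e: "\<tau> - {x} \<union> {x'} - {x'} \<union> {x} = \<tau> - {x'} \<union> {x}" using assms by blast
  have "\<not> {x} \<subseteq> \<tau> - {x} \<union> {x'}" "x' \<in> \<tau> - {x} \<union> {x'}" using assms by blast+
  then show "\<tau> \<in> prism {x'} x (subdiv {x} x' S) \<longleftrightarrow> \<tau> \<in> prism {x} x' S"
    unfolding prism_def mem_subdiv mem_Collect_eq e by simp
qed

text \<open>The boundary of \<open>insert v A\<close> consists of \<open>A\<close> and of the join
  of \<open>v\<close> with \<partial>A. Coned off from \<open>a\<close>, the first part gives the
  prism and the second one lies in the cone on the subdivided boundary.\<close>

lemma cone_star:
  assumes S: "cpx S" and A: "A \<in> S" and v: "v \<notin> verts S" "a \<notin> verts S" "a \<noteq> v"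
  shows "cone v (subdiv A a S) \<union> prism A a S = subdiv (insert v A) a (cone v S)"
proof (rule set_eqI)
  fix \<tau>
  have n: "v \<notin> X" "a \<notin> X" if "X \<in> S" for X using that v face_verts by blast+
  have vA: "v \<notin> A" "a \<notin> A" using n A by auto
  have e: "\<tau> - {v} - {a} \<union> A = \<tau> - {a} - {v} \<union> A" "A \<subseteq> \<tau> - {v} \<longleftrightarrow> A \<subseteq> \<tau>" "a \<in> \<tau> - {v} \<longleftrightarrow> a \<in> \<tau>"
     "\<tau> - {a} \<union> insert v A - {v} = \<tau> - {a} - {v} \<union> A" "insert v A \<subseteq> \<tau> \<longleftrightarrow> v \<in> \<tau> \<and> A \<subseteq> \<tau>"
    using vA v(3) by blast+
  have p1: "\<tau> - {a} \<union> A \<in> S \<Longrightarrow> v \<notin> \<tau>" using n(1)[of "\<tau> - {a} \<union> A"] v(3) by blast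
  have p2: "v \<notin> \<tau> \<Longrightarrow> \<tau> - {a} - {v} \<union> A = \<tau> - {a} \<union> A" "v \<notin> \<tau> \<Longrightarrow> \<tau> - {v} = \<tau>" by blast+
  have p3: "a \<notin> \<tau> \<Longrightarrow> \<tau> - {a} = \<tau>" "A \<subseteq> \<tau> \<Longrightarrow> \<tau> \<union> A = \<tau>" by blast+
  have p4: "\<tau> \<union> A \<in> S \<Longrightarrow> \<tau> \<in> S" using cpx_down[OF S] by blast
  show "\<tau> \<in> cone v (subdiv A a S) \<union> prism A a S \<longleftrightarrow> \<tau> \<in> subdiv (insert v A) a (cone v S)"
  proof (cases "a \<in> \<tau>")
    case True
    then show ?thesis unfolding Un_iff mem_subdiv cone_def prism_def mem_Collect_eq e
      using p1 p2 by (cases "v \<in> \<tau>") auto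
  next
    case False
    then show ?thesis unfolding Un_iff mem_subdiv cone_def prism_def mem_Collect_eq e
      using p1 p2 p3 p4 by (cases "v \<in> \<tau>"; cases "A \<subseteq> \<tau>") auto
  qed
qed

lemma eqv_cone_star:
  assumes S: "cpx S" and A: "A \<in> S" and v: "v \<notin> V" "a \<notin> V" "a \<noteq> v" "verts S \<subseteq> V"
  shows "eqv V (cone v S) (cone v (subdiv A a S) \<union> prism A a S)"
proof -
  have e: "cone v (subdiv A a S) \<union> prism A a S = subdiv (insert v A) a (cone v S)"
    by (rule cone_star[OF S A]) (use v in auto)
  have "v \<notin> A" using A v face_verts by blast
  then have "insert v A - {v} = A" by blast
  then have "insert v A \<in> cone v S" using A unfolding cone_def by simp
  then show ?thesis unfolding e by (intro eqv_subdiv[OF cpx_cone[OF S]]) (use v in \<open>auto simp: verts_cone[OF S]\<close>)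
qed

text \<open>The cone on the pushed boundary is subdivided at \<open>{v, x'}\<close>. The new apex is
  \<open>x\<close> itself, which has left the boundary and is free to serve as an interior
  vertex.\<close>

lemma eqv_cone_push:
  assumes S: "cpx S" and x: "{x} \<in> S" "x' \<notin> verts S" and V: "insert x' (verts S - {x}) \<subseteq> V" "v \<notin> V" "v \<noteq> x" "x \<notin> V"
  shows "eqv V (cone v (subdiv {x} x' S)) (cone v S \<union> prism {x} x' S)"
proof -
  let ?S = "subdiv {x} x' S"
  have xx: "x \<in> verts S" using in_verts_iff[OF S] x by blast
  have xn: "x \<noteq> x'" using xx x by blast
  have S1: "cpx ?S" by (rule cpx_subdiv[OF S]) simp
  have x1: "{x'} \<in> ?S" using x xn unfolding mem_subdiv by auto
  have "eqv V (cone v ?S) (cone v (subdiv {x'} x ?S) \<union> prism {x'} x ?S)"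
    by (rule eqv_cone_star[OF S1 x1]) (use V verts_push[OF S x] in auto)
  then show ?thesis by (simp add: subdiv_undo[OF x(2)] prism_swap[OF xn])
qed

text \<open>Starring \<open>K\<close> below the prism leaves a cone with the prism attached. By
  \<open>eqv_cone_push\<close> this is the cone on the pushed boundary after one subdivision, so one
  weld finishes.\<close>

lemma starrable_push:
  fixes K :: "'a::infinite set set"
  assumes K: "cpx K" and S: "cpx S" "S \<subseteq> K" and x: "{x} \<in> S" "x' \<notin> verts K" and UK: "starrable K S"
  shows "starrable (K \<union> prism {x} x' S) (subdiv {x} x' S)"
proof -
  let ?S = "subdiv {x} x' S"
  have SK: "verts S \<subseteq> verts K" by (rule verts_mono[OF S(2)])
  have x': "x' \<notin> verts S" using SK x by blast
  have xx: "x \<in> verts S" using in_verts_iff[OF S(1)] x by blast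
  have vS: "verts ?S = insert x' (verts S - {x})" by (rule verts_push[OF S(1) x(1) x'])
  have "finite (verts K \<union> {x'})" using finite_verts[OF K] by simp
  then obtain v where v: "v \<notin> verts K \<union> {x'}" by (rule ex_fresh)
  let ?V = "insert x' (verts S)"
  have "eqv ?V K (cone v S)"
    by (rule starrable_at[OF UK K S(1)]) (use finite_verts[OF S(1)] SK x v in auto)
  then have "eqv ?V (K \<union> prism {x} x' S) (cone v S \<union> prism {x} x' S)"
    by (rule eqv_glue[OF _ K cpx_prism[OF S(1) x(1)] verts_prism_subset])
  then have "eqv (verts ?S) (K \<union> prism {x} x' S) (cone v S \<union> prism {x} x' S)"
    by (rule eqv_mono) (use vS in auto)
  moreover have "eqv (verts ?S) (cone v ?S) (cone v S \<union> prism {x} x' S)"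
    by (rule eqv_cone_push[OF S(1) x(1) x']) (use v SK xx x' vS in auto)
  ultimately have "eqv (verts ?S) (K \<union> prism {x} x' S) (cone v ?S)"
    by (metis equivclp_sym equivclp_trans)
  moreover have "v \<notin> verts ?S" using v vS SK by auto
  ultimately show ?thesis unfolding starrable_def by blast
qed

text \<open>Starring \<open>K\<close> at the boundary vertex \<open>x\<close> renames
  \<open>x\<close> to \<open>a\<close> and pushes \<open>a\<close> out to \<open>x\<close>. So
  \<open>K\<close> is equivalent to a renamed copy of \<open>K\<close> with the pushed prism, and
  this copy has boundary \<open>S\<close> again.\<close>

lemma starrable_unpush:
  fixes K :: "'a::infinite set set"
  assumes K: "cpx K" and S: "cpx S" "S \<subseteq> K" and x: "{x} \<in> S" "x' \<notin> verts K"
    and tame: "tame_rel K S" and Ux: "starrable (lk {x} K) (lk {x} S)"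
    and UK: "starrable (K \<union> prism {x} x' S) (subdiv {x} x' S)"
  shows "starrable K S"
proof -
  have SK: "verts S \<subseteq> verts K" by (rule verts_mono[OF S(2)])
  have x': "x' \<notin> verts S" using SK x by blast
  have xx: "x \<in> verts S" using in_verts_iff[OF S(1)] x by blast
  have xn: "x \<noteq> x'" using xx x' by blast
  have "finite (verts K \<union> {x'})" using finite_verts[OF K] by simp
  then obtain a where a: "a \<notin> verts K \<union> {x'}" by (rule ex_fresh)
  have an: "a \<noteq> x" "a \<notin> verts S" "a \<notin> verts K" "a \<noteq> x'" using a xx SK by auto
  have 1: "eqv (verts S) K (subdiv {x} a K \<union> prism {x} a S)"
    by (rule starring_boundary_face[OF K S x(1) _ _ _ _ _ tame Ux])
      (use finite_verts[OF S(1)] SK an in auto)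
  \<comment> \<open>Applied in this order, the two transpositions send \<open>x\<close> to
    \<open>a\<close> and \<open>x'\<close> to \<open>x\<close>.\<close>
  let ?f = "transpose x a" let ?g = "transpose x x'"
  have b: "bij ?f" "bij ?g" by simp_all
  have fK: "relabel ?f K = subdiv {x} a K" "relabel ?f S = subdiv {x} a S"
    using subdiv_singleton_relabel[of a K x] subdiv_singleton_relabel[of a S x] an by auto
  have vK: "verts (subdiv {x} a K) \<subseteq> insert a (verts K - {x})" "verts (subdiv {x} a S) \<subseteq> insert a (verts S - {x})"
    using verts_push[OF K _ an(3), of x] verts_push[OF S(1) x(1) an(2)] x(1) S(2) by auto
  have gK: "relabel ?g (subdiv {x} a K) = subdiv {x} a K" "relabel ?g (subdiv {x} a S) = subdiv {x} a S"
  proof -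
    have n: "x \<notin> verts (subdiv {x} a K)" "x' \<notin> verts (subdiv {x} a K)" "x \<notin> verts (subdiv {x} a S)" "x' \<notin> verts (subdiv {x} a S)"
      using vK an x x' by auto
    show "relabel ?g (subdiv {x} a K) = subdiv {x} a K"
      by (rule relabel_fix[OF b(2)], rule transpose_apply_other) (use n in auto)
    show "relabel ?g (subdiv {x} a S) = subdiv {x} a S"
      by (rule relabel_fix[OF b(2)], rule transpose_apply_other) (use n in auto)
  qed
  have vS: "verts (subdiv {x} x' S) = insert x' (verts S - {x})" by (rule verts_push[OF S(1) x(1) x'])
  have fS: "relabel ?f (subdiv {x} x' S) = subdiv {x} x' S"
    by (rule relabel_fix[OF b(1)], rule transpose_apply_other) (use vS an xn in auto)
  have gS: "relabel ?g (subdiv {x} x' S) = S"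
    using subdiv_singleton_relabel[OF x'] relabel_transpose_twice by metis
  have "starrable (relabel ?g (relabel ?f (K \<union> prism {x} x' S))) (relabel ?g (relabel ?f (subdiv {x} x' S)))"
    by (intro starrable_relabel b UK)
  moreover have "relabel ?f (prism {x} x' S) = prism {a} x' (subdiv {x} a S)"
    using an xn by (simp add: relabel_prism[OF b(1)] fK transpose_def)
  moreover have "relabel ?g (prism {a} x' (subdiv {x} a S)) = prism {a} x (subdiv {x} a S)"
    using an xn by (simp add: relabel_prism[OF b(2)] gK transpose_def)
  moreover have "prism {a} x (subdiv {x} a S) = prism {x} a S" by (rule prism_swap) (use an in auto)
  ultimately have "starrable (subdiv {x} a K \<union> prism {x} a S) S" by (simp add: relabel_Un fK gK fS gS)
  then show ?thesis using starrable_eqv[OF 1] by simp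
qed

lemma verts_subdiv_face:
  assumes K: "cpx K" "cpx S" "S \<subseteq> K" and A: "A \<in> S" "A \<noteq> {}" and a: "a \<notin> verts K"
  shows "insert a (verts S) \<inter> verts (subdiv A a K) = verts (subdiv A a S)"
proof
  have c: "cpx (subdiv A a K)" "cpx (subdiv A a S)" using cpx_subdiv[OF K(1) A(2)] cpx_subdiv[OF K(2) A(2)] by auto
  have aA: "a \<notin> A" using A K a face_verts by blast
  have aS: "a \<in> verts (subdiv A a S)" by (rule new_vertex_subdiv[OF A aA])
  show "insert a (verts S) \<inter> verts (subdiv A a K) \<subseteq> verts (subdiv A a S)"
  proof
    fix x assume x: "x \<in> insert a (verts S) \<inter> verts (subdiv A a K)"
    show "x \<in> verts (subdiv A a S)"
    proof (cases "x = a")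
      case False
      then have "{x} \<in> S" "{x} \<in> subdiv A a K" using x in_verts_iff[OF K(2)] in_verts_iff[OF c(1)] by auto
      then have "{x} \<in> subdiv A a S" using False unfolding mem_subdiv by auto
      then show ?thesis using in_verts_iff[OF c(2)] by blast
    qed (use aS in simp)
  qed
  show "verts (subdiv A a S) \<subseteq> insert a (verts S) \<inter> verts (subdiv A a K)"
    using verts_subdiv_subset[of A a S] verts_mono[OF subdiv_mono[OF K(3)], of A a] by blast
qed

text \<open>Replacing the star of \<open>A\<close> exhibits \<open>K\<close> as the subdivided ball
  with a prism attached. Starring that ball leaves a cone with a prism, which is the cone on
  \<open>S\<close> subdivided at \<open>insert v A\<close>.\<close>

lemma starrable_unsub:
  fixes K :: "'a::infinite set set"
  assumes K: "cpx K" and S: "cpx S" "S \<subseteq> K" and A: "A \<in> S" "A \<noteq> {}" and a: "a \<notin> verts K"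
    and tame: "tame_rel K S" and UA: "starrable (lk A K) (lk A S)"
    and UK: "starrable (subdiv A a K) (subdiv A a S)"
  shows "starrable K S"
proof -
  have SK: "verts S \<subseteq> verts K" by (rule verts_mono[OF S(2)])
  have aS: "a \<notin> verts S" using SK a by blast
  let ?S = "subdiv A a S" let ?K = "subdiv A a K" let ?V = "insert a (verts S)"
  have c: "cpx ?K" "cpx ?S" using cpx_subdiv[OF K A(2)] cpx_subdiv[OF S(1) A(2)] by auto
  have 1: "eqv (verts S) K (?K \<union> prism A a S)"
    by (rule starring_boundary_face[OF K S A _ _ _ _ tame UA]) (use finite_verts[OF S(1)] SK aS a in auto)
  have "finite ?V" using finite_verts[OF S(1)] by simp
  then obtain v where v: "v \<notin> ?V" by (rule ex_fresh)
  have "eqv ?V ?K (cone v ?S)"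
    by (rule starrable_at[OF UK c _ verts_subdiv_face[OF K S A a] v]) (use finite_verts[OF S(1)] in auto)
  then have "eqv ?V (?K \<union> prism A a S) (cone v ?S \<union> prism A a S)"
    by (rule eqv_glue[OF _ c(1) cpx_prism[OF S(1) A(1)] verts_prism_subset])
  then have 2: "eqv (verts S) (?K \<union> prism A a S) (cone v ?S \<union> prism A a S)"
    by (rule eqv_mono) auto
  have 3: "eqv (verts S) (cone v S) (cone v ?S \<union> prism A a S)"
    by (rule eqv_cone_star[OF S(1) A(1)]) (use v aS in auto)
  have "eqv (verts S) K (cone v S)"
    by (rule equivclp_trans[OF equivclp_trans[OF 1 2] equivclp_sym[OF 3]])
  then show ?thesis unfolding starrable_def using v by blast
qed

section \<open>Tameness and starrable links under subdivision, pushing and passing to links\<close>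

definition links_starrable :: "'a set set \<Rightarrow> 'a set set \<Rightarrow> bool" where
  "links_starrable K S \<longleftrightarrow> (\<forall>A\<in>S. A \<noteq> {} \<longrightarrow> starrable (lk A K) (lk A S))"

lemma tame_rel_subdiv:
  assumes K: "cpx K" "cpx S" "S \<subseteq> K" and A: "A \<in> S" and a: "a \<notin> verts K" and t: "tame_rel K S"
  shows "tame_rel (subdiv A a K) (subdiv A a S)"
  unfolding tame_rel_def
proof (intro ballI impI)
  fix \<tau> assume \<tau>: "\<tau> \<in> subdiv A a K" "\<tau> \<subseteq> verts (subdiv A a S)"
  have v: "\<tau> \<subseteq> insert a (verts S)" using \<tau> verts_subdiv_subset[of A a S] by blast
  show "\<tau> \<in> subdiv A a S"
  proof (cases "a \<in> \<tau>")
    case True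
    have "\<tau> - {a} \<union> A \<subseteq> verts S" using v face_verts[OF A] by blast
    moreover have "\<tau> - {a} \<union> A \<in> K" using \<tau>(1) True unfolding mem_subdiv by simp
    ultimately have "\<tau> - {a} \<union> A \<in> S" using t unfolding tame_rel_def by simp
    then show ?thesis using \<tau>(1) True unfolding mem_subdiv by simp
  next
    case False
    then have "\<tau> \<subseteq> verts S" using v by blast
    moreover have "\<tau> \<in> K" using \<tau>(1) False unfolding mem_subdiv by simp
    ultimately have "\<tau> \<in> S" using t unfolding tame_rel_def by simp
    then show ?thesis using \<tau>(1) False unfolding mem_subdiv by simp
  qed
qed

lemma tame_rel_push:
  assumes S: "cpx S" "S \<subseteq> K" and x: "{x} \<in> S" "x' \<notin> verts K" and t: "tame_rel K S"
  shows "tame_rel (K \<union> prism {x} x' S) (subdiv {x} x' S)"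
  unfolding tame_rel_def
proof (intro ballI impI)
  have SK: "verts S \<subseteq> verts K" by (rule verts_mono[OF S(2)])
  have x': "x' \<notin> verts S" using SK x by blast
  have vS: "verts (subdiv {x} x' S) = insert x' (verts S - {x})" by (rule verts_push[OF S(1) x(1) x'])
  fix \<tau> assume \<tau>: "\<tau> \<in> K \<union> prism {x} x' S" "\<tau> \<subseteq> verts (subdiv {x} x' S)"
  have x\<tau>: "x \<notin> \<tau>"
  proof
    assume "x \<in> \<tau>"
    then have "x \<in> insert x' (verts S - {x})" using \<tau>(2) vS by blast
    then show False using x' x in_verts_iff[OF S(1)] by auto
  qed
  show "\<tau> \<in> subdiv {x} x' S"
  proof (cases "x' \<in> \<tau>")
    case True
    then have "\<tau> \<notin> K" using x(2) face_verts by blast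
    then have "\<tau> - {x'} \<union> {x} \<in> S" using \<tau>(1) unfolding prism_def by blast
    then show ?thesis using x\<tau> True unfolding mem_subdiv by auto
  next
    case False
    have "\<tau> \<in> S"
    proof (cases "\<tau> \<in> K")
      case True
      moreover have "\<tau> \<subseteq> verts S" using \<tau>(2) False unfolding vS by blast
      ultimately show ?thesis using t unfolding tame_rel_def by simp
    next
      case nK: False
      then have "\<tau> - {x'} \<union> {x} \<in> S" using \<tau>(1) unfolding prism_def by blast
      then show ?thesis by (rule cpx_down[OF S(1)]) (use False in auto)
    qed
    then show ?thesis using x\<tau> False unfolding mem_subdiv by auto
  qed
qed

lemma tame_rel_lk:
  assumes "cpx K" "cpx S" and A: "A \<in> S" and t: "tame_rel K S"
  shows "tame_rel (lk A K) (lk A S)"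
  unfolding tame_rel_def
proof (intro ballI impI)
  fix \<tau> assume \<tau>: "\<tau> \<in> lk A K" "\<tau> \<subseteq> verts (lk A S)"
  have "\<tau> \<union> A \<subseteq> verts S" using \<tau>(2) verts_lk_subset[of A S] face_verts[OF A] by blast
  moreover have "\<tau> \<union> A \<in> K" "\<tau> \<inter> A = {}" using \<tau>(1) unfolding lk_def by auto
  ultimately show "\<tau> \<in> lk A S" using t unfolding tame_rel_def lk_def by auto
qed

lemma links_starrable_lk:
  assumes G: "links_starrable K S"
  shows "links_starrable (lk A K) (lk A S)"
  unfolding links_starrable_def
proof (intro ballI impI)
  fix B assume B: "B \<in> lk A S" "B \<noteq> {}"
  then have h: "B \<inter> A = {}" "A \<union> B \<in> S" unfolding lk_def by (auto simp: Un_commute)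
  then show "starrable (lk B (lk A K)) (lk B (lk A S))"
    using G B(2) unfolding links_starrable_def lk_lk[OF h(1)] by auto
qed

lemma lk_prism:
  assumes "a \<notin> B" "A \<inter> B = {}"
  shows "lk B (prism A a S) = prism A a (lk B S)"
proof (rule set_eqI)
  fix \<tau>
  have e: "\<tau> \<union> B - {a} \<union> A = \<tau> - {a} \<union> A \<union> B" "(\<tau> - {a} \<union> A) \<inter> B = {} \<longleftrightarrow> \<tau> \<inter> B = {}" using assms by blast+
  show "\<tau> \<in> lk B (prism A a S) \<longleftrightarrow> \<tau> \<in> prism A a (lk B S)"
    unfolding lk_def prism_def mem_Collect_eq e by simp
qed

text \<open>If \<open>x' \<in> A\<close>, the new link is a cone with apex \<open>x\<close>,
  whatever \<open>K\<close> is. Otherwise the link of \<open>A\<close> is itself pushed at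
  \<open>x\<close>, or unchanged if \<open>x\<close> is not in the link of \<open>A\<close> in
  \<open>S\<close>. So something must be known about \<open>K\<close> only if
  \<open>x' \<notin> A\<close>.\<close>

lemma starrable_lk_push:
  fixes K :: "'a::infinite set set"
  assumes K: "cpx K" and S: "cpx S" "S \<subseteq> K" and x: "{x} \<in> S" "x' \<notin> verts K"
    and A: "A \<in> subdiv {x} x' S" "A \<noteq> {}" and UA: "x' \<notin> A \<Longrightarrow> starrable (lk A K) (lk A S)"
  shows "starrable (lk A (K \<union> prism {x} x' S)) (lk A (subdiv {x} x' S))"
proof -
  have SK: "verts S \<subseteq> verts K" by (rule verts_mono[OF S(2)])
  have x': "x' \<notin> verts S" using SK x by blast
  have xn: "x \<noteq> x'" using x x' in_verts_iff[OF S(1)] by blast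
  have xA: "x \<notin> A" using A(1) unfolding mem_subdiv by blast
  show ?thesis
  proof (cases "x' \<in> A")
    case False
    then have AS: "A \<in> S" using A(1) unfolding mem_subdiv by simp
    have "{x} - A = {x}" using xA by blast
    then have e1: "lk A (subdiv {x} x' S) = subdiv {x} x' (lk A S)" using lk_subdiv[of "{x}" A x' S] xA False by auto
    have e2: "lk A (prism {x} x' S) = prism {x} x' (lk A S)" by (rule lk_prism) (use False xA in auto)
    have c: "cpx (lk A K)" "cpx (lk A S)" using cpx_lk K S AS by blast+
    have m: "lk A S \<subseteq> lk A K" using S(2) unfolding lk_def by blast
    have xv: "x' \<notin> verts (lk A K)" using x(2) verts_lk_subset[of A K] by blast
    show ?thesis
    proof (cases "{x} \<in> lk A S")
      case True
      then show ?thesis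
        unfolding lk_Un e1 e2 by (rule starrable_push[OF c m _ xv UA[OF False]])
    next
      case nx: False
      have no: "x \<notin> \<tau>" if "\<tau> \<in> lk A S" for \<tau>
        using that nx in_verts_iff[OF c(2), of x] face_verts[OF that] by blast
      then have "prism {x} x' (lk A S) = {}" unfolding prism_def by blast
      moreover have "subdiv {x} x' (lk A S) = lk A S"
        by (rule subdiv_id) (use no m xv verts_mono[OF m] in auto)
      ultimately show ?thesis unfolding lk_Un e1 e2 using UA[OF False] by simp
    qed
  next
    case True
    let ?A = "A - {x'} \<union> {x}"
    have A0: "?A \<in> S" using A(1) True unfolding mem_subdiv by simp
    have 1: "lk A K = {}" using True x(2) unfolding lk_def verts_def by blast
    have 2: "lk A (prism {x} x' S) = cone x (lk ?A S)"
    proof (rule set_eqI)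
      fix \<tau>
      have n: "\<tau> - {x} \<union> ?A \<in> S \<Longrightarrow> x' \<notin> \<tau>" using x' xn face_verts[of "\<tau> - {x} \<union> ?A" S] by blast
      have e: "\<tau> \<union> A - {x'} \<union> {x} = \<tau> - {x'} - {x} \<union> ?A" using xA by blast
      have d: "x' \<notin> \<tau> \<Longrightarrow> (\<tau> - {x}) \<inter> ?A = {} \<longleftrightarrow> \<tau> \<inter> A = {}" using xA by blast
      show "\<tau> \<in> lk A (prism {x} x' S) \<longleftrightarrow> \<tau> \<in> cone x (lk ?A S)"
      proof (cases "x' \<in> \<tau>")
        case t: True
        then have "\<tau> \<inter> A \<noteq> {}" using True by blast
        then show ?thesis using n t unfolding lk_def cone_def by blast
      next
        case t: False
        then have "\<tau> - {x'} = \<tau>" by blast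
        then show ?thesis unfolding lk_def cone_def prism_def mem_Collect_eq e using d[OF t] by simp
      qed
    qed
    have 3: "lk A (subdiv {x} x' S) = lk ?A S"
    proof (rule set_eqI)
      fix \<tau>
      have n: "\<tau> \<union> ?A \<in> S \<Longrightarrow> x' \<notin> \<tau>" using x' face_verts[of "\<tau> \<union> ?A" S] by blast
      have e: "x \<notin> \<tau> \<Longrightarrow> \<not> {x} \<subseteq> \<tau> \<union> A" "x' \<in> \<tau> \<union> A" "x' \<notin> \<tau> \<Longrightarrow> \<tau> \<union> A - {x'} \<union> {x} = \<tau> \<union> ?A"
        "x' \<notin> \<tau> \<Longrightarrow> \<tau> \<inter> ?A = {} \<longleftrightarrow> \<tau> \<inter> A = {} \<and> x \<notin> \<tau>" using True xA by blast+
      show "\<tau> \<in> lk A (subdiv {x} x' S) \<longleftrightarrow> \<tau> \<in> lk ?A S"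
      proof (cases "x' \<in> \<tau>")
        case t: True
        then have "\<tau> \<inter> A \<noteq> {}" using True by blast
        then show ?thesis using n t unfolding lk_def by blast
      next
        case t: False
        show ?thesis unfolding lk_def mem_Collect_eq mem_subdiv using e(1,2) e(3,4)[OF t] by auto
      qed
    qed
    have "x \<notin> verts (lk ?A S)" using verts_lk_subset[of ?A S] by blast
    then show ?thesis unfolding lk_Un 1 2 3 using starrable_cone by simp
  qed
qed

lemma links_starrable_push:
  fixes K :: "'a::infinite set set"
  assumes "cpx K" "cpx S" "S \<subseteq> K" "{x} \<in> S" "x' \<notin> verts K" "links_starrable K S"
  shows "links_starrable (K \<union> prism {x} x' S) (subdiv {x} x' S)"
  unfolding links_starrable_def
proof (intro ballI impI)
  fix A assume A: "A \<in> subdiv {x} x' S" "A \<noteq> {}"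
  have "A \<in> S" if "x' \<notin> A" using A(1) that unfolding mem_subdiv by simp
  then show "starrable (lk A (K \<union> prism {x} x' S)) (lk A (subdiv {x} x' S))"
    by (intro starrable_lk_push assms A) (use assms(6) A in \<open>auto simp: links_starrable_def\<close>)
qed

section \<open>Joins with the boundary of a simplex\<close>

lemma cpx_join_bd:
  assumes L: "cpx L" and \<kappa>: "finite \<kappa>" "\<kappa> \<noteq> {}"
  shows "cpx (join_bd \<kappa> L)"
proof (rule cpxI)
  show "finite (verts L \<union> \<kappa>)" using finite_verts[OF L] \<kappa> by simp
  show "\<tau> \<subseteq> verts L \<union> \<kappa>" if "\<tau> \<in> join_bd \<kappa> L" for \<tau>
    using that face_verts[of "\<tau> - \<kappa>" L] unfolding join_bd_def by blast
  show "{} \<in> join_bd \<kappa> L" using cpx_empty[OF L] \<kappa> unfolding join_bd_def by simp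
  show "\<rho> \<in> join_bd \<kappa> L" if "\<tau> \<in> join_bd \<kappa> L" "\<rho> \<subseteq> \<tau>" for \<tau> \<rho>
    using that cpx_down[OF L, of "\<tau> - \<kappa>" "\<rho> - \<kappa>"] unfolding join_bd_def by blast
qed

lemma verts_join_bd_subset: "verts (join_bd \<kappa> L) \<subseteq> verts L \<union> \<kappa>"
  unfolding join_bd_def verts_def by blast

lemma subdiv_join_bd:
  assumes "\<sigma> \<inter> \<kappa> = {}" "s \<notin> \<kappa>"
  shows "subdiv \<sigma> s (join_bd \<kappa> L) = join_bd \<kappa> (subdiv \<sigma> s L)"
proof (rule set_eqI)
  fix \<tau>
  have e: "\<sigma> \<subseteq> \<tau> - \<kappa> \<longleftrightarrow> \<sigma> \<subseteq> \<tau>" "s \<in> \<tau> - \<kappa> \<longleftrightarrow> s \<in> \<tau>" "\<tau> - {s} \<union> \<sigma> - \<kappa> = \<tau> - \<kappa> - {s} \<union> \<sigma>"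
    "\<kappa> \<subseteq> \<tau> - {s} \<union> \<sigma> \<longleftrightarrow> \<kappa> \<subseteq> \<tau>" using assms by blast+
  show "\<tau> \<in> subdiv \<sigma> s (join_bd \<kappa> L) \<longleftrightarrow> \<tau> \<in> join_bd \<kappa> (subdiv \<sigma> s L)"
    unfolding mem_subdiv join_bd_def mem_Collect_eq e by auto
qed

lemma eqv_join_bd:
  assumes "eqv V L L'" "cpx L" and \<kappa>: "finite \<kappa>" "\<kappa> \<noteq> {}" "\<kappa> \<subseteq> V" "verts L \<inter> \<kappa> = {}"
  shows "eqv V (join_bd \<kappa> L) (join_bd \<kappa> L')"
proof -
  have st: "eqv V (join_bd \<kappa> M) (join_bd \<kappa> (subdiv \<sigma> s M))"
    if "cpx M" "\<sigma> \<in> M" "\<not> \<sigma> \<subseteq> V" "s \<notin> V" "s \<notin> verts M" "verts M \<inter> \<kappa> = {}" for M \<sigma> s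
  proof -
    have d: "\<sigma> \<inter> \<kappa> = {}" "s \<notin> \<kappa>" using that \<kappa> face_verts by blast+
    then have "\<sigma> - \<kappa> = \<sigma>" "\<not> \<kappa> \<subseteq> \<sigma>" using \<kappa> by blast+
    then have "\<sigma> \<in> join_bd \<kappa> M" using that unfolding join_bd_def by simp
    then have "eqv V (join_bd \<kappa> M) (subdiv \<sigma> s (join_bd \<kappa> M))"
      using that d verts_join_bd_subset[of \<kappa> M] \<kappa> by (intro eqv_subdiv cpx_join_bd) auto
    then show ?thesis by (simp add: subdiv_join_bd[OF d])
  qed
  have "eqv V (join_bd \<kappa> L) (join_bd \<kappa> L') \<and> verts L' \<inter> \<kappa> = {}"
    using assms(1,2)
  proof (induction rule: eqv_induct)
    case base
    show ?case using \<kappa> by simp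
  next
    case (subdiv M \<sigma> s)
    have "verts (subdiv \<sigma> s M) \<inter> \<kappa> = {}" using subdiv \<kappa> verts_subdiv_subset[of \<sigma> s M] by blast
    then show ?case using subdiv st[of M \<sigma> s] by (metis equivclp_trans)
  next
    case (weld M \<sigma> s)
    \<comment> \<open>A subdivision loses an old vertex only if this vertex is the whole base, and a
      base inside \<kappa> is excluded by \<open>\<kappa> \<subseteq> V\<close>.\<close>
    have "verts M \<inter> \<kappa> = {}"
    proof (cases "\<exists>y. \<sigma> = {y}")
      case True
      then obtain y where y: "\<sigma> = {y}" by blast
      then have "verts (subdiv \<sigma> s M) = insert s (verts M - {y})" using weld verts_push[of M y s] by simp
      moreover have "y \<notin> \<kappa>" using y weld \<kappa> by blast
      ultimately show ?thesis using weld by blast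
    next
      case False
      have "{x} \<in> subdiv \<sigma> s M" if "x \<in> verts M" for x
      proof -
        have "{x} \<in> M" "x \<noteq> s" using that weld(6) in_verts_iff[OF weld(2)] by auto
        moreover have "\<not> \<sigma> \<subseteq> {x}" using False weld by blast
        ultimately show ?thesis unfolding mem_subdiv by simp
      qed
      then have "verts M \<subseteq> verts (subdiv \<sigma> s M)" unfolding verts_def by blast
      then show ?thesis using weld by blast
    qed
    then show ?case using weld st[of M \<sigma> s] by (metis equivclp_sym equivclp_trans)
  qed
  then show ?thesis by blast
qed

lemma join_bd_cone: "w \<notin> \<kappa> \<Longrightarrow> join_bd \<kappa> (cone w M) = cone w (join_bd \<kappa> M)"
proof (rule set_eqI)
  fix \<tau> assume "w \<notin> \<kappa>"
  then have e: "\<tau> - \<kappa> - {w} = \<tau> - {w} - \<kappa>" "\<kappa> \<subseteq> \<tau> - {w} \<longleftrightarrow> \<kappa> \<subseteq> \<tau>" by blast+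
  show "\<tau> \<in> join_bd \<kappa> (cone w M) \<longleftrightarrow> \<tau> \<in> cone w (join_bd \<kappa> M)"
    unfolding join_bd_def cone_def mem_Collect_eq e by simp
qed

text \<open>With \<kappa> added to the protected vertices, the starring of \<open>L\<close> never
  meets \<kappa> and is joined with \<partial>\<kappa> move by move. It is applied to the link of
  the new vertex of a subdivision, see \<open>lk_new_vertex\<close>.\<close>

lemma starrable_join_bd:
  fixes L :: "'a::infinite set set"
  assumes "starrable L M" "cpx L" "cpx M" "M \<subseteq> L" and \<kappa>: "finite \<kappa>" "\<kappa> \<noteq> {}" "verts L \<inter> \<kappa> = {}"
  shows "starrable (join_bd \<kappa> L) (join_bd \<kappa> M)"
proof -
  let ?V = "verts M \<union> \<kappa>"
  have fin: "finite ?V" using finite_verts[OF assms(3)] \<kappa> by simp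
  obtain w where w: "w \<notin> ?V" using ex_fresh[OF fin] by blast
  have "eqv ?V L (cone w M)"
    by (rule starrable_at[OF assms(1-3) fin _ w]) (use \<kappa> verts_mono[OF assms(4)] in auto)
  then have "eqv ?V (join_bd \<kappa> L) (join_bd \<kappa> (cone w M))" by (rule eqv_join_bd) (use assms in auto)
  then have "eqv (verts (join_bd \<kappa> M)) (join_bd \<kappa> L) (cone w (join_bd \<kappa> M))"
    using w eqv_mono[OF _ verts_join_bd_subset] by (simp add: join_bd_cone)
  then show ?thesis unfolding starrable_def using w verts_join_bd_subset[of \<kappa> M] by blast
qed

lemma lk_new_vertex:
  assumes "a \<notin> verts K" "A \<in> K"
  shows "lk {a} (subdiv A a K) = join_bd A (lk A K)"
proof (rule set_eqI)
  fix \<tau>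
  have aA: "a \<notin> A" using assms face_verts by blast
  have e: "A \<subseteq> \<tau> \<union> {a} \<longleftrightarrow> A \<subseteq> \<tau>" "a \<in> \<tau> \<union> {a} \<longleftrightarrow> True" "a \<notin> \<tau> \<Longrightarrow> \<tau> \<union> {a} - {a} \<union> A = \<tau> \<union> A"
    "\<tau> - A \<union> A = \<tau> \<union> A" "(\<tau> - A) \<inter> A = {} \<longleftrightarrow> True" "\<tau> \<inter> {a} = {} \<longleftrightarrow> a \<notin> \<tau>" using aA by blast+
  have n: "\<tau> \<union> A \<in> K \<Longrightarrow> a \<notin> \<tau>" using assms face_verts by blast
  show "\<tau> \<in> lk {a} (subdiv A a K) \<longleftrightarrow> \<tau> \<in> join_bd A (lk A K)"
    unfolding lk_def join_bd_def mem_Collect_eq mem_subdiv e(1,2,4-6) using e(3) n by auto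
qed

lemma subdiv_subdiv_vertex:
  assumes "a \<notin> verts S" "a \<noteq> a'" "A \<in> S" "a' \<notin> verts S"
  shows "subdiv {a} a' (subdiv A a S) = subdiv A a' S"
proof (rule set_eqI)
  fix \<tau>
  have n: "a \<notin> X" "a' \<notin> X" if "X \<in> S" for X using that assms face_verts by blast+
  have aA: "a \<notin> A" "a' \<notin> A" using n assms by auto
  have e: "A \<subseteq> \<tau> - {a'} \<union> {a} \<longleftrightarrow> A \<subseteq> \<tau>" "a \<in> \<tau> - {a'} \<union> {a} \<longleftrightarrow> True" "{a} \<subseteq> \<tau> \<longleftrightarrow> a \<in> \<tau>"
    "\<tau> - {a'} \<union> {a} - {a} \<union> A = \<tau> - {a'} - {a} \<union> A" using aA by blast+
  have g: "a \<notin> \<tau> \<Longrightarrow> \<tau> - {a'} - {a} \<union> A = \<tau> - {a'} \<union> A" by blast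
  have h: "a \<in> \<tau> \<Longrightarrow> \<tau> - {a'} \<union> A \<notin> S" "a \<in> \<tau> \<Longrightarrow> \<tau> \<notin> S" using n[of "\<tau> - {a'} \<union> A"] n[of \<tau>] assms(2) by blast+
  show "\<tau> \<in> subdiv {a} a' (subdiv A a S) \<longleftrightarrow> \<tau> \<in> subdiv A a' S"
    unfolding mem_subdiv e using g h by auto
qed

lemma prism_prism_subdiv:
  assumes S: "cpx S" "A \<in> S" "A \<noteq> {}" and a: "a \<notin> verts S" "a \<noteq> a'" "a' \<notin> verts S"
  shows "subdiv A a (prism A a' S) = prism {a} a' (subdiv A a S)"
proof (rule set_eqI)
  fix \<tau>
  have n: "a \<notin> X" "a' \<notin> X" if "X \<in> S" for X using that assms face_verts by blast+
  have aA: "a \<notin> A" "a' \<notin> A" using n assms by auto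
  have e: "a \<in> \<tau> - {a'} \<union> {a} \<longleftrightarrow> True" "A \<subseteq> \<tau> - {a'} \<union> {a} \<longleftrightarrow> A \<subseteq> \<tau>"
    "\<tau> - {a'} \<union> {a} - {a} \<union> A = \<tau> - {a'} - {a} \<union> A" "\<tau> - {a} \<union> A - {a'} \<union> A = \<tau> - {a'} - {a} \<union> A"
    using aA by blast+
  have g: "a \<notin> \<tau> \<Longrightarrow> \<tau> - {a'} - {a} \<union> A = \<tau> - {a'} \<union> A" by blast
  show "\<tau> \<in> subdiv A a (prism A a' S) \<longleftrightarrow> \<tau> \<in> prism {a} a' (subdiv A a S)"
    unfolding mem_subdiv prism_def mem_Collect_eq e using g by auto
qed

text \<open>On the left the star of \<open>A\<close> is the join of \<open>A\<close>,
  \<partial>\<open>{v, a}\<close> and \<open>lk A S\<close>, which calls for the flip from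
  \<open>A\<close> to \<open>{v, a}\<close>. No face of \<open>R\<close> contains \<open>A\<close>
  or \<open>v\<close>, so \<open>R\<close> does not take part.\<close>

lemma eqv_cone_flip:
  fixes S :: "'a::infinite set set"
  assumes S: "cpx S" and A: "A \<in> S" "A \<noteq> {}" and v: "v \<notin> verts S" "a \<notin> verts S" "a \<noteq> v"
    and R: "cpx R" "\<And>\<rho>. \<rho> \<in> R \<Longrightarrow> \<not> A \<subseteq> \<rho>" "v \<notin> verts R"
    and V: "finite V" "\<not> A \<subseteq> V" "v \<notin> V"
  shows "eqv V (cone v S \<union> prism A a S \<union> R) (cone v (subdiv A a S) \<union> R)"
proof (rule flip_eqv[OF _ _ _ V(2) _ _ V(1), of _ _ "{v,a}"])
  have n: "v \<notin> X" "a \<notin> X" if "X \<in> S" for X using that v face_verts by blast+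
  have vA: "v \<notin> A" "a \<notin> A" using n A by auto
  have Rv: "v \<notin> X" if "X \<in> R" for X using that R face_verts by blast
  show "cpx (cone v S \<union> prism A a S \<union> R)" by (intro cpx_Un cpx_cone cpx_prism S R A)
  show "cpx (cone v (subdiv A a S) \<union> R)" by (intro cpx_Un cpx_cone cpx_subdiv S R A)
  have "A - {v} = A" using vA by blast
  then show "A \<in> cone v S \<union> prism A a S \<union> R" using A unfolding cone_def by simp
  have "{a} \<in> subdiv A a S" using A vA unfolding mem_subdiv by auto
  moreover have "{v,a} - {v} = {a}" using v by blast
  ultimately show "{v,a} \<in> cone v (subdiv A a S) \<union> R" unfolding cone_def by simp
  show "\<not> {v,a} \<subseteq> V" using V by simp
  fix \<rho>
  have e: "A \<subseteq> \<rho> - {v} \<longleftrightarrow> A \<subseteq> \<rho>" "a \<in> \<rho> - {v} \<longleftrightarrow> a \<in> \<rho>" "\<rho> - {v} - {a} \<union> A = \<rho> - {a} \<union> A - {v}"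
    "{v, a} \<subseteq> \<rho> \<longleftrightarrow> v \<in> \<rho> \<and> a \<in> \<rho>" using vA v by blast+
  have p1: "\<rho> - {a} \<union> A \<in> S \<Longrightarrow> v \<notin> \<rho>" using n(1)[of "\<rho> - {a} \<union> A"] v(3) by blast
  have p2: "v \<notin> \<rho> \<Longrightarrow> \<rho> - {a} \<union> A - {v} = \<rho> - {a} \<union> A" "v \<notin> \<rho> \<Longrightarrow> \<rho> - {v} = \<rho>" using vA by blast+
  have p3: "a \<in> \<rho> \<Longrightarrow> \<rho> - {v} \<notin> S" using n(2)[of "\<rho> - {v}"] v(3) by blast
  have p4: "a \<notin> \<rho> \<Longrightarrow> \<rho> - {a} = \<rho>" by blast
  have p5: "\<rho> \<union> A \<in> S \<Longrightarrow> \<rho> \<in> S" using cpx_down[OF S] by blast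
  show "\<not> A \<subseteq> \<rho> \<and> \<rho> \<in> cone v S \<union> prism A a S \<union> R \<longleftrightarrow> \<not> {v, a} \<subseteq> \<rho> \<and> \<rho> \<in> cone v (subdiv A a S) \<union> R"
  proof (cases "\<rho> \<in> R")
    case True
    then show ?thesis using R(2) Rv by auto
  next
    case False
    show ?thesis
    proof (cases "a \<in> \<rho>")
      case True
      then show ?thesis using False p1 p2 p3 unfolding Un_iff cone_def prism_def mem_Collect_eq mem_subdiv e
        by (cases "v \<in> \<rho>") auto
    next
      case na: False
      then show ?thesis using False p1 p2 p4 p5 unfolding Un_iff cone_def prism_def mem_Collect_eq mem_subdiv e
        by (cases "v \<in> \<rho>") auto
    qed
  qed
  have q: "\<rho> \<union> A \<notin> R" "\<rho> \<union> {v, a} \<notin> R" using R(2) Rv by blast+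
  have f: "A \<subseteq> \<rho> \<union> {v,a} - {v} \<longleftrightarrow> A \<subseteq> \<rho>" "a \<in> \<rho> \<union> {v,a} - {v} \<longleftrightarrow> True"
    "\<rho> \<union> {v,a} - {v} - {a} \<union> A = \<rho> - {a} \<union> A - {v}" "\<rho> \<union> A - {a} \<union> A = \<rho> - {a} \<union> A" using vA v by blast+
  have g1: "\<rho> \<union> A - {v} \<in> S \<Longrightarrow> a \<notin> \<rho>" using n(2)[of "\<rho> \<union> A - {v}"] v(3) by blast
  show "\<not> A \<subseteq> \<rho> \<and> \<rho> \<union> A \<in> cone v S \<union> prism A a S \<union> R \<longleftrightarrow> \<not> {v, a} \<subseteq> \<rho> \<and> \<rho> \<union> {v, a} \<in> cone v (subdiv A a S) \<union> R"
    using q p1 p2 p4 g1 unfolding Un_iff cone_def prism_def mem_Collect_eq mem_subdiv e(4) f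
    by (cases "v \<in> \<rho>"; cases "a \<in> \<rho>") auto
qed

text \<open>The base \<open>A\<close> lies in the protected boundary, so the subdivision is not an
  admissible move. After \<open>a\<close> has been pushed to \<open>a'\<close> and one vertex
  \<open>x\<close> of \<open>A\<close> to \<open>x'\<close>, the face \<open>A\<close> is no longer
  inside the outer boundary and can be welded back; then \<open>K\<close> is starred underneath. The
  two pushes are undone by \<open>starrable_unpush\<close>, which needs starrable links of
  \<open>x\<close> and \<open>a\<close>. In the link of \<open>x\<close> the base is
  \<open>A - {x}\<close>, hence the induction on \<open>card A\<close>.\<close>

lemma starrable_subdiv:
  fixes K :: "'a::infinite set set"
  assumes "cpx K" "cpx S" "S \<subseteq> K" "A \<in> S" "A \<noteq> {}" "a \<notin> verts K" "tame_rel K S" "links_starrable K S" "starrable K S"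
  shows "starrable (subdiv A a K) (subdiv A a S)"
  using assms
proof (induction "card A" arbitrary: K S A rule: less_induct)
  case (less A K S)
  note K = \<open>cpx K\<close> and S = \<open>cpx S\<close> \<open>S \<subseteq> K\<close> and A = \<open>A \<in> S\<close> \<open>A \<noteq> {}\<close> and a = \<open>a \<notin> verts K\<close>
    and tame = \<open>tame_rel K S\<close> and good = \<open>links_starrable K S\<close> and UK = \<open>starrable K S\<close>
  have SK: "verts S \<subseteq> verts K" by (rule verts_mono[OF S(2)])
  have aS: "a \<notin> verts S" using SK a by blast
  have AS: "A \<subseteq> verts S" by (rule face_verts[OF A(1)])
  have finA: "finite A" by (rule cpx_finite_face[OF S(1) A(1)])
  obtain x where x: "x \<in> A" using A by blast
  show ?case
  proof (cases "A = {x}")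
    case True
    have "bij (transpose x a)" by simp
    from starrable_relabel[OF this UK] show ?thesis
      using subdiv_singleton_relabel[OF a, of x] subdiv_singleton_relabel[OF aS, of x] True by simp
  next
    case False
    have "finite (verts K \<union> {a})" using finite_verts[OF K] by simp
    then obtain a' where a': "a' \<notin> verts K \<union> {a}" by (rule ex_fresh)
    have "finite (verts K \<union> {a, a'})" using finite_verts[OF K] by simp
    then obtain x' where x': "x' \<notin> verts K \<union> {a, a'}" by (rule ex_fresh)
    have "finite (verts K \<union> {a, a', x'})" using finite_verts[OF K] by simp
    then obtain v where v: "v \<notin> verts K \<union> {a, a', x'}" by (rule ex_fresh)
    have xS: "x \<in> verts S" using x AS by blast
    have nn: "a' \<notin> verts S" "x' \<notin> verts S" "v \<notin> verts S" "a \<noteq> a'" "x \<noteq> a" "x \<noteq> a'" "x \<noteq> x'" "x' \<noteq> a'" "x' \<noteq> a"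
      "v \<noteq> a" "v \<noteq> a'" "v \<noteq> x'" "v \<noteq> x" "a' \<noteq> v"
      using a a' x' v SK xS by auto
    have nA: "a \<notin> A" "a' \<notin> A" "x' \<notin> A" "v \<notin> A" using AS nn aS by auto
    have nAx: "\<not> A \<subseteq> {x}" using False x by blast
    let ?K1 = "subdiv A a K" let ?S1 = "subdiv A a S"
    let ?K2 = "?K1 \<union> prism {a} a' ?S1" let ?S2 = "subdiv {a} a' ?S1"
    let ?K3 = "?K2 \<union> prism {x} x' ?S2" let ?S3 = "subdiv {x} x' ?S2"
    have S2: "?S2 = subdiv A a' S" by (rule subdiv_subdiv_vertex) (use aS nn A in auto)
    have c1: "cpx ?K1" "cpx ?S1" using cpx_subdiv[OF K A(2)] cpx_subdiv[OF S(1) A(2)] by auto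
    have m1: "?S1 \<subseteq> ?K1" by (rule subdiv_mono[OF S(2)])
    have aS1: "{a} \<in> ?S1" using A nA unfolding mem_subdiv by auto
    have c2: "cpx ?K2" "cpx ?S2" using cpx_Un[OF c1(1) cpx_prism[OF c1(2) aS1]] cpx_subdiv[OF c1(2)] by auto
    have a'K1: "a' \<notin> verts ?K1" using verts_subdiv_subset[of A a K] a' by blast
    have m2: "?S2 \<subseteq> ?K2"
    proof
      fix \<tau> assume t: "\<tau> \<in> ?S2"
      show "\<tau> \<in> ?K2"
      proof (cases "a' \<in> \<tau>")
        case True
        then show ?thesis using t unfolding mem_subdiv[of _ "{a}"] prism_def by simp
      next
        case False
        then have "\<tau> \<in> ?S1" using t unfolding mem_subdiv[of _ "{a}"] by simp
        then show ?thesis using m1 by blast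
      qed
    qed
    have xS2: "{x} \<in> ?S2"
    proof -
      have "{x} \<in> S" using in_verts_iff[OF S(1)] xS by simp
      then show ?thesis unfolding S2 mem_subdiv using nAx nn by auto
    qed
    have vK2: "verts ?K2 \<subseteq> verts K \<union> {a, a'}"
      using verts_subdiv_subset[of A a K] verts_prism_subset[of "{a}" a' ?S1] verts_subdiv_subset[of A a S] SK
      unfolding verts_Un by blast
    have x'K2: "x' \<notin> verts ?K2" using vK2 x' by blast
    have vS2: "verts ?S2 \<subseteq> insert a' (verts S)" unfolding S2 by (rule verts_subdiv_subset)
    have x'S2: "x' \<notin> verts ?S2" using vS2 nn by blast
    have t1: "tame_rel ?K1 ?S1" by (rule tame_rel_subdiv[OF K S A(1) a tame])
    have t2: "tame_rel ?K2 ?S2" by (rule tame_rel_push[OF c1(2) m1 aS1 a'K1 t1])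
    have Ua: "starrable (lk {a} ?K1) (lk {a} ?S1)"
    proof -
      have AK: "A \<in> K" using A S by blast
      have "starrable (join_bd A (lk A K)) (join_bd A (lk A S))"
      proof (rule starrable_join_bd)
        show "starrable (lk A K) (lk A S)" using good A unfolding links_starrable_def by blast
        show "cpx (lk A K)" "cpx (lk A S)" using cpx_lk[OF K AK] cpx_lk[OF S(1) A(1)] by auto
        show "lk A S \<subseteq> lk A K" using S(2) unfolding lk_def by blast
        show "verts (lk A K) \<inter> A = {}" using verts_lk_subset[of A K] by blast
      qed (use finA A in auto)
      then show ?thesis using lk_new_vertex[OF a AK] lk_new_vertex[OF aS A(1)] by simp
    qed
    have xSs: "{x} \<in> S" "{x} \<in> K" using in_verts_iff[OF S(1)] xS S by auto
    have Ux: "starrable (lk {x} ?K1) (lk {x} ?S1)"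
    proof -
      have e: "lk {x} ?K1 = subdiv (A - {x}) a (lk {x} K)" "lk {x} ?S1 = subdiv (A - {x}) a (lk {x} S)"
        using lk_subdiv[OF nAx] nn by auto
      have "starrable (subdiv (A - {x}) a (lk {x} K)) (subdiv (A - {x}) a (lk {x} S))"
      proof (rule less.hyps)
        show "card (A - {x}) < card A" by (rule card_Diff1_less[OF finA x])
        show "cpx (lk {x} K)" "cpx (lk {x} S)" using cpx_lk[OF K xSs(2)] cpx_lk[OF S(1) xSs(1)] by auto
        show "lk {x} S \<subseteq> lk {x} K" using S(2) unfolding lk_def by blast
        have "(A - {x}) \<union> {x} = A" using x by blast
        then show "A - {x} \<in> lk {x} S" using A unfolding lk_def by simp
        show "A - {x} \<noteq> {}" using nAx by blast
        show "a \<notin> verts (lk {x} K)" using a verts_lk_subset[of "{x}" K] by blast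
        show "tame_rel (lk {x} K) (lk {x} S)" by (rule tame_rel_lk[OF K S(1) xSs(1) tame])
        show "links_starrable (lk {x} K) (lk {x} S)" by (rule links_starrable_lk[OF good])
        show "starrable (lk {x} K) (lk {x} S)" using good xSs unfolding links_starrable_def by blast
      qed
      then show ?thesis unfolding e .
    qed
    have Ux2: "starrable (lk {x} ?K2) (lk {x} ?S2)"
      by (rule starrable_lk_push[OF c1 m1 aS1 a'K1 xS2 _ Ux]) simp
    let ?V = "verts ?S3" let ?R = "prism {x} x' ?S2" let ?W = "verts S \<union> {a', x'}"
    have vS3: "?V = insert x' (verts ?S2 - {x})" by (rule verts_push[OF c2(2) xS2 x'S2])
    have VW: "?V \<subseteq> ?W" "x \<notin> ?V" "a \<notin> ?V" "v \<notin> ?V" using vS3 vS2 nn aS by auto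
    have cR: "cpx ?R" by (rule cpx_prism[OF c2(2) xS2])
    have vR: "verts ?R \<subseteq> ?W" using verts_prism_subset[of "{x}" x' ?S2] vS2 by blast
    have RA: "\<not> A \<subseteq> \<rho>" if "\<rho> \<in> ?R" for \<rho>
    proof
      assume "A \<subseteq> \<rho>"
      then have "A \<subseteq> \<rho> - {x'} \<union> {x}" using nA by blast
      moreover have "\<rho> - {x'} \<union> {x} \<in> subdiv A a' S" using that unfolding prism_def S2 by simp
      ultimately show False unfolding mem_subdiv by simp
    qed
    have cP: "cpx (prism A a' S)" by (rule cpx_prism[OF S(1) A(1)])
    let ?Q = "prism A a' S \<union> ?R"
    have cQ: "cpx ?Q" by (rule cpx_Un[OF cP cR])
    have vQ: "verts ?Q \<subseteq> ?W" using verts_prism_subset[of A a' S] vR unfolding verts_Un by blast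
    \<comment> \<open>The subdivision of the prism \<open>prism A a' S\<close> at \<open>A\<close>
      is the push of \<open>a\<close> to \<open>a'\<close>, so the doubly pushed complex arises from
      \<open>K\<close> with prisms attached by one subdivision at \<open>A\<close>.\<close>
    have K3: "?K3 = subdiv A a (K \<union> ?Q)"
    proof -
      have "subdiv A a ?R = ?R" by (rule subdiv_id[OF RA]) (use vR aS nn in auto)
      moreover have "subdiv A a (prism A a' S) = prism {a} a' ?S1"
        by (rule prism_prism_subdiv[OF S(1) A]) (use aS nn in auto)
      ultimately show ?thesis by (simp add: subdiv_Un Un_assoc)
    qed
    have e1: "eqv ?V (K \<union> ?Q) ?K3"
      unfolding K3
    proof (rule eqv_subdiv)
      show "cpx (K \<union> ?Q)" by (rule cpx_Un[OF K cQ])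
      show "A \<in> K \<union> ?Q" using A S by blast
      show "\<not> A \<subseteq> ?V" using x VW by blast
      show "a \<notin> ?V" by (rule VW)
      show "a \<notin> verts (K \<union> ?Q)" using vQ a aS nn unfolding verts_Un by blast
    qed
    have "eqv ?W K (cone v S)"
    proof (rule starrable_at[OF UK K S(1)])
      show "finite ?W" using finite_verts[OF S(1)] by simp
      show "?W \<inter> verts K = verts S" using SK a' x' by blast
      show "v \<notin> ?W" using nn by blast
    qed
    then have "eqv ?W (K \<union> ?Q) (cone v S \<union> ?Q)" by (rule eqv_glue[OF _ K cQ vQ])
    then have e2: "eqv ?V (K \<union> ?Q) (cone v S \<union> ?Q)" by (rule eqv_mono[OF _ VW(1)])
    have e3: "eqv ?V (cone v S \<union> prism A a' S \<union> ?R) (cone v (subdiv A a' S) \<union> ?R)"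
    proof (rule eqv_cone_flip[OF S(1) A])
      show "v \<notin> verts ?R" using vR nn by blast
      show "finite ?V" by (rule finite_subset[OF VW(1)]) (use finite_verts[OF S(1)] in simp)
      show "\<not> A \<subseteq> ?V" using x VW by blast
    qed (use nn VW cR RA in auto)
    have e4: "eqv ?V (cone v ?S3) (cone v ?S2 \<union> ?R)"
      by (rule eqv_cone_push[OF c2(2) xS2 x'S2]) (use vS3 VW nn in auto)
    have e5: "eqv ?V (cone v S \<union> ?Q) (cone v ?S2 \<union> ?R)" using e3 by (simp only: Un_assoc S2)
    have "eqv ?V ?K3 (cone v ?S3)"
      by (rule equivclp_trans[OF equivclp_trans[OF equivclp_trans[OF equivclp_sym[OF e1] e2] e5] equivclp_sym[OF e4]])
    then have U3: "starrable ?K3 ?S3" unfolding starrable_def using VW(4) by blast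
    have U2: "starrable ?K2 ?S2" by (rule starrable_unpush[OF c2 m2 xS2 x'K2 t2 Ux2 U3])
    show ?thesis by (rule starrable_unpush[OF c1 m1 aS1 a'K1 t1 Ua U2])
  qed
qed

lemma links_starrable_subdiv:
  fixes K :: "'a::infinite set set"
  assumes K: "cpx K" "cpx S" "S \<subseteq> K" and \<sigma>: "\<sigma> \<in> K" "\<not> \<sigma> \<subseteq> verts S" "s \<notin> verts K" and G: "links_starrable K S"
  shows "links_starrable (subdiv \<sigma> s K) S"
  unfolding links_starrable_def
proof (intro ballI impI)
  fix A assume A: "A \<in> S" "A \<noteq> {}"
  have UA: "starrable (lk A K) (lk A S)" using G A unfolding links_starrable_def by blast
  have AS: "A \<subseteq> verts S" "A \<in> K" using A K face_verts by blast+
  have sA: "s \<notin> A" using AS \<sigma> face_verts by blast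
  have n: "\<not> \<sigma> \<subseteq> A" using AS \<sigma> by blast
  have e: "lk A (subdiv \<sigma> s K) = subdiv (\<sigma> - A) s (lk A K)" by (rule lk_subdiv[OF n sA])
  have v: "verts (lk A S) \<subseteq> verts S" using verts_lk_subset[of A S] by blast
  have sl: "s \<notin> verts (lk A K)" using \<sigma> verts_lk_subset[of A K] by blast
  have sS: "s \<notin> verts S" using \<sigma> verts_mono[OF K(3)] by blast
  show "starrable (lk A (subdiv \<sigma> s K)) (lk A S)"
  proof (cases "\<sigma> - A \<in> lk A K")
    case True
    have "eqv (verts (lk A S)) (lk A K) (subdiv (\<sigma> - A) s (lk A K))"
    proof (rule eqv_subdiv[OF cpx_lk[OF K(1) AS(2)] True])
      show "\<not> \<sigma> - A \<subseteq> verts (lk A S)" using \<sigma> v AS by blast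
    qed (use sl sS v in auto)
    then show ?thesis unfolding e using UA starrable_eqv by blast
  next
    case False
    have "\<not> \<sigma> - A \<subseteq> \<rho>" if "\<rho> \<in> lk A K" for \<rho>
      using cpx_down[OF cpx_lk[OF K(1) AS(2)] that, of "\<sigma> - A"] False by blast
    then have "subdiv (\<sigma> - A) s (lk A K) = lk A K" by (rule subdiv_id) (use sl in auto)
    then show ?thesis unfolding e using UA by simp
  qed
qed

lemma tame_rel_interior_subdiv:
  assumes "tame_rel K S" "\<not> \<sigma> \<subseteq> verts S" "s \<notin> verts S"
  shows "tame_rel (subdiv \<sigma> s K) S"
  unfolding tame_rel_def
proof (intro ballI impI)
  fix \<tau> assume \<tau>: "\<tau> \<in> subdiv \<sigma> s K" "\<tau> \<subseteq> verts S"
  then have "s \<notin> \<tau>" using assms(3) by blast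
  then have "\<tau> \<in> K" using \<tau>(1) unfolding mem_subdiv by simp
  then show "\<tau> \<in> S" using assms(1) \<tau>(2) unfolding tame_rel_def by simp
qed

section \<open>Collars\<close>

text \<open>
  A list entry \<open>(x, x')\<close> pushes the boundary vertex \<open>x\<close> outwards to the new vertex \<open>x'\<close>: the join of
  the edge \<open>{x, x'}\<close> with the link of \<open>x\<close> in the boundary is glued on. \<open>collar_end\<close> is the outer
  boundary, and \<open>valid\<close> keeps the new vertices distinct and outside \<open>F\<close>.
\<close>

fun collar :: "'a set set \<Rightarrow> ('a \<times> 'a) list \<Rightarrow> 'a set set" where
  "collar S [] = {}"
| "collar S ((x, x') # g) = prism {x} x' S \<union> collar (subdiv {x} x' S) g"

fun collar_end :: "'a set set \<Rightarrow> ('a \<times> 'a) list \<Rightarrow> 'a set set" where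
  "collar_end S [] = S"
| "collar_end S ((x, x') # g) = collar_end (subdiv {x} x' S) g"

fun valid :: "'a set \<Rightarrow> 'a set set \<Rightarrow> ('a \<times> 'a) list \<Rightarrow> bool" where
  "valid F S [] \<longleftrightarrow> True"
| "valid F S ((x, x') # g) \<longleftrightarrow> {x} \<in> S \<and> x' \<notin> F \<and> valid (insert x' F) (subdiv {x} x' S) g"

lemma collar_append: "collar S (g @ h) = collar S g \<union> collar (collar_end S g) h"
  by (induction g arbitrary: S rule: list.induct) auto

lemma collar_end_append: "collar_end S (g @ h) = collar_end (collar_end S g) h"
  by (induction g arbitrary: S) auto

lemma valid_append: "valid F S (g @ h) \<longleftrightarrow> valid F S g \<and> valid (F \<union> snd ` set g) (collar_end S g) h"
  by (induction g arbitrary: S F) auto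

lemma valid_mono: "valid F S g \<Longrightarrow> F' \<subseteq> F \<Longrightarrow> valid F' S g"
proof (induction g arbitrary: F F' S)
  case (Cons p g)
  obtain x x' where p: "p = (x, x')" by (cases p)
  show ?case using Cons.prems Cons.IH[of "insert x' F" "subdiv {x} x' S" "insert x' F'"] p by auto
qed simp

lemma valid_insert: "valid F S g \<Longrightarrow> a \<notin> snd ` set g \<Longrightarrow> valid (insert a F) S g"
proof (induction g arbitrary: F S)
  case (Cons p g)
  obtain x x' where p: "p = (x, x')" by (cases p)
  show ?case using Cons.prems Cons.IH[of "insert x' F" "subdiv {x} x' S"] p by (auto simp: insert_commute)
qed simp

lemma valid_names: "valid F S g \<Longrightarrow> snd ` set g \<inter> F = {}"
proof (induction g arbitrary: F S)
  case (Cons p g)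
  obtain x x' where p: "p = (x, x')" by (cases p)
  have "snd ` set g \<inter> insert x' F = {}" using Cons.prems Cons.IH[of "insert x' F" "subdiv {x} x' S"] p by simp
  then show ?case using Cons.prems p by auto
qed simp

lemma verts_collar_subset: "verts (collar S g) \<subseteq> verts S \<union> snd ` set g"
proof (induction g arbitrary: S)
  case (Cons p g)
  obtain x x' where p: "p = (x, x')" by (cases p)
  have "verts (collar (subdiv {x} x' S) g) \<subseteq> verts (subdiv {x} x' S) \<union> snd ` set g" by (rule Cons.IH)
  then show ?case using p verts_subdiv_subset[of "{x}" x' S] verts_prism_subset[of "{x}" x' S]
    by (auto simp: verts_Un)
qed (simp add: verts_def)

lemma verts_collar_end_subset: "verts (collar_end S g) \<subseteq> verts S \<union> snd ` set g"
proof (induction g arbitrary: S)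
  case (Cons p g)
  obtain x x' where p: "p = (x, x')" by (cases p)
  have "verts (collar_end (subdiv {x} x' S) g) \<subseteq> verts (subdiv {x} x' S) \<union> snd ` set g" by (rule Cons.IH)
  then show ?case using p verts_subdiv_subset[of "{x}" x' S] by auto
qed simp

lemma collar_down:
  assumes "valid F S g" "cpx S" "\<tau> \<in> collar S g" "\<rho> \<subseteq> \<tau>"
  shows "\<rho> \<in> collar S g"
  using assms
proof (induction g arbitrary: S F)
  case (Cons p g)
  obtain x x' where p: "p = (x, x')" by (cases p)
  have v: "{x} \<in> S" "valid (insert x' F) (subdiv {x} x' S) g" using Cons.prems p by auto
  have c: "cpx (subdiv {x} x' S)" "cpx (prism {x} x' S)" using cpx_subdiv[OF Cons.prems(2)] cpx_prism[OF Cons.prems(2) v(1)] by auto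
  show ?case
  proof (cases "\<tau> \<in> prism {x} x' S")
    case True
    then show ?thesis using cpx_down[OF c(2) True Cons.prems(4)] p by simp
  next
    case False
    then have "\<tau> \<in> collar (subdiv {x} x' S) g" using Cons.prems p by simp
    then show ?thesis using Cons.IH[OF v(2) c(1) _ Cons.prems(4)] p by simp
  qed
qed simp

lemma collar_old_face:
  assumes "cpx S" "valid F S g" "\<tau> \<in> collar S g" "\<tau> \<inter> snd ` set g = {}"
  shows "\<tau> \<in> S"
  using assms
proof (induction g arbitrary: S F)
  case (Cons p g)
  obtain x x' where p: "p = (x, x')" by (cases p)
  have v: "{x} \<in> S" "valid (insert x' F) (subdiv {x} x' S) g" using Cons.prems p by auto
  have c: "cpx (subdiv {x} x' S)" using cpx_subdiv[OF Cons.prems(1)] by auto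
  have x': "x' \<notin> \<tau>" using Cons.prems p by auto
  show ?case
  proof (cases "\<tau> \<in> prism {x} x' S")
    case True
    then have "\<tau> - {x'} \<union> {x} \<in> S" unfolding prism_def by simp
    then show ?thesis by (rule cpx_down[OF Cons.prems(1)]) (use x' in auto)
  next
    case False
    then have "\<tau> \<in> collar (subdiv {x} x' S) g" "\<tau> \<inter> snd ` set g = {}" using Cons.prems p by auto
    then have "\<tau> \<in> subdiv {x} x' S" using Cons.IH[OF c v(2)] by blast
    then show ?thesis using x' unfolding mem_subdiv by simp
  qed
qed simp

lemma push_subset:
  assumes "S \<subseteq> K"
  shows "subdiv {x} x' S \<subseteq> K \<union> prism {x} x' S"
proof
  fix \<tau> assume t: "\<tau> \<in> subdiv {x} x' S"
  show "\<tau> \<in> K \<union> prism {x} x' S"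
  proof (cases "x' \<in> \<tau>")
    case True
    then show ?thesis using t unfolding mem_subdiv prism_def by simp
  next
    case False
    then have "\<tau> \<in> S" using t unfolding mem_subdiv by simp
    then show ?thesis using assms by blast
  qed
qed

lemma push_facts:
  assumes "cpx K" "cpx S" "S \<subseteq> K" "{x} \<in> S" "x' \<notin> F" "verts K \<subseteq> F"
  shows "cpx (K \<union> prism {x} x' S)" "cpx (subdiv {x} x' S)" "subdiv {x} x' S \<subseteq> K \<union> prism {x} x' S"
    "verts (K \<union> prism {x} x' S) \<subseteq> insert x' F" "x' \<notin> verts K" "x' \<notin> verts S" "x \<in> verts S" "x \<noteq> x'"
    "verts (subdiv {x} x' S) = insert x' (verts S - {x})" "verts S \<subseteq> F"
proof -
  have vS: "verts S \<subseteq> verts K" by (rule verts_mono[OF assms(3)])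
  show "cpx (K \<union> prism {x} x' S)" by (rule cpx_Un[OF assms(1) cpx_prism[OF assms(2,4)]])
  show "cpx (subdiv {x} x' S)" by (rule cpx_subdiv[OF assms(2)]) simp
  show "subdiv {x} x' S \<subseteq> K \<union> prism {x} x' S" by (rule push_subset[OF assms(3)])
  show "verts (K \<union> prism {x} x' S) \<subseteq> insert x' F"
    using verts_prism_subset[of "{x}" x' S] vS assms(6) unfolding verts_Un by blast
  show a: "x' \<notin> verts K" "x' \<notin> verts S" "verts S \<subseteq> F" using assms vS by auto
  show b: "x \<in> verts S" using in_verts_iff[OF assms(2)] assms(4) by simp
  show "x \<noteq> x'" using a b by blast
  show "verts (subdiv {x} x' S) = insert x' (verts S - {x})" by (rule verts_push[OF assms(2,4) a(2)])
qed

lemma collar_cpx: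
  assumes "cpx K" "cpx S" "S \<subseteq> K" "verts K \<subseteq> F" "valid F S g"
  shows "cpx (K \<union> collar S g) \<and> cpx (collar_end S g) \<and> collar_end S g \<subseteq> K \<union> collar S g"
  using assms
proof (induction g arbitrary: K S F)
  case (Cons p g)
  obtain x x' where p: "p = (x, x')" by (cases p)
  have v: "{x} \<in> S" "x' \<notin> F" "valid (insert x' F) (subdiv {x} x' S) g" using Cons.prems p by auto
  note f = push_facts[OF Cons.prems(1-3) v(1,2) Cons.prems(4)]
  show ?case using Cons.IH[OF f(1-4) v(3)] p by (simp add: Un_assoc)
qed simp

lemma old_not_in_collar:
  assumes "valid F S g" "z \<in> F" "z \<notin> verts S"
  shows "z \<notin> verts (collar S g)" "z \<notin> verts (collar_end S g)"
  using valid_names[OF assms(1)] verts_collar_subset[of S g] verts_collar_end_subset[of S g] assms by blast+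

text \<open>A pushed vertex belongs to \<open>F\<close>, and all later new names avoid
  \<open>F\<close>, so it cannot return.\<close>

lemma pushed_gone:
  assumes "cpx S" "verts S \<subseteq> F" "valid F S g"
  shows "fst ` set g \<inter> verts (collar_end S g) = {}"
  using assms
proof (induction g arbitrary: S F)
  case (Cons p g)
  obtain x x' where p: "p = (x, x')" by (cases p)
  have v: "{x} \<in> S" "x' \<notin> F" "valid (insert x' F) (subdiv {x} x' S) g" using Cons.prems p by auto
  note f = push_facts[OF Cons.prems(1,1) order_refl v(1,2) Cons.prems(2)]
  have "fst ` set g \<inter> verts (collar_end (subdiv {x} x' S) g) = {}"
    by (rule Cons.IH[OF f(2) _ v(3)]) (use f in auto)
  moreover have "x \<notin> verts (collar_end (subdiv {x} x' S) g)"
    by (rule old_not_in_collar(2)[OF v(3)]) (use f Cons.prems in auto)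
  ultimately show ?case using p by auto
qed simp

lemma unpushed_stays:
  assumes "{x} \<in> S" "x \<notin> fst ` set g" "x \<in> F" "valid F S g"
  shows "{x} \<in> collar_end S g"
  using assms
proof (induction g arbitrary: S F)
  case (Cons p g)
  obtain z z' where p: "p = (z, z')" by (cases p)
  have "{x} \<in> subdiv {z} z' S" using Cons.prems p unfolding mem_subdiv by auto
  then have "{x} \<in> collar_end (subdiv {z} z' S) g" using Cons.IH[of "subdiv {z} z' S" "insert z' F"] Cons.prems p by auto
  then show ?case using p by simp
qed simp

section \<open>Adding and removing collars\<close>

lemma starrable_collar:
  fixes K :: "'a::infinite set set"
  assumes "cpx K" "cpx S" "S \<subseteq> K" "verts K \<subseteq> F" "valid F S g" "starrable K S"
  shows "starrable (K \<union> collar S g) (collar_end S g)"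
  using assms
proof (induction g arbitrary: K S F)
  case (Cons p g)
  obtain x x' where p: "p = (x, x')" by (cases p)
  have v: "{x} \<in> S" "x' \<notin> F" "valid (insert x' F) (subdiv {x} x' S) g" using Cons.prems p by auto
  note f = push_facts[OF Cons.prems(1-3) v(1,2) Cons.prems(4)]
  have "starrable (K \<union> prism {x} x' S) (subdiv {x} x' S)" by (rule starrable_push[OF Cons.prems(1-3) v(1) f(5) Cons.prems(6)])
  from Cons.IH[OF f(1-4) v(3) this] show ?case using p by (simp add: Un_assoc)
qed simp

text \<open>The last push has to be undone first; therefore tameness and starrable links are
  transported forward through the pushes.\<close>

lemma starrable_uncollar:
  fixes K :: "'a::infinite set set"
  assumes "cpx K" "cpx S" "S \<subseteq> K" "verts K \<subseteq> F" "valid F S g" "tame_rel K S" "links_starrable K S"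
    "starrable (K \<union> collar S g) (collar_end S g)"
  shows "starrable K S"
  using assms
proof (induction g arbitrary: K S F)
  case (Cons p g)
  obtain x x' where p: "p = (x, x')" by (cases p)
  have v: "{x} \<in> S" "x' \<notin> F" "valid (insert x' F) (subdiv {x} x' S) g" using Cons.prems p by auto
  note f = push_facts[OF Cons.prems(1-3) v(1,2) Cons.prems(4)]
  have "starrable (K \<union> prism {x} x' S \<union> collar (subdiv {x} x' S) g) (collar_end (subdiv {x} x' S) g)"
    using Cons.prems(8) p by (simp add: Un_assoc)
  from Cons.IH[OF f(1-4) v(3) tame_rel_push[OF Cons.prems(2,3) v(1) f(5) Cons.prems(6)]
      links_starrable_push[OF Cons.prems(1-3) v(1) f(5) Cons.prems(7)] this]
  have "starrable (K \<union> prism {x} x' S) (subdiv {x} x' S)" .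
  moreover have "starrable (lk {x} K) (lk {x} S)" using Cons.prems(7) v(1) unfolding links_starrable_def by blast
  ultimately show ?case by (intro starrable_unpush[OF Cons.prems(1-3) v(1) f(5) Cons.prems(6)])
qed simp

text \<open>
  The link of a boundary face with a pushed out vertex is a cone modified by later pushes. So if
  all boundary vertices are new, nothing needs to be known about the links in \<open>K\<close>.
\<close>

lemma collar_tame_good_aux:
  fixes K :: "'a::infinite set set"
  assumes "cpx K" "cpx S" "S \<subseteq> K" "verts K \<subseteq> F" "valid F S g" "X \<subseteq> F"
    "\<And>A. A \<in> S \<Longrightarrow> \<not> A \<subseteq> X \<Longrightarrow> starrable (lk A K) (lk A S)"
    "\<And>\<tau>. \<tau> \<in> K \<Longrightarrow> \<tau> \<subseteq> verts S \<Longrightarrow> \<not> \<tau> \<subseteq> X \<Longrightarrow> \<tau> \<in> S"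
  shows "(\<forall>A. A \<in> collar_end S g \<longrightarrow> \<not> A \<subseteq> X \<longrightarrow> starrable (lk A (K \<union> collar S g)) (lk A (collar_end S g))) \<and>
     (\<forall>\<tau>. \<tau> \<in> K \<union> collar S g \<longrightarrow> \<tau> \<subseteq> verts (collar_end S g) \<longrightarrow> \<not> \<tau> \<subseteq> X \<longrightarrow> \<tau> \<in> collar_end S g)"
  using assms
proof (induction g arbitrary: K S F)
  case (Cons p g)
  obtain x x' where p: "p = (x, x')" by (cases p)
  have v: "{x} \<in> S" "x' \<notin> F" "valid (insert x' F) (subdiv {x} x' S) g" using Cons.prems p by auto
  note f = push_facts[OF Cons.prems(1-3) v(1,2) Cons.prems(4)]
  have 1: "starrable (lk A (K \<union> prism {x} x' S)) (lk A (subdiv {x} x' S))" if A: "A \<in> subdiv {x} x' S" "\<not> A \<subseteq> X" for A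
  proof (rule starrable_lk_push[OF Cons.prems(1-3) v(1) f(5) A(1)])
    show "A \<noteq> {}" using A by blast
    assume "x' \<notin> A"
    then have "A \<in> S" using A(1) unfolding mem_subdiv by simp
    then show "starrable (lk A K) (lk A S)" using Cons.prems(7) A(2) by blast
  qed
  have 2: "\<tau> \<in> subdiv {x} x' S"
    if \<tau>: "\<tau> \<in> K \<union> prism {x} x' S" "\<tau> \<subseteq> verts (subdiv {x} x' S)" "\<not> \<tau> \<subseteq> X" for \<tau>
  proof -
    have x\<tau>: "x \<notin> \<tau>" using \<tau>(2) f(8) unfolding f(9) by blast
    show ?thesis
    proof (cases "x' \<in> \<tau>")
      case True
      then have "\<tau> \<notin> K" using f(5) face_verts by blast
      then have "\<tau> - {x'} \<union> {x} \<in> S" using \<tau>(1) unfolding prism_def by blast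
      then show ?thesis using x\<tau> True unfolding mem_subdiv by auto
    next
      case False
      have "\<tau> \<in> S"
      proof (cases "\<tau> \<in> K")
        case True
        moreover have "\<tau> \<subseteq> verts S" using \<tau>(2) False unfolding f(9) by blast
        ultimately show ?thesis using Cons.prems(8) \<tau>(3) by blast
      next
        case nK: False
        then have "\<tau> - {x'} \<union> {x} \<in> S" using \<tau>(1) unfolding prism_def by blast
        then show ?thesis by (rule cpx_down[OF Cons.prems(2)]) (use False in auto)
      qed
      then show ?thesis using x\<tau> False unfolding mem_subdiv by auto
    qed
  qed
  have "X \<subseteq> insert x' F" using Cons.prems(6) by blast
  from Cons.IH[OF f(1-4) v(3) this 1 2] show ?case using p by (simp add: Un_assoc)
qed simp

lemma full_disjoint:
  assumes "verts S \<subseteq> F" "valid F S g" "verts (collar_end S g) \<inter> verts S = {}"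
  shows "verts (collar_end S g) \<inter> F = {}"
proof -
  have "verts (collar_end S g) \<subseteq> snd ` set g" using verts_collar_end_subset[of S g] assms(3) by blast
  then show ?thesis using valid_names[OF assms(2)] by blast
qed

lemma collar_tame_good:
  fixes K :: "'a::infinite set set"
  assumes K: "cpx K" "cpx S" "S \<subseteq> K" "verts K \<subseteq> F" "valid F S g" and full: "verts (collar_end S g) \<inter> verts S = {}"
  shows "tame_rel (K \<union> collar S g) (collar_end S g)" "links_starrable (K \<union> collar S g) (collar_end S g)"
proof -
  have SK: "verts S \<subseteq> verts K" by (rule verts_mono[OF K(3)])
  have d: "verts (collar_end S g) \<inter> F = {}" by (rule full_disjoint[OF _ K(5) full]) (use SK K in auto)
  have e: "{} \<in> collar_end S g" using collar_cpx[OF K] cpx_empty by blast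
  \<comment> \<open>With \<open>verts K\<close> as the exceptional set, both hypotheses about
    \<open>K\<close> hold vacuously; a full outer boundary has no vertex in this set, so nothing is
    lost in the conclusion.\<close>
  have *: "(\<forall>A. A \<in> collar_end S g \<longrightarrow> \<not> A \<subseteq> verts K \<longrightarrow> starrable (lk A (K \<union> collar S g)) (lk A (collar_end S g))) \<and>
     (\<forall>\<tau>. \<tau> \<in> K \<union> collar S g \<longrightarrow> \<tau> \<subseteq> verts (collar_end S g) \<longrightarrow> \<not> \<tau> \<subseteq> verts K \<longrightarrow> \<tau> \<in> collar_end S g)"
  proof (rule collar_tame_good_aux[OF K K(4)])
    fix A assume "A \<in> S" "\<not> A \<subseteq> verts K"
    then show "starrable (lk A K) (lk A S)" using K(3) face_verts[of A K] by blast
  next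
    fix \<tau> assume "\<tau> \<in> K" "\<not> \<tau> \<subseteq> verts K"
    then show "\<tau> \<in> S" using face_verts[of \<tau> K] by blast
  qed
  have n: "\<not> \<tau> \<subseteq> verts K" if "\<tau> \<subseteq> verts (collar_end S g)" "\<tau> \<noteq> {}" for \<tau> using that d K(4) by blast
  show "tame_rel (K \<union> collar S g) (collar_end S g)"
    unfolding tame_rel_def
  proof (intro ballI impI)
    fix \<tau> assume "\<tau> \<in> K \<union> collar S g" "\<tau> \<subseteq> verts (collar_end S g)"
    then show "\<tau> \<in> collar_end S g" using *[THEN conjunct2, rule_format, of \<tau>] e n[of \<tau>] by (cases "\<tau> = {}") simp_all
  qed
  show "links_starrable (K \<union> collar S g) (collar_end S g)"
    unfolding links_starrable_def
  proof (intro ballI impI)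
    fix A assume A: "A \<in> collar_end S g" "A \<noteq> {}"
    then show "starrable (lk A (K \<union> collar S g)) (lk A (collar_end S g))" using * n[OF face_verts[OF A(1)] A(2)] by simp
  qed
qed

section \<open>Independence of the collar\<close>

text \<open>If \<open>{x, z}\<close> is a face, the two orders triangulate the same prism over this
  edge with the diagonals \<open>{y, z}\<close> and \<open>{x, z'}\<close>, which a flip exchanges.
  If not, the two complexes are equal.\<close>

lemma eqv_swap_pushes:
  fixes S :: "'a::infinite set set"
  assumes G: "cpx G" and S: "cpx S" and x: "{x} \<in> S" "{z} \<in> S" "x \<noteq> z"
    and f: "y \<notin> verts S" "z' \<notin> verts S" "y \<noteq> z'"
    and Gn: "\<And>\<rho>. \<rho> \<in> G \<Longrightarrow> \<not> {y, z} \<subseteq> \<rho>" "\<And>\<rho>. \<rho> \<in> G \<Longrightarrow> \<not> {x, z'} \<subseteq> \<rho>"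
    and V: "finite V" "x \<notin> V" "z \<notin> V"
  shows "eqv V (G \<union> (prism {x} y S \<union> prism {z} z' (subdiv {x} y S))) (G \<union> (prism {z} z' S \<union> prism {x} y (subdiv {z} z' S)))"
    (is "eqv V ?A ?B")
proof -
  have n: "y \<notin> X" "z' \<notin> X" if "X \<in> S" for X using that f face_verts by blast+
  have xz: "x \<in> verts S" "z \<in> verts S" using x in_verts_iff[OF S] by auto
  have d: "x \<noteq> y" "x \<noteq> z'" "z \<noteq> y" "z \<noteq> z'" using xz f by auto
  have S1: "cpx (subdiv {x} y S)" "cpx (subdiv {z} z' S)" using cpx_subdiv[OF S] by auto
  have zx: "{z} \<in> subdiv {x} y S" "{x} \<in> subdiv {z} z' S" using x d unfolding mem_subdiv by auto
  \<comment> \<open>\<open>P\<close> and \<open>Q\<close> are membership in the prisms over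
    \<open>x\<close> and \<open>z\<close> in the original \<open>S\<close>; \<open>W\<close>
    describes the faces that belong to the edge \<open>{x, z}\<close>, on which the order
    matters.\<close>
  define P where "P \<rho> \<longleftrightarrow> \<rho> - {y} \<union> {x} \<in> S" for \<rho>
  define Q where "Q \<rho> \<longleftrightarrow> \<rho> - {z'} \<union> {z} \<in> S" for \<rho>
  define W where "W \<rho> \<longleftrightarrow> \<rho> - {y} - {z'} \<union> {x} \<union> {z} \<in> S" for \<rho>
  have A: "\<rho> \<in> ?A \<longleftrightarrow> \<rho> \<in> G \<or> P \<rho> \<or> (x \<notin> \<rho> \<and> (if y \<in> \<rho> then W \<rho> else Q \<rho>))" for \<rho>
  proof -
    have e: "{x} \<subseteq> \<rho> - {z'} \<union> {z} \<longleftrightarrow> x \<in> \<rho>" "y \<in> \<rho> - {z'} \<union> {z} \<longleftrightarrow> y \<in> \<rho>"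
      "\<rho> - {z'} \<union> {z} - {y} \<union> {x} = \<rho> - {y} - {z'} \<union> {x} \<union> {z}" using d f x(3) by blast+
    have "\<rho> \<in> prism {z} z' (subdiv {x} y S) \<longleftrightarrow> (x \<notin> \<rho> \<and> (if y \<in> \<rho> then W \<rho> else Q \<rho>))"
      unfolding prism_def mem_Collect_eq mem_subdiv e Q_def W_def ..
    moreover have "\<rho> \<in> prism {x} y S \<longleftrightarrow> P \<rho>" unfolding prism_def P_def by simp
    ultimately show ?thesis by simp
  qed
  have B: "\<rho> \<in> ?B \<longleftrightarrow> \<rho> \<in> G \<or> Q \<rho> \<or> (z \<notin> \<rho> \<and> (if z' \<in> \<rho> then W \<rho> else P \<rho>))" for \<rho>
  proof -
    have e: "{z} \<subseteq> \<rho> - {y} \<union> {x} \<longleftrightarrow> z \<in> \<rho>" "z' \<in> \<rho> - {y} \<union> {x} \<longleftrightarrow> z' \<in> \<rho>"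
      "\<rho> - {y} \<union> {x} - {z'} \<union> {z} = \<rho> - {y} - {z'} \<union> {x} \<union> {z}" using d f x(3) by blast+
    have "\<rho> \<in> prism {x} y (subdiv {z} z' S) \<longleftrightarrow> (z \<notin> \<rho> \<and> (if z' \<in> \<rho> then W \<rho> else P \<rho>))"
      unfolding prism_def mem_Collect_eq mem_subdiv e P_def W_def ..
    moreover have "\<rho> \<in> prism {z} z' S \<longleftrightarrow> Q \<rho>" unfolding prism_def Q_def by simp
    ultimately show ?thesis by simp
  qed
  have Pn: "P \<rho> \<Longrightarrow> z' \<notin> \<rho>" for \<rho> using n(2)[of "\<rho> - {y} \<union> {x}"] f(3) unfolding P_def by blast
  have Qn: "Q \<rho> \<Longrightarrow> y \<notin> \<rho>" for \<rho> using n(1)[of "\<rho> - {z'} \<union> {z}"] f(3) unfolding Q_def by blast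
  have WP: "z' \<notin> \<rho> \<Longrightarrow> W \<rho> \<Longrightarrow> P \<rho>" for \<rho>
    using cpx_down[OF S, of "\<rho> - {y} - {z'} \<union> {x} \<union> {z}" "\<rho> - {y} \<union> {x}"] unfolding W_def P_def by blast
  have WQ: "y \<notin> \<rho> \<Longrightarrow> W \<rho> \<Longrightarrow> Q \<rho>" for \<rho>
    using cpx_down[OF S, of "\<rho> - {y} - {z'} \<union> {x} \<union> {z}" "\<rho> - {z'} \<union> {z}"] unfolding W_def Q_def by blast
  show ?thesis
  proof (cases "{x, z} \<in> S")
    case False
    have Wn: "\<not> W \<rho>" for \<rho> unfolding W_def using cpx_down[OF S, of _ "{x,z}"] False by blast
    have Pz: "P \<rho> \<Longrightarrow> z \<notin> \<rho>" for \<rho> unfolding P_def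
      using cpx_down[OF S, of "\<rho> - {y} \<union> {x}" "{x,z}"] False d by blast
    have Qx: "Q \<rho> \<Longrightarrow> x \<notin> \<rho>" for \<rho> unfolding Q_def
      using cpx_down[OF S, of "\<rho> - {z'} \<union> {z}" "{x,z}"] False d by blast
    have "\<rho> \<in> ?A \<longleftrightarrow> \<rho> \<in> ?B" for \<rho> unfolding A B using Wn Pz Qx Pn Qn by auto
    then have "?A = ?B" by blast
    then show ?thesis by simp
  next
    case True
    show ?thesis
    proof (rule flip_eqv[OF _ _ _ _ _ _ V(1), of _ _ "{y,z}" "{x,z'}"])
      show "cpx ?A" by (intro cpx_Un G cpx_prism S x S1 zx)
      show "cpx ?B" by (intro cpx_Un G cpx_prism S x S1 zx)
      have "{y,z} - {y} \<union> {x} = {x,z}" "{x,z'} - {z'} \<union> {z} = {x,z}" using d by blast+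
      then have "P {y,z}" "Q {x,z'}" unfolding P_def Q_def using True by simp_all
      then show "{y,z} \<in> ?A" "{x,z'} \<in> ?B" unfolding A B by simp_all
      show "\<not> {y,z} \<subseteq> V" "\<not> {x,z'} \<subseteq> V" using V by auto
      fix \<rho>
      have e: "{y,z} \<subseteq> \<rho> \<longleftrightarrow> y \<in> \<rho> \<and> z \<in> \<rho>" "{x,z'} \<subseteq> \<rho> \<longleftrightarrow> x \<in> \<rho> \<and> z' \<in> \<rho>" by blast+
      show "\<not> {y, z} \<subseteq> \<rho> \<and> \<rho> \<in> ?A \<longleftrightarrow> \<not> {x, z'} \<subseteq> \<rho> \<and> \<rho> \<in> ?B"
      proof (cases "\<rho> \<in> G")
        case True
        then show ?thesis using Gn unfolding A B by blast
      next
        case nG: False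
        show ?thesis
        proof (cases "y \<in> \<rho> \<or> z' \<in> \<rho>")
          case True
          then show ?thesis unfolding A B e using nG Pn[of \<rho>] Qn[of \<rho>] WP[of \<rho>] WQ[of \<rho>] by auto
        next
          case False
          have 1: "x \<in> \<rho> \<Longrightarrow> P \<rho> \<longleftrightarrow> \<rho> \<in> S" "z \<in> \<rho> \<Longrightarrow> Q \<rho> \<longleftrightarrow> \<rho> \<in> S"
            using False unfolding P_def Q_def by (simp_all add: insert_absorb)
          have 2: "P \<rho> \<Longrightarrow> \<rho> \<in> S" "Q \<rho> \<Longrightarrow> \<rho> \<in> S"
            using False cpx_down[OF S, of "\<rho> - {y} \<union> {x}" \<rho>] cpx_down[OF S, of "\<rho> - {z'} \<union> {z}" \<rho>]
            unfolding P_def Q_def by blast+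
          show ?thesis unfolding A B e using nG 1 2 False by auto
        qed
      qed
      have g: "\<rho> \<union> {y,z} \<notin> G" "\<rho> \<union> {x,z'} \<notin> G" using Gn by blast+
      have 1: "P (\<rho> \<union> {y,z}) \<longleftrightarrow> W \<rho> \<and> z' \<notin> \<rho>"
      proof -
        have "P (\<rho> \<union> {y,z}) \<Longrightarrow> z' \<notin> \<rho>" using Pn by blast
        moreover have "z' \<notin> \<rho> \<Longrightarrow> \<rho> \<union> {y,z} - {y} \<union> {x} = \<rho> - {y} - {z'} \<union> {x} \<union> {z}" using d by blast
        ultimately show ?thesis unfolding P_def W_def by auto
      qed
      have 2: "Q (\<rho> \<union> {x,z'}) \<longleftrightarrow> W \<rho> \<and> y \<notin> \<rho>"
      proof -
        have "Q (\<rho> \<union> {x,z'}) \<Longrightarrow> y \<notin> \<rho>" using Qn by blast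
        moreover have "y \<notin> \<rho> \<Longrightarrow> \<rho> \<union> {x,z'} - {z'} \<union> {z} = \<rho> - {y} - {z'} \<union> {x} \<union> {z}" using d by blast
        ultimately show ?thesis unfolding Q_def W_def by auto
      qed
      have 3: "W (\<rho> \<union> {y,z}) \<longleftrightarrow> W \<rho>" "W (\<rho> \<union> {x,z'}) \<longleftrightarrow> W \<rho>"
      proof -
        have "\<rho> \<union> {y,z} - {y} - {z'} \<union> {x} \<union> {z} = \<rho> - {y} - {z'} \<union> {x} \<union> {z}"
          "\<rho> \<union> {x,z'} - {y} - {z'} \<union> {x} \<union> {z} = \<rho> - {y} - {z'} \<union> {x} \<union> {z}" using d by blast+
        then show "W (\<rho> \<union> {y,z}) \<longleftrightarrow> W \<rho>" "W (\<rho> \<union> {x,z'}) \<longleftrightarrow> W \<rho>" unfolding W_def by simp_all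
      qed
      have 4: "x \<in> \<rho> \<union> {y,z} \<longleftrightarrow> x \<in> \<rho>" "z \<in> \<rho> \<union> {x,z'} \<longleftrightarrow> z \<in> \<rho>" "y \<in> \<rho> \<union> {y,z} \<longleftrightarrow> True" "z' \<in> \<rho> \<union> {x,z'} \<longleftrightarrow> True"
        using d x(3) by blast+
      show "\<not> {y, z} \<subseteq> \<rho> \<and> \<rho> \<union> {y, z} \<in> ?A \<longleftrightarrow> \<not> {x, z'} \<subseteq> \<rho> \<and> \<rho> \<union> {x, z'} \<in> ?B"
        unfolding A B 1 2 3 4 e using g by auto
    qed
  qed
qed

text \<open>The prism is the join of the edge \<open>{x, x'}\<close> with the link of
  \<open>x\<close>; a midpoint \<open>y\<close> of this edge cuts it into two prisms on top of each
  other.\<close>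

lemma merge_pushes:
  assumes d: "x \<noteq> y" "x \<noteq> x'" "y \<noteq> x'" and f: "y \<notin> verts S" "x' \<notin> verts S"
    and G: "y \<notin> verts G" "\<And>\<rho>. \<rho> \<in> G \<Longrightarrow> \<not> {x, x'} \<subseteq> \<rho>"
  shows "subdiv {x, x'} y (G \<union> prism {x} x' S) = G \<union> (prism {x} y S \<union> prism {y} x' (subdiv {x} y S))"
proof -
  have "subdiv {x, x'} y G = G" by (rule subdiv_id[OF G(2,1)])
  moreover have "subdiv {x, x'} y (prism {x} x' S) = prism {x} y S \<union> prism {y} x' (subdiv {x} y S)"
  proof (rule set_eqI)
    fix \<tau>
    have n: "y \<notin> X" "x' \<notin> X" if "X \<in> S" for X using that f face_verts by blast+
    define W where "W \<longleftrightarrow> \<tau> - {y} - {x'} \<union> {x} \<in> S"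
    have e: "\<tau> - {y} \<union> {x, x'} - {x'} \<union> {x} = \<tau> - {y} - {x'} \<union> {x}" "{x} \<subseteq> \<tau> - {x'} \<union> {y} \<longleftrightarrow> x \<in> \<tau>"
      "y \<in> \<tau> - {x'} \<union> {y} \<longleftrightarrow> True" "\<tau> - {x'} \<union> {y} - {y} \<union> {x} = \<tau> - {y} - {x'} \<union> {x}"
      "{x,x'} \<subseteq> \<tau> \<longleftrightarrow> x \<in> \<tau> \<and> x' \<in> \<tau>"
      using d by blast+
    have 1: "\<tau> - {y} \<union> {x} \<in> S \<longleftrightarrow> W \<and> x' \<notin> \<tau>"
    proof -
      have "\<tau> - {y} \<union> {x} \<in> S \<Longrightarrow> x' \<notin> \<tau>" using n(2)[of "\<tau> - {y} \<union> {x}"] d by blast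
      moreover have "x' \<notin> \<tau> \<Longrightarrow> \<tau> - {y} \<union> {x} = \<tau> - {y} - {x'} \<union> {x}" by blast
      ultimately show ?thesis unfolding W_def by auto
    qed
    have 2: "y \<notin> \<tau> \<Longrightarrow> \<tau> - {x'} \<union> {x} \<in> S \<longleftrightarrow> W" unfolding W_def by simp
    show "\<tau> \<in> subdiv {x, x'} y (prism {x} x' S) \<longleftrightarrow> \<tau> \<in> prism {x} y S \<union> prism {y} x' (subdiv {x} y S)"
      unfolding mem_subdiv Un_iff prism_def mem_Collect_eq e 1 using 2 unfolding W_def by auto
  qed
  ultimately show ?thesis by (simp add: subdiv_Un)
qed

lemma subdiv_prism_comm:
  assumes "x \<notin> A" "x \<noteq> a" "x' \<notin> A" "x' \<noteq> a"
  shows "subdiv A a (prism {x} x' S) = prism {x} x' (subdiv A a S)"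
proof (rule set_eqI)
  fix \<tau>
  have e: "A \<subseteq> \<tau> - {x'} \<union> {x} \<longleftrightarrow> A \<subseteq> \<tau>" "a \<in> \<tau> - {x'} \<union> {x} \<longleftrightarrow> a \<in> \<tau>"
    "\<tau> - {a} \<union> A - {x'} \<union> {x} = \<tau> - {x'} \<union> {x} - {a} \<union> A" using assms by blast+
  show "\<tau> \<in> subdiv A a (prism {x} x' S) \<longleftrightarrow> \<tau> \<in> prism {x} x' (subdiv A a S)"
    unfolding mem_subdiv prism_def mem_Collect_eq e ..
qed

lemma subdiv_push_comm:
  assumes "x \<notin> A" "x \<noteq> a" "x' \<notin> A" "x' \<noteq> a"
  shows "subdiv A a (subdiv {x} x' S) = subdiv {x} x' (subdiv A a S)"
proof (rule set_eqI)
  fix \<tau>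
  have e: "A \<subseteq> \<tau> - {x'} \<union> {x} \<longleftrightarrow> A \<subseteq> \<tau>" "a \<in> \<tau> - {x'} \<union> {x} \<longleftrightarrow> a \<in> \<tau>"
    "\<tau> - {a} \<union> A - {x'} \<union> {x} = \<tau> - {x'} \<union> {x} - {a} \<union> A" "{x} \<subseteq> \<tau> - {a} \<union> A \<longleftrightarrow> x \<in> \<tau>"
    "x' \<in> \<tau> - {a} \<union> A \<longleftrightarrow> x' \<in> \<tau>" "{x} \<subseteq> \<tau> \<longleftrightarrow> x \<in> \<tau>" using assms by blast+
  show "\<tau> \<in> subdiv A a (subdiv {x} x' S) \<longleftrightarrow> \<tau> \<in> subdiv {x} x' (subdiv A a S)"
    unfolding mem_subdiv e if_bool_eq_conj by argo
qed

text \<open>The first push of \<open>x\<close> is split at a midpoint \<open>y\<close> by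
  \<open>merge_pushes\<close>, and its lower half is moved to the front by exchanging it with each
  push in \<open>g1\<close>. The flips are admissible because pushed vertices are not in
  \<open>V\<close>.\<close>

lemma insert_push:
  fixes S :: "'a::infinite set set"
  assumes "cpx G" "cpx S" "S \<subseteq> G" "verts G \<subseteq> F" "valid F S (g1 @ (x, x') # g2)" "x \<notin> fst ` set g1" "{x} \<in> S"
    "y \<notin> F" "y \<notin> snd ` set (g1 @ (x, x') # g2)" "finite V" "V \<inter> fst ` set g1 = {}" "x \<notin> V" "y \<notin> V"
  shows "eqv V (G \<union> collar S (g1 @ (x, x') # g2)) (G \<union> collar S ((x, y) # g1 @ (y, x') # g2)) \<and>
    collar_end S (g1 @ (x, x') # g2) = collar_end S ((x, y) # g1 @ (y, x') # g2) \<and> valid F S ((x, y) # g1 @ (y, x') # g2)"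
  using assms
proof (induction g1 arbitrary: G S F)
  case Nil
  note h = Nil.prems
  have v: "x' \<notin> F" "valid (insert x' F) (subdiv {x} x' S) g2" using h(5) by auto
  note f = push_facts[OF h(1-3,7) v(1) h(4)]
  have y: "y \<noteq> x'" "y \<notin> snd ` set g2" using h(9) by auto
  have yG: "y \<notin> verts G" "y \<notin> verts S" using h(4,8) f(10) by auto
  have xy: "x \<noteq> y" using f(7) yG by blast
  have S': "subdiv {y} x' (subdiv {x} y S) = subdiv {x} x' S"
    by (rule subdiv_subdiv_vertex) (use yG y f h in auto)
  let ?R = "collar (subdiv {x} x' S) g2"
  have xR: "x \<notin> verts ?R" by (rule old_not_in_collar(1)[OF v(2)]) (use f h in auto)
  have yR: "y \<notin> verts ?R" using verts_collar_subset[of "subdiv {x} x' S" g2] y yG f(9) by auto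
  have c: "cpx (G \<union> (prism {x} x' S \<union> ?R))" using collar_cpx[OF f(1-4) v(2)] by (simp add: Un_assoc)
  have e: "subdiv {x, x'} y (G \<union> ?R \<union> prism {x} x' S) = G \<union> ?R \<union> (prism {x} y S \<union> prism {y} x' (subdiv {x} y S))"
  proof (rule merge_pushes)
    show "y \<notin> verts (G \<union> ?R)" using yG yR by (simp add: verts_Un)
    fix \<rho> assume "\<rho> \<in> G \<union> ?R"
    then show "\<not> {x, x'} \<subseteq> \<rho>" using f(5) xR face_verts[of \<rho> G] face_verts[of \<rho> ?R] by blast
  qed (use xy f y yG in auto)
  have "eqv V (G \<union> (prism {x} x' S \<union> ?R)) (subdiv {x, x'} y (G \<union> (prism {x} x' S \<union> ?R)))"
  proof (rule eqv_subdiv[OF c])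
    have "{x, x'} - {x'} \<union> {x} = {x}" using f by blast
    then have "{x, x'} \<in> prism {x} x' S" unfolding prism_def mem_Collect_eq using h(7) by metis
    then show "{x, x'} \<in> G \<union> (prism {x} x' S \<union> ?R)" by blast
    show "y \<notin> verts (G \<union> (prism {x} x' S \<union> ?R))"
      using yG yR verts_prism_subset[of "{x}" x' S] y by (auto simp: verts_Un)
  qed (use h in auto)
  then have "eqv V (G \<union> collar S ([] @ (x, x') # g2)) (G \<union> collar S ((x, y) # [] @ (y, x') # g2))"
    using e S' by (simp add: Un_ac)
  moreover have "valid F S ((x, y) # [] @ (y, x') # g2)"
  proof -
    have "{y} \<in> subdiv {x} y S" using h(7) xy unfolding mem_subdiv by auto
    moreover have "valid (insert y (insert x' F)) (subdiv {x} x' S) g2" by (rule valid_insert[OF v(2) y(2)])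
    ultimately show ?thesis using h y v(1) S' by (auto simp: insert_commute)
  qed
  ultimately show ?case using S' by simp
next
  case (Cons p g1)
  note h = Cons.prems
  obtain z z' where p: "p = (z, z')" by (cases p)
  have v: "{z} \<in> S" "z' \<notin> F" "valid (insert z' F) (subdiv {z} z' S) (g1 @ (x, x') # g2)" using h(5) p by auto
  note f = push_facts[OF h(1-3) v(1,2) h(4)]
  have xz: "x \<noteq> z" using h(6) p by auto
  have x: "x \<in> verts S" using in_verts_iff[OF h(2)] h(7) by simp
  have yz: "y \<noteq> z'" "y \<notin> snd ` set (g1 @ (x, x') # g2)" using h(9) p by auto
  have yS: "y \<notin> verts S" "y \<notin> verts G" using f(10) h(4,8) by auto
  have d: "x \<noteq> z'" "x \<noteq> y" "z \<noteq> y" using x f yS by auto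
  have xS': "{x} \<in> subdiv {z} z' S" using h(7) xz d unfolding mem_subdiv by auto
  let ?G = "G \<union> prism {z} z' S" let ?S = "subdiv {z} z' S" let ?F = "insert z' F"
  have IH: "eqv V (?G \<union> collar ?S (g1 @ (x, x') # g2)) (?G \<union> collar ?S ((x, y) # g1 @ (y, x') # g2)) \<and>
    collar_end ?S (g1 @ (x, x') # g2) = collar_end ?S ((x, y) # g1 @ (y, x') # g2) \<and> valid ?F ?S ((x, y) # g1 @ (y, x') # g2)"
    by (rule Cons.IH[OF f(1-4) v(3) _ xS']) (use h p yz in auto)
  let ?T = "subdiv {x} y ?S" let ?R = "collar ?T (g1 @ (y, x') # g2)"
  have T: "subdiv {z} z' (subdiv {x} y S) = ?T" by (rule subdiv_push_comm[symmetric]) (use xz d f yz(1) in auto)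
  have vT: "valid (insert y ?F) ?T (g1 @ (y, x') # g2)" using IH by simp
  have yn: "y \<notin> verts ?S" using f(9) yS yz by auto
  have vTv: "verts ?T = insert y (verts ?S - {x})" by (rule verts_push[OF f(2) xS' yn])
  have xR: "x \<notin> verts ?R" by (rule old_not_in_collar(1)[OF vT]) (use vTv d x f in auto)
  have zR: "z \<notin> verts ?R" by (rule old_not_in_collar(1)[OF vT]) (use vTv d f in auto)
  have m: "?S \<subseteq> ?G" by (rule f(3))
  have cR: "cpx (G \<union> ?R)"
  proof (rule cpxI)
    have "finite (verts (?G \<union> collar ?S ((x, y) # g1 @ (y, x') # g2)))"
      using collar_cpx[OF f(1-4), of "(x, y) # g1 @ (y, x') # g2"] IH finite_verts by blast
    then show "finite (verts (G \<union> ?R))" by (rule rev_finite_subset) (auto simp: verts_Un)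
    show "\<tau> \<subseteq> verts (G \<union> ?R)" if "\<tau> \<in> G \<union> ?R" for \<tau> by (rule face_verts[OF that])
    show "{} \<in> G \<union> ?R" using cpx_empty[OF h(1)] by simp
    show "\<rho> \<in> G \<union> ?R" if "\<tau> \<in> G \<union> ?R" "\<rho> \<subseteq> \<tau>" for \<tau> \<rho>
    proof (cases "\<tau> \<in> G")
      case True
      then show ?thesis using cpx_down[OF h(1) True that(2)] by blast
    next
      case False
      then have "\<tau> \<in> ?R" using that by blast
      then show ?thesis using collar_down[OF _ _ _ that(2)] vT cpx_subdiv[OF f(2), of "{x}" y] by blast
    qed
  qed
  have sw: "eqv V (G \<union> ?R \<union> (prism {x} y S \<union> prism {z} z' (subdiv {x} y S))) (G \<union> ?R \<union> (prism {z} z' S \<union> prism {x} y ?S))"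
  proof (rule eqv_swap_pushes[OF cR h(2,7) v(1) xz yS(1) f(6) yz(1)])
    fix \<rho> assume "\<rho> \<in> G \<union> ?R"
    then show "\<not> {y, z} \<subseteq> \<rho>" "\<not> {x, z'} \<subseteq> \<rho>"
      using yS f(5) xR zR face_verts[of \<rho> G] face_verts[of \<rho> ?R] by blast+
  qed (use h p in auto)
  have e1: "G \<union> collar S ((p # g1) @ (x, x') # g2) = ?G \<union> collar ?S (g1 @ (x, x') # g2)" using p by (simp add: Un_assoc)
  have e2: "?G \<union> collar ?S ((x, y) # g1 @ (y, x') # g2) = G \<union> ?R \<union> (prism {z} z' S \<union> prism {x} y ?S)" by (simp add: Un_ac)
  have e3: "G \<union> collar S ((x, y) # (p # g1) @ (y, x') # g2) = G \<union> ?R \<union> (prism {x} y S \<union> prism {z} z' (subdiv {x} y S))"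
    using p T by (simp add: Un_ac)
  have "eqv V (G \<union> collar S ((p # g1) @ (x, x') # g2)) (G \<union> collar S ((x, y) # (p # g1) @ (y, x') # g2))"
    unfolding e1 e3 by (rule equivclp_trans[OF IH[THEN conjunct1, unfolded e2] equivclp_sym[OF sw]])
  moreover have "collar_end S ((p # g1) @ (x, x') # g2) = collar_end S ((x, y) # (p # g1) @ (y, x') # g2)"
    using IH p T by simp
  moreover have "valid F S ((x, y) # (p # g1) @ (y, x') # g2)"
  proof -
    have "{z} \<in> subdiv {x} y S" using v(1) xz d unfolding mem_subdiv by auto
    then show ?thesis using IH p T h v(2) yz(1) by (auto simp: insert_commute)
  qed
  ultimately show ?case by blast
qed

lemma split_first_push:
  assumes "x \<in> fst ` set g"
  obtains g1 x' g2 where "g = g1 @ (x, x') # g2" "x \<notin> fst ` set g1"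
proof -
  have "\<exists>g1 x' g2. g = g1 @ (x, x') # g2 \<and> x \<notin> fst ` set g1" using assms
  proof (induction g)
    case (Cons p g)
    show ?case
    proof (cases "fst p = x")
      case True
      then have "p # g = [] @ (x, snd p) # g" by auto
      then show ?thesis by (metis empty_iff image_empty list.set(1))
    next
      case False
      then obtain g1 x' g2 where "g = g1 @ (x, x') # g2" "x \<notin> fst ` set g1" using Cons by auto
      then have "p # g = (p # g1) @ (x, x') # g2" "x \<notin> fst ` set (p # g1)" using False by auto
      then show ?thesis by blast
    qed
  qed simp
  then show ?thesis using that by blast
qed

text \<open>A vertex that is missing from the outer boundary must be pushed somewhere in
  \<open>g\<close>, by \<open>unpushed_stays\<close>. Its first push is split and the lower half
  brought forward, for one entry of \<open>h\<close> after the other; the outer boundary, and with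
  it the protected set, never changes.\<close>

lemma insert_collar:
  fixes S :: "'a::infinite set set"
  assumes "cpx G" "cpx S" "S \<subseteq> G" "verts G \<subseteq> F" "valid F S g" "finite F"
    "distinct (map fst h)" "fst ` set h \<subseteq> verts S" "fst ` set h \<inter> verts (collar_end S g) = {}"
    "distinct (map snd h)" "snd ` set h \<inter> (F \<union> snd ` set g) = {}"
  shows "\<exists>g'. valid F S (h @ g') \<and> collar_end S (h @ g') = collar_end S g \<and>
     eqv (verts (collar_end S g)) (G \<union> collar S g) (G \<union> collar S (h @ g'))"
  using assms
proof (induction h arbitrary: G S F g)
  case Nil
  then show ?case by (intro exI[of _ g]) simp
next
  case (Cons p h)
  note a = Cons.prems
  obtain x y where p: "p = (x, y)" by (cases p)
  have x: "x \<in> verts S" "{x} \<in> S" "x \<notin> verts (collar_end S g)" using a(8,9) p in_verts_iff[OF a(2)] by auto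
  have SF: "verts S \<subseteq> F" using verts_mono[OF a(3)] a(4) by blast
  have y: "y \<notin> F" "y \<notin> snd ` set g" using a(11) p by auto
  have cb: "cpx (collar_end S g)" using collar_cpx[OF a(1-5)] by blast
  have "x \<in> fst ` set g"
  proof (rule ccontr)
    assume "x \<notin> fst ` set g"
    then have "{x} \<in> collar_end S g" using unpushed_stays[OF x(2) _ _ a(5)] x SF by blast
    then show False using x(3) unfolding verts_def by blast
  qed
  then obtain g1 x' g2 where g: "g = g1 @ (x, x') # g2" "x \<notin> fst ` set g1" by (rule split_first_push)
  let ?g = "g1 @ (y, x') # g2" let ?V = "verts (collar_end S g)"
  have yV: "y \<notin> ?V" using verts_collar_end_subset[of S g] y SF by blast
  have "fst ` set g \<inter> ?V = {}" by (rule pushed_gone[OF a(2) SF a(5)])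
  then have "?V \<inter> fst ` set g1 = {}" using g(1) by auto
  then have I: "eqv ?V (G \<union> collar S g) (G \<union> collar S ((x, y) # ?g)) \<and> collar_end S g = collar_end S ((x, y) # ?g) \<and> valid F S ((x, y) # ?g)"
    using insert_push[OF a(1-4) a(5)[unfolded g(1)] g(2) x(2) y(1) y(2)[unfolded g(1)] finite_verts[OF cb] _ x(3) yV]
    unfolding g(1) by blast
  have v: "valid (insert y F) (subdiv {x} y S) ?g" using I by simp
  note f = push_facts[OF a(1-3) x(2) y(1) a(4)]
  have b: "collar_end (subdiv {x} y S) ?g = collar_end S g" using I by simp
  have "\<exists>g'. valid (insert y F) (subdiv {x} y S) (h @ g') \<and> collar_end (subdiv {x} y S) (h @ g') = collar_end (subdiv {x} y S) ?g \<and>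
     eqv (verts (collar_end (subdiv {x} y S) ?g)) (G \<union> prism {x} y S \<union> collar (subdiv {x} y S) ?g) (G \<union> prism {x} y S \<union> collar (subdiv {x} y S) (h @ g'))"
  proof (rule Cons.IH[OF f(1-4) v])
    show "finite (insert y F)" using a(6) by simp
    show "distinct (map fst h)" "distinct (map snd h)" using a by auto
    have "x \<notin> fst ` set h" using a(7) p by auto
    then show "fst ` set h \<subseteq> verts (subdiv {x} y S)" using a(8) p unfolding f(9) by auto
    show "fst ` set h \<inter> verts (collar_end (subdiv {x} y S) ?g) = {}" using a(9) p unfolding b by auto
    show "snd ` set h \<inter> (insert y F \<union> snd ` set ?g) = {}" using a(10,11) p g(1) by auto
  qed
  then obtain g' where g': "valid (insert y F) (subdiv {x} y S) (h @ g')" "collar_end (subdiv {x} y S) (h @ g') = collar_end S g"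
    "eqv ?V (G \<union> prism {x} y S \<union> collar (subdiv {x} y S) ?g) (G \<union> prism {x} y S \<union> collar (subdiv {x} y S) (h @ g'))"
    unfolding b by blast
  have "eqv ?V (G \<union> collar S ((x, y) # ?g)) (G \<union> collar S ((p # h) @ g'))" using g'(3) p by (simp add: Un_assoc)
  then have "eqv ?V (G \<union> collar S g) (G \<union> collar S ((p # h) @ g'))" using equivclp_trans[OF I[THEN conjunct1]] by blast
  moreover have "valid F S ((p # h) @ g')" using g'(1) p x y by simp
  moreover have "collar_end S ((p # h) @ g') = collar_end S g" using g'(2) p by simp
  ultimately show ?case by blast
qed

lemma fresh_names:
  fixes E :: "'a::infinite set"
  assumes "finite E"
  shows "\<exists>ys. length ys = n \<and> distinct ys \<and> set ys \<inter> E = {}"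
proof (induction n)
  case (Suc n)
  then obtain ys where ys: "length ys = n" "distinct ys" "set ys \<inter> E = {}" by blast
  have "finite (set ys \<union> E)" using assms by simp
  then obtain y where "y \<notin> set ys \<union> E" by (rule ex_fresh)
  then show ?case using ys by (intro exI[of _ "y # ys"]) auto
qed simp

lemma valid_distinct:
  assumes "cpx S" "verts S \<subseteq> F" "distinct (map fst h)" "fst ` set h \<subseteq> verts S" "distinct (map snd h)" "snd ` set h \<inter> F = {}"
  shows "valid F S h"
  using assms
proof (induction h arbitrary: S F)
  case (Cons p h)
  note a = Cons.prems
  obtain x y where p: "p = (x, y)" by (cases p)
  have x: "{x} \<in> S" "y \<notin> F" using a p in_verts_iff[OF a(1)] by auto
  note f = push_facts[OF a(1,1) order_refl x a(2)]
  have "valid (insert y F) (subdiv {x} y S) h"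
  proof (rule Cons.IH[OF f(2)])
    show "verts (subdiv {x} y S) \<subseteq> insert y F" using f(9,10) by blast
    show "fst ` set h \<subseteq> verts (subdiv {x} y S)" using a(3,4) p unfolding f(9) by auto
  qed (use a p in auto)
  then show ?case using x p by simp
qed simp

lemma ex_full_collar:
  fixes S :: "'a::infinite set set"
  assumes "cpx S" "verts S \<subseteq> F" "finite F" "finite E"
  obtains h where "distinct (map fst h)" "fst ` set h = verts S" "distinct (map snd h)" "snd ` set h \<inter> (F \<union> E) = {}"
    "valid F S h" "verts (collar_end S h) \<inter> verts S = {}"
proof -
  obtain xs where xs: "set xs = verts S" "distinct xs" using finite_distinct_list[OF finite_verts[OF assms(1)]] by blast
  have "finite (F \<union> E)" using assms by simp
  then obtain ys where ys: "length ys = length xs" "distinct ys" "set ys \<inter> (F \<union> E) = {}" using fresh_names by blast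
  let ?h = "zip xs ys"
  have m: "map fst ?h = xs" "map snd ?h = ys" using ys by auto
  have s: "fst ` set ?h = verts S" "snd ` set ?h = set ys" using m xs by (metis list.set_map)+
  have v: "valid F S ?h" by (rule valid_distinct[OF assms(1,2)]) (use m s xs ys in auto)
  have "verts (collar_end S ?h) \<inter> verts S = {}" using pushed_gone[OF assms(1,2) v] s by blast
  then show ?thesis using that[of ?h] m s xs ys v by auto
qed

text \<open>The collar \<open>g\<close> is refined to \<open>h @ g'\<close>. Since \<open>h\<close>
  is full, the complex with collar \<open>h\<close> is tame with starrable links, so
  \<open>g'\<close> may be added to it or removed from it.\<close>

lemma collar_independent:
  fixes K :: "'a::infinite set set"
  assumes K: "cpx K" "cpx S" "S \<subseteq> K" "verts K \<subseteq> F" "finite F" "valid F S g"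
    and full: "verts (collar_end S g) \<inter> verts S = {}"
    and h: "distinct (map fst h)" "fst ` set h = verts S" "distinct (map snd h)" "snd ` set h \<inter> (F \<union> snd ` set g) = {}"
      "valid F S h" "verts (collar_end S h) \<inter> verts S = {}"
  shows "starrable (K \<union> collar S g) (collar_end S g) \<longleftrightarrow> starrable (K \<union> collar S h) (collar_end S h)"
proof -
  obtain g' where g': "valid F S (h @ g')" "collar_end S (h @ g') = collar_end S g"
     "eqv (verts (collar_end S g)) (K \<union> collar S g) (K \<union> collar S (h @ g'))"
    using insert_collar[OF K(1-4,6,5) h(1) _ _ h(3,4)] h(2) full by blast
  let ?T = "K \<union> collar S h"
  have e: "K \<union> collar S (h @ g') = ?T \<union> collar (collar_end S h) g'" by (simp add: collar_append Un_assoc)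
  have 1: "starrable (K \<union> collar S g) (collar_end S g) \<longleftrightarrow> starrable (?T \<union> collar (collar_end S h) g') (collar_end (collar_end S h) g')"
    using starrable_eqv[OF g'(3)] unfolding e using g'(2) by (simp add: collar_end_append)
  have c: "cpx ?T" "cpx (collar_end S h)" "collar_end S h \<subseteq> ?T" using collar_cpx[OF K(1-4) h(5)] by auto
  have v: "valid (F \<union> snd ` set h) (collar_end S h) g'" using g'(1) by (simp add: valid_append)
  have T: "verts ?T \<subseteq> F \<union> snd ` set h"
    using verts_collar_subset[of S h] verts_mono[OF K(3)] K(4) unfolding verts_Un by blast
  show ?thesis
    unfolding 1
    using starrable_collar[OF c T v] starrable_uncollar[OF c T v collar_tame_good[OF K(1-4) h(5,6)]] by blast
qed

text \<open>The collar is required to be full so that, whatever \<open>K\<close> is, the enlarged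
  complex is tame with starrable links. That one full collar suffices is harmless by
  \<open>collar_starrable_all\<close>.\<close>

definition collar_starrable :: "'a set set \<Rightarrow> 'a set set \<Rightarrow> bool" where
  "collar_starrable K S \<longleftrightarrow> (\<exists>g. valid (verts K) S g \<and> verts (collar_end S g) \<inter> verts S = {} \<and> starrable (K \<union> collar S g) (collar_end S g))"

text \<open>The names in two given collars may clash, so both are compared with a third one that
  avoids the names of both.\<close>

lemma collar_starrable_all:
  fixes K :: "'a::infinite set set"
  assumes K: "cpx K" "cpx S" "S \<subseteq> K" and "collar_starrable K S" and g: "valid F S g" "verts K \<subseteq> F" "verts (collar_end S g) \<inter> verts S = {}"
  shows "starrable (K \<union> collar S g) (collar_end S g)"
proof -
  obtain g1 where g1: "valid (verts K) S g1" "verts (collar_end S g1) \<inter> verts S = {}" "starrable (K \<union> collar S g1) (collar_end S g1)"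
    using assms(4) unfolding collar_starrable_def by blast
  have vg: "valid (verts K) S g" by (rule valid_mono[OF g(1,2)])
  have "finite (snd ` set g1 \<union> snd ` set g)" by simp
  then obtain h where h: "distinct (map fst h)" "fst ` set h = verts S" "distinct (map snd h)"
     "snd ` set h \<inter> (verts K \<union> (snd ` set g1 \<union> snd ` set g)) = {}" "valid (verts K) S h" "verts (collar_end S h) \<inter> verts S = {}"
    by (rule ex_full_collar[OF K(2) verts_mono[OF K(3)] finite_verts[OF K(1)]])
  have "starrable (K \<union> collar S g1) (collar_end S g1) \<longleftrightarrow> starrable (K \<union> collar S h) (collar_end S h)"
    by (rule collar_independent[OF K order_refl finite_verts[OF K(1)] g1(1,2) h(1-3) _ h(5,6)]) (use h(4) in blast)
  moreover have "starrable (K \<union> collar S g) (collar_end S g) \<longleftrightarrow> starrable (K \<union> collar S h) (collar_end S h)"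
    by (rule collar_independent[OF K order_refl finite_verts[OF K(1)] vg g(3) h(1-3) _ h(5,6)]) (use h(4) in blast)
  ultimately show ?thesis using g1 by blast
qed

lemma collar_starrable_I:
  assumes "valid F S g" "verts K \<subseteq> F" "verts (collar_end S g) \<inter> verts S = {}" "starrable (K \<union> collar S g) (collar_end S g)"
  shows "collar_starrable K S"
  unfolding collar_starrable_def using valid_mono[OF assms(1,2)] assms(3,4) by blast

lemma starrable_if_collar_starrable:
  fixes K :: "'a::infinite set set"
  assumes K: "cpx K" "cpx S" "S \<subseteq> K" and "collar_starrable K S" "tame_rel K S" "links_starrable K S"
  shows "starrable K S"
proof -
  obtain g where "valid (verts K) S g" "starrable (K \<union> collar S g) (collar_end S g)" using assms(4) unfolding collar_starrable_def by blast
  then show ?thesis using starrable_uncollar[OF K order_refl _ assms(5,6)] by blast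
qed

lemma collar_starrable_cone:
  fixes S :: "'a::infinite set set"
  assumes S: "cpx S" and v: "v \<notin> verts S"
  shows "collar_starrable (cone v S) S"
proof -
  have SK: "S \<subseteq> cone v S" using v cpx_down[OF S] unfolding cone_def by blast
  have c: "cpx (cone v S)" by (rule cpx_cone[OF S])
  obtain h where h: "valid (verts (cone v S)) S h" "verts (collar_end S h) \<inter> verts S = {}"
    by (rule ex_full_collar[OF S verts_mono[OF SK] finite_verts[OF c] finite.emptyI])
  have "starrable (cone v S \<union> collar S h) (collar_end S h)" by (rule starrable_collar[OF c S SK order_refl h(1) starrable_cone[OF v]])
  then show ?thesis by (rule collar_starrable_I[OF h(1) order_refl h(2)])
qed

text \<open>Under a full collar no vertex of \<open>K\<close> is on the outer boundary, so every
  nonempty face of \<open>K\<close> is an admissible base, even one inside \<open>verts S\<close>.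
  As \<sigma> is not in \<open>S\<close>, it is not in the collar, and the collar is not
  affected.\<close>

lemma collar_starrable_interior_subdiv:
  fixes K :: "'a::infinite set set"
  assumes K: "cpx K" "cpx S" "S \<subseteq> K" and \<sigma>: "\<sigma> \<in> K" "\<sigma> \<notin> S" "s \<notin> verts K"
  shows "collar_starrable (subdiv \<sigma> s K) S \<longleftrightarrow> collar_starrable K S"
proof -
  have SK: "verts S \<subseteq> verts K" by (rule verts_mono[OF K(3)])
  have \<sigma>0: "\<sigma> \<noteq> {}" using \<sigma> cpx_empty[OF K(2)] by blast
  let ?F = "insert s (verts K)" let ?K = "subdiv \<sigma> s K"
  have c: "cpx ?K" by (rule cpx_subdiv[OF K(1) \<sigma>0])
  have m: "S \<subseteq> ?K"
  proof
    fix \<tau> assume t: "\<tau> \<in> S"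
    then have "\<not> \<sigma> \<subseteq> \<tau>" using cpx_down[OF K(2) t] \<sigma> by blast
    moreover have "s \<notin> \<tau>" using t \<sigma> SK face_verts by blast
    ultimately show "\<tau> \<in> ?K" using t K(3) unfolding mem_subdiv by auto
  qed
  obtain g where g: "valid ?F S g" "verts (collar_end S g) \<inter> verts S = {}"
    by (rule ex_full_collar[OF K(2) _ _ finite.emptyI, of ?F]) (use SK finite_verts[OF K(1)] in auto)
  have vK: "verts K \<subseteq> ?F" "verts ?K \<subseteq> ?F" using verts_subdiv_subset[of \<sigma> s K] by auto
  have d: "verts (collar_end S g) \<inter> ?F = {}" by (rule full_disjoint[OF _ g]) (use SK in auto)
  have subdiv: "subdiv \<sigma> s (K \<union> collar S g) = ?K \<union> collar S g"
  proof -
    have "subdiv \<sigma> s (collar S g) = collar S g"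
    proof (rule subdiv_id)
      show "s \<notin> verts (collar S g)" by (rule old_not_in_collar(1)[OF g(1)]) (use SK \<sigma> in auto)
      fix \<tau> assume t: "\<tau> \<in> collar S g"
      show "\<not> \<sigma> \<subseteq> \<tau>"
      proof
        assume "\<sigma> \<subseteq> \<tau>"
        then have "\<sigma> \<in> collar S g" by (rule collar_down[OF g(1) K(2) t])
        moreover have "\<sigma> \<inter> snd ` set g = {}" using valid_names[OF g(1)] face_verts[OF \<sigma>(1)] by blast
        ultimately have "\<sigma> \<in> S" by (rule collar_old_face[OF K(2) g(1)])
        then show False using \<sigma> by blast
      qed
    qed
    then show ?thesis by (simp add: subdiv_Un)
  qed
  have "eqv (verts (collar_end S g)) (K \<union> collar S g) (subdiv \<sigma> s (K \<union> collar S g))"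
  proof (rule eqv_subdiv)
    show "cpx (K \<union> collar S g)" using collar_cpx[OF K vK(1) g(1)] by blast
    show "\<sigma> \<in> K \<union> collar S g" using \<sigma> by blast
    show "\<not> \<sigma> \<subseteq> verts (collar_end S g)" using d face_verts[OF \<sigma>(1)] \<sigma>0 by blast
    show "s \<notin> verts (collar_end S g)" using d by blast
    show "s \<notin> verts (K \<union> collar S g)"
      using \<sigma>(3) old_not_in_collar(1)[OF g(1), of s] SK by (auto simp: verts_Un)
  qed
  then have e: "starrable (?K \<union> collar S g) (collar_end S g) \<longleftrightarrow> starrable (K \<union> collar S g) (collar_end S g)" unfolding subdiv by (rule starrable_eqv)
  show ?thesis
  proof
    assume "collar_starrable ?K S"
    then have "starrable (?K \<union> collar S g) (collar_end S g)" by (rule collar_starrable_all[OF c K(2) m _ g(1) vK(2) g(2)])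
    then show "collar_starrable K S" using collar_starrable_I[OF g(1) vK(1) g(2)] e by simp
  next
    assume "collar_starrable K S"
    then have "starrable (K \<union> collar S g) (collar_end S g)" by (rule collar_starrable_all[OF K _ g(1) vK(1) g(2)])
    then show "collar_starrable ?K S" using collar_starrable_I[OF g(1) vK(2) g(2)] e by simp
  qed
qed

section \<open>Collars and subdivisions of the boundary\<close>

lemma mem_cong: "X = Y \<Longrightarrow> X \<in> S \<longleftrightarrow> Y \<in> S"
  by simp

lemma push_subdiv_subdiv:
  assumes S: "cpx S" and x: "x \<in> A" "A \<in> S" and f: "a \<notin> verts S" "a1 \<notin> verts S" "x' \<notin> verts S"
    and d: "a \<noteq> a1" "a \<noteq> x'" "a1 \<noteq> x'" and K: "x' \<notin> verts K" "a1 \<notin> verts K"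
  shows "subdiv (A - {x} \<union> {x'}) a1 (subdiv A a (K \<union> prism {x} x' S)) =
    subdiv A a K \<union> (prism {x} x' (subdiv A a S) \<union> prism {a} a1 (subdiv {x} x' (subdiv A a S)))"
proof -
  let ?A = "A - {x} \<union> {x'}"
  have vs: "verts (subdiv A a K) \<subseteq> insert a (verts K)" by (rule verts_subdiv_subset)
  have 1: "subdiv ?A a1 (subdiv A a K) = subdiv A a K"
  proof (rule subdiv_id)
    show "a1 \<notin> verts (subdiv A a K)" using vs K d by blast
    fix \<tau> assume "\<tau> \<in> subdiv A a K"
    then have "x' \<notin> \<tau>" using face_verts[of \<tau> "subdiv A a K"] vs K d by blast
    then show "\<not> ?A \<subseteq> \<tau>" by blast
  qed
  have 2: "subdiv ?A a1 (subdiv A a (prism {x} x' S)) = prism {x} x' (subdiv A a S) \<union> prism {a} a1 (subdiv {x} x' (subdiv A a S))"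
  proof (rule set_eqI)
    fix \<tau>
    have n: "a \<notin> X" "a1 \<notin> X" "x' \<notin> X" if "X \<in> S" for X using that f face_verts by blast+
    have nA: "a \<notin> A" "a1 \<notin> A" "x' \<notin> A" using n x by auto
    have dx: "x \<noteq> a" "x \<noteq> a1" "x \<noteq> x'" using nA x by auto
    \<comment> \<open>\<open>X\<close> says that \<tau> without the new vertices spans a face with
      \<open>A\<close>, and \<open>Y\<close> that \<tau> lies in the prism over \<open>x\<close>.
      All three complexes are described through these two conditions.\<close>
    define X where "X \<longleftrightarrow> \<tau> - {a} - {a1} - {x'} \<union> A \<in> S"
    define Y where "Y \<longleftrightarrow> \<tau> - {x'} \<union> {x} \<in> S"
    have sA: "?A \<subseteq> \<tau> \<longleftrightarrow> A - {x} \<subseteq> \<tau> \<and> x' \<in> \<tau>" by blast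
    have L: "\<tau> \<in> subdiv ?A a1 (subdiv A a (prism {x} x' S)) \<longleftrightarrow>
       \<not> (A - {x} \<subseteq> \<tau> \<and> x' \<in> \<tau>) \<and> (if a1 \<in> \<tau> then x \<notin> \<tau> \<and> X else \<not> A \<subseteq> \<tau> \<and> (if a \<in> \<tau> then X else Y))"
    proof (cases "a1 \<in> \<tau>")
      case True
      have e: "A \<subseteq> \<tau> - {a1} \<union> ?A \<longleftrightarrow> x \<in> \<tau>" "a \<in> \<tau> - {a1} \<union> ?A \<longleftrightarrow> a \<in> \<tau>"
        "\<tau> - {a1} \<union> ?A - {a} \<union> A - {x'} \<union> {x} = \<tau> - {a} - {a1} - {x'} \<union> A"
        using nA dx x d by blast+
      have e2: "\<tau> - {a1} \<union> ?A - {x'} \<union> {x} \<in> S \<longleftrightarrow> X" if "a \<notin> \<tau>"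
        unfolding X_def by (rule mem_cong) (use nA dx x d that in blast)
      show ?thesis using True e2 unfolding mem_subdiv prism_def mem_Collect_eq e sA X_def by auto
    next
      case False
      have e: "\<tau> - {a} \<union> A - {x'} \<union> {x} \<in> S \<longleftrightarrow> X"
        unfolding X_def by (rule mem_cong) (use nA dx x False in blast)
      show ?thesis using False unfolding mem_subdiv prism_def mem_Collect_eq e sA Y_def by auto
    qed
    have R1: "\<tau> \<in> prism {x} x' (subdiv A a S) \<longleftrightarrow> a1 \<notin> \<tau> \<and> \<not> A - {x} \<subseteq> \<tau> \<and> (if a \<in> \<tau> then X else Y)"
    proof (cases "a1 \<in> \<tau>")
      case True
      have "\<tau> - {x'} \<union> {x} - {a} \<union> A \<notin> S" "\<tau> - {x'} \<union> {x} \<notin> S"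
        using n(2)[of "\<tau> - {x'} \<union> {x} - {a} \<union> A"] n(2)[of "\<tau> - {x'} \<union> {x}"] True d by blast+
      then show ?thesis using True unfolding prism_def mem_Collect_eq mem_subdiv by auto
    next
      case False
      have e: "A \<subseteq> \<tau> - {x'} \<union> {x} \<longleftrightarrow> A - {x} \<subseteq> \<tau>" "a \<in> \<tau> - {x'} \<union> {x} \<longleftrightarrow> a \<in> \<tau>" using nA dx d by blast+
      have e2: "\<tau> - {x'} \<union> {x} - {a} \<union> A \<in> S \<longleftrightarrow> X"
        unfolding X_def by (rule mem_cong) (use nA dx x False in blast)
      show ?thesis using False unfolding prism_def mem_Collect_eq mem_subdiv e e2 Y_def by auto
    qed
    have R2: "\<tau> \<in> prism {a} a1 (subdiv {x} x' (subdiv A a S)) \<longleftrightarrow> x \<notin> \<tau> \<and> \<not> (A - {x} \<subseteq> \<tau> \<and> x' \<in> \<tau>) \<and> X"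
    proof -
      have e: "{x} \<subseteq> \<tau> - {a1} \<union> {a} \<longleftrightarrow> x \<in> \<tau>" "x' \<in> \<tau> - {a1} \<union> {a} \<longleftrightarrow> x' \<in> \<tau>"
        "A \<subseteq> \<tau> - {a1} \<union> {a} - {x'} \<union> {x} \<longleftrightarrow> A - {x} \<subseteq> \<tau>" "a \<in> \<tau> - {a1} \<union> {a} - {x'} \<union> {x} \<longleftrightarrow> True"
        "A \<subseteq> \<tau> - {a1} \<union> {a} \<longleftrightarrow> A \<subseteq> \<tau>" "a \<in> \<tau> - {a1} \<union> {a} \<longleftrightarrow> True"
        using nA dx d by blast+
      have e1: "\<tau> - {a1} \<union> {a} - {x'} \<union> {x} - {a} \<union> A \<in> S \<longleftrightarrow> X"
        unfolding X_def by (rule mem_cong) (use nA x in blast)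
      have e2: "\<tau> - {a1} \<union> {a} - {a} \<union> A \<in> S \<longleftrightarrow> X" if "x' \<notin> \<tau>"
        unfolding X_def by (rule mem_cong) (use that in blast)
      have e3: "x \<notin> \<tau> \<Longrightarrow> \<not> A \<subseteq> \<tau>" using x by blast
      show ?thesis unfolding prism_def mem_Collect_eq mem_subdiv e e1 using e2 e3 by auto
    qed
    have XY: "a \<notin> \<tau> \<Longrightarrow> a1 \<notin> \<tau> \<Longrightarrow> X \<Longrightarrow> Y"
      unfolding X_def Y_def by (erule cpx_down[OF S]) (use x in blast)
    have YX: "a \<notin> \<tau> \<Longrightarrow> a1 \<notin> \<tau> \<Longrightarrow> A - {x} \<subseteq> \<tau> \<Longrightarrow> Y \<Longrightarrow> X"
      unfolding X_def Y_def by (erule cpx_down[OF S]) (use nA in blast)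
    have XY': "a \<notin> \<tau> \<and> a1 \<notin> \<tau> \<and> X \<longrightarrow> Y" using XY by blast
    have YX': "a \<notin> \<tau> \<and> a1 \<notin> \<tau> \<and> A - {x} \<subseteq> \<tau> \<and> Y \<longrightarrow> X" using YX by blast
    have Ax: "A \<subseteq> \<tau> \<longleftrightarrow> A - {x} \<subseteq> \<tau> \<and> x \<in> \<tau>" using x by blast
    show "\<tau> \<in> subdiv ?A a1 (subdiv A a (prism {x} x' S)) \<longleftrightarrow> \<tau> \<in> prism {x} x' (subdiv A a S) \<union> prism {a} a1 (subdiv {x} x' (subdiv A a S))"
      unfolding Un_iff L R1 R2 Ax if_bool_eq_conj
      using XY' YX' by argo
  qed
  show ?thesis unfolding subdiv_Un 1 2 ..
qed

text \<open>The counterpart of \<open>push_subdiv_subdiv\<close> for the outer boundary. There the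
  push acts as a renaming of \<open>x\<close>, so the claim is a renamed instance of
  \<open>subdiv_subdiv_vertex\<close>.\<close>

lemma subdiv_push_image:
  assumes "x \<in> A" "A \<in> S" and f: "a \<notin> verts S" "a1 \<notin> verts S" "x' \<notin> verts S"
    and d: "a \<noteq> a1" "a \<noteq> x'" "a1 \<noteq> x'"
  shows "subdiv (A - {x} \<union> {x'}) a1 (subdiv {x} x' S) = subdiv {a} a1 (subdiv {x} x' (subdiv A a S))"
proof -
  let ?f = "transpose x x'"
  have b: "bij ?f" by simp
  have AS: "A \<subseteq> verts S" by (rule face_verts[OF assms(2)])
  have "x' \<notin> A" "x \<noteq> a" "x \<noteq> a1" using AS f assms(1) by auto
  then have fa: "?f a = a" "?f a1 = a1" "?f ` A = A - {x} \<union> {x'}"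
    using d assms(1) by (auto simp: transpose_def)
  have v: "x' \<notin> verts (subdiv A a S)" using verts_subdiv_subset[of A a S] f d by blast
  have "subdiv (A - {x} \<union> {x'}) a1 (subdiv {x} x' S) = relabel ?f (subdiv A a1 S)"
    using relabel_subdiv[OF b, of A a1 S] fa subdiv_singleton_relabel[OF f(3), of x] by simp
  also have "subdiv A a1 S = subdiv {a} a1 (subdiv A a S)" by (rule subdiv_subdiv_vertex[symmetric]) (use f d assms in auto)
  also have "relabel ?f (subdiv {a} a1 (subdiv A a S)) = subdiv {a} a1 (subdiv {x} x' (subdiv A a S))"
    using relabel_subdiv[OF b, of "{a}" a1 "subdiv A a S"] fa subdiv_singleton_relabel[OF v, of x] by simp
  finally show ?thesis .
qed

text \<open>
  Once a vertex \<open>x\<close> of \<open>A\<close> has been pushed out, \<open>A\<close> is an admissible base. Subdividing \<open>A\<close> and then its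
  pushed copy amounts to pushing \<open>x\<close> and then \<open>a\<close> out of the boundary subdivided at \<open>A\<close>.
\<close>

lemma starrable_collar_subdiv:
  fixes K :: "'a::infinite set set"
  assumes "cpx K" "cpx S" "S \<subseteq> K" "verts K \<subseteq> F" "finite F" "valid F S g" "A \<in> S" "\<And>x. \<not> A \<subseteq> {x}"
    "a \<in> F" "a \<notin> verts K" "tame_rel (K \<union> collar S g) (collar_end S g)" "links_starrable (K \<union> collar S g) (collar_end S g)"
  shows "\<exists>g'. valid F (subdiv A a S) g' \<and>
     verts (collar_end (subdiv A a S) g') \<subseteq> verts (collar_end S g) \<union> (if A \<subseteq> verts (collar_end S g) then {a} else - F) \<and>
     (starrable (K \<union> collar S g) (collar_end S g) \<longleftrightarrow> starrable (subdiv A a K \<union> collar (subdiv A a S) g') (collar_end (subdiv A a S) g'))"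
  using assms
proof (induction g arbitrary: K S F A a)
  case Nil
  note h = Nil.prems
  have A0: "A \<noteq> {}" using h(8) by blast
  have hh: "tame_rel K S" "links_starrable K S" using h(11,12) by auto
  have "starrable (lk A K) (lk A S)" using hh(2) h(7) A0 unfolding links_starrable_def by blast
  then have "starrable K S \<longleftrightarrow> starrable (subdiv A a K) (subdiv A a S)"
    using starrable_subdiv[OF h(1-3,7) A0 h(10) hh] starrable_unsub[OF h(1-3,7) A0 h(10) hh(1)] by blast
  \<comment> \<open>If no vertex of \<open>A\<close> is pushed out, \<open>a\<close> stays on the
    outer boundary. Otherwise all additional outer vertices have names outside \<open>F\<close>;
    this bound is what keeps a full collar full.\<close>
  moreover have "verts (subdiv A a S) \<subseteq> verts S \<union> {a}" using verts_subdiv_subset[of A a S] by blast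
  moreover have "A \<subseteq> verts S" by (rule face_verts[OF h(7)])
  ultimately show ?case by (intro exI[of _ "[]"]) simp
next
  case (Cons p g)
  note h = Cons.prems
  have A0: "A \<noteq> {}" using h(8) by blast
  obtain x x' where p: "p = (x, x')" by (cases p)
  have v: "{x} \<in> S" "x' \<notin> F" "valid (insert x' F) (subdiv {x} x' S) g" using h(6) p by auto
  note f = push_facts[OF h(1-3) v(1,2) h(4)]
  let ?K = "K \<union> prism {x} x' S" let ?S = "subdiv {x} x' S" let ?F = "insert x' F"
  have e: "K \<union> collar S (p # g) = ?K \<union> collar ?S g" "collar_end S (p # g) = collar_end ?S g" using p by (simp_all add: Un_assoc)
  have aS: "a \<notin> verts S" using verts_mono[OF h(3)] h(10) by blast
  have ax: "a \<noteq> x'" "a \<noteq> x" using h(9) v(2) aS f(7) by auto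
  have AS: "A \<subseteq> verts S" by (rule face_verts[OF h(7)])
  have x'A: "x' \<notin> A" "a \<notin> A" using AS f(6) aS by auto
  have xS': "{x} \<in> subdiv A a S" using v(1) h(8)[of x] ax unfolding mem_subdiv by auto
  have vK: "verts ?K \<subseteq> insert x' (verts K)"
    using verts_prism_subset[of "{x}" x' S] verts_mono[OF h(3)] unfolding verts_Un by blast
  have aK: "a \<notin> verts ?K" using vK h(10) ax by blast
  show ?case
  proof (cases "x \<in> A")
    case False
    have AS': "A \<in> ?S" using h(7) False x'A unfolding mem_subdiv by auto
    have "\<exists>g'. valid ?F (subdiv A a ?S) g' \<and>
     verts (collar_end (subdiv A a ?S) g') \<subseteq> verts (collar_end ?S g) \<union> (if A \<subseteq> verts (collar_end ?S g) then {a} else - ?F) \<and>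
     (starrable (?K \<union> collar ?S g) (collar_end ?S g) \<longleftrightarrow> starrable (subdiv A a ?K \<union> collar (subdiv A a ?S) g') (collar_end (subdiv A a ?S) g'))"
      by (rule Cons.IH[OF f(1-4) _ v(3) AS' h(8) _ aK]) (use h(5,9,11,12) e in auto)
    then obtain g' where g': "valid ?F (subdiv A a ?S) g'"
      "verts (collar_end (subdiv A a ?S) g') \<subseteq> verts (collar_end ?S g) \<union> (if A \<subseteq> verts (collar_end ?S g) then {a} else - ?F)"
      "starrable (?K \<union> collar ?S g) (collar_end ?S g) \<longleftrightarrow> starrable (subdiv A a ?K \<union> collar (subdiv A a ?S) g') (collar_end (subdiv A a ?S) g')" by blast
    have c1: "subdiv A a ?S = subdiv {x} x' (subdiv A a S)" by (rule subdiv_push_comm) (use False ax x'A in auto)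
    have c2: "subdiv A a ?K = subdiv A a K \<union> prism {x} x' (subdiv A a S)"
      unfolding subdiv_Un using subdiv_prism_comm[of x A a x' S] False ax x'A by simp
    have "valid F (subdiv A a S) ((x, x') # g')" using xS' v(2) g'(1) c1 by simp
    moreover have "verts (collar_end (subdiv A a S) ((x, x') # g')) \<subseteq>
        verts (collar_end S (p # g)) \<union> (if A \<subseteq> verts (collar_end S (p # g)) then {a} else - F)"
      using g'(2) c1 unfolding e(2) by (auto split: if_splits)
    moreover have "starrable (K \<union> collar S (p # g)) (collar_end S (p # g)) \<longleftrightarrow>
        starrable (subdiv A a K \<union> collar (subdiv A a S) ((x, x') # g')) (collar_end (subdiv A a S) ((x, x') # g'))"
      unfolding e using g'(3) unfolding c1 c2 by (simp add: Un_assoc)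
    ultimately show ?thesis by blast
  next
    case True
    have "finite (?F \<union> snd ` set g)" using h(5) by simp
    then obtain a1 where a1: "a1 \<notin> ?F \<union> snd ` set g" by (rule ex_fresh)
    let ?A = "A - {x} \<union> {x'}" let ?K2 = "subdiv A a ?K" let ?F2 = "insert a1 ?F"
    have d: "a \<noteq> a1" "a1 \<noteq> x'" "a1 \<notin> verts S" "a1 \<notin> verts K" using a1 h(4,9) f(10) by auto
    have cK2: "cpx ?K2" by (rule cpx_subdiv[OF f(1) A0])
    have noA: "\<not> A \<subseteq> \<tau>" if "x \<notin> \<tau>" for \<tau> using True that by blast
    have m2: "?S \<subseteq> ?K2"
    proof
      fix \<tau> assume t: "\<tau> \<in> ?S"
      have "x \<notin> \<tau>" using t unfolding mem_subdiv by blast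
      moreover have "a \<notin> \<tau>" using face_verts[OF t] ax aS unfolding f(9) by blast
      moreover have "\<tau> \<in> ?K" using t f(3) by blast
      ultimately show "\<tau> \<in> ?K2" using noA unfolding mem_subdiv[of _ A] by simp
    qed
    have vK2: "verts ?K2 \<subseteq> insert a (verts ?K)" by (rule verts_subdiv_subset)
    have xN: "x \<notin> verts (collar ?S g)" "x \<notin> verts (collar_end ?S g)"
      using old_not_in_collar[OF v(3), of x] f(7-10) by auto
    have aN: "a \<notin> verts (collar ?S g)" "a \<notin> verts (collar_end ?S g)"
      using old_not_in_collar[OF v(3), of a] h(9) aS ax unfolding f(9) by auto
    have e2: "subdiv A a (?K \<union> collar ?S g) = ?K2 \<union> collar ?S g"
    proof -
      have "subdiv A a (collar ?S g) = collar ?S g"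
        by (rule subdiv_id[OF _ aN(1)]) (use noA xN face_verts in blast)
      then show ?thesis by (simp add: subdiv_Un)
    qed
    have col: "cpx (?K \<union> collar ?S g)" "cpx (collar_end ?S g)" "collar_end ?S g \<subseteq> ?K \<union> collar ?S g"
      using collar_cpx[OF f(1-4) v(3)] by auto
    have AK: "A \<in> ?K \<union> collar ?S g" using h(3,7) by blast
    have AV: "\<not> A \<subseteq> verts (collar_end ?S g)" using True xN by blast
    have aKN: "a \<notin> verts (?K \<union> collar ?S g)" using aK aN by (simp add: verts_Un)
    have "eqv (verts (collar_end ?S g)) (?K \<union> collar ?S g) (?K2 \<union> collar ?S g)"
      unfolding e2[symmetric] by (rule eqv_subdiv[OF col(1) AK AV aN(2) aKN])
    then have Ue: "starrable (?K2 \<union> collar ?S g) (collar_end ?S g) \<longleftrightarrow> starrable (?K \<union> collar ?S g) (collar_end ?S g)" by (rule starrable_eqv)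
    have t2: "tame_rel (?K2 \<union> collar ?S g) (collar_end ?S g)"
      unfolding e2[symmetric] by (rule tame_rel_interior_subdiv[OF _ AV aN(2)]) (use h(11) e in simp)
    have g2: "links_starrable (?K2 \<union> collar ?S g) (collar_end ?S g)"
      unfolding e2[symmetric] by (rule links_starrable_subdiv[OF col AK AV aKN]) (use h(12) e in simp)
    have v2: "valid ?F2 ?S g" by (rule valid_insert[OF v(3)]) (use a1 in simp)
    have A1: "?A \<in> ?S"
    proof -
      have "\<not> {x} \<subseteq> ?A" "x' \<in> ?A" "?A - {x'} \<union> {x} = A" using f(8) True x'A by blast+
      then show ?thesis using h(7) unfolding mem_subdiv by simp
    qed
    have A1b: "\<not> ?A \<subseteq> {z}" for z
    proof
      assume s: "?A \<subseteq> {z}"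
      then have "z = x'" by blast
      then have "A \<subseteq> {x}" using s x'A by blast
      then show False using h(8) by blast
    qed
    have "\<exists>g'. valid ?F2 (subdiv ?A a1 ?S) g' \<and>
     verts (collar_end (subdiv ?A a1 ?S) g') \<subseteq> verts (collar_end ?S g) \<union> (if ?A \<subseteq> verts (collar_end ?S g) then {a1} else - ?F2) \<and>
     (starrable (?K2 \<union> collar ?S g) (collar_end ?S g) \<longleftrightarrow> starrable (subdiv ?A a1 ?K2 \<union> collar (subdiv ?A a1 ?S) g') (collar_end (subdiv ?A a1 ?S) g'))"
    proof (rule Cons.IH[OF cK2 f(2) m2 _ _ v2 A1 A1b _ _ t2 g2])
      show "verts ?K2 \<subseteq> ?F2" using vK2 vK h(4,9) by blast
      show "a1 \<notin> verts ?K2" using vK2 vK d a1 by blast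
    qed (use h(5) in auto)
    then obtain g' where g': "valid ?F2 (subdiv ?A a1 ?S) g'"
     "verts (collar_end (subdiv ?A a1 ?S) g') \<subseteq> verts (collar_end ?S g) \<union> (if ?A \<subseteq> verts (collar_end ?S g) then {a1} else - ?F2)"
     "starrable (?K2 \<union> collar ?S g) (collar_end ?S g) \<longleftrightarrow> starrable (subdiv ?A a1 ?K2 \<union> collar (subdiv ?A a1 ?S) g') (collar_end (subdiv ?A a1 ?S) g')"
      by blast
    have c1: "subdiv ?A a1 ?S = subdiv {a} a1 (subdiv {x} x' (subdiv A a S))"
      by (rule subdiv_push_image[OF True h(7) aS d(3) f(6) d(1) ax(1) d(2)])
    have c2: "subdiv ?A a1 ?K2 = subdiv A a K \<union> (prism {x} x' (subdiv A a S) \<union> prism {a} a1 (subdiv {x} x' (subdiv A a S)))"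
      by (rule push_subdiv_subdiv[OF h(2) True h(7) aS d(3) f(6) d(1) ax(1) d(2) f(5) d(4)])
    let ?g = "(x, x') # (a, a1) # g'"
    have "{a} \<in> subdiv A a S" using h(7) x'A A0 unfolding mem_subdiv by auto
    then have "{a} \<in> subdiv {x} x' (subdiv A a S)" using ax unfolding mem_subdiv[of _ "{x}"] by auto
    then have "valid F (subdiv A a S) ?g" using xS' v(2) a1 g'(1) c1 by simp
    moreover have "verts (collar_end (subdiv A a S) ?g) \<subseteq> verts (collar_end S (p # g)) \<union> (if A \<subseteq> verts (collar_end S (p # g)) then {a} else - F)"
      using g'(2) c1 AV a1 unfolding e(2) by (auto split: if_splits)
    moreover have "starrable (K \<union> collar S (p # g)) (collar_end S (p # g)) \<longleftrightarrow> starrable (subdiv A a K \<union> collar (subdiv A a S) ?g) (collar_end (subdiv A a S) ?g)"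
      unfolding e using g'(3) Ue unfolding c1 c2 by (simp add: Un_assoc)
    ultimately show ?thesis by blast
  qed
qed

lemma collar_relabel:
  assumes "bij f"
  shows "relabel f (collar S g) = collar (relabel f S) (map (map_prod f f) g)"
proof (induction g arbitrary: S)
  case Nil
  show ?case by (simp add: relabel_def)
next
  case (Cons p g)
  then show ?case by (cases p) (simp add: relabel_Un relabel_prism[OF assms] relabel_subdiv[OF assms])
qed

lemma collar_end_relabel: "bij f \<Longrightarrow> relabel f (collar_end S g) = collar_end (relabel f S) (map (map_prod f f) g)"
proof (induction g arbitrary: S)
  case (Cons p g)
  then show ?case by (cases p) (simp add: relabel_subdiv)
qed simp

lemma valid_relabel: "bij f \<Longrightarrow> valid F S g \<Longrightarrow> valid (f ` F) (relabel f S) (map (map_prod f f) g)"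
proof (induction g arbitrary: S F)
  case (Cons p g)
  obtain x x' where p: "p = (x, x')" by (cases p)
  have "valid (insert x' F) (subdiv {x} x' S) g" "{x} \<in> S" "x' \<notin> F" using Cons.prems p by auto
  then show ?case using Cons.IH[of "insert x' F" "subdiv {x} x' S"] Cons.prems(1) p
    by (simp add: relabel_subdiv inj_image_mem_iff bij_is_inj) (simp add: relabel_def vimage_singleton)
qed simp

lemma collar_starrable_relabel:
  assumes f: "bij f" and collar_starrable: "collar_starrable K S"
  shows "collar_starrable (relabel f K) (relabel f S)"
proof -
  obtain g where g: "valid (verts K) S g" "verts (collar_end S g) \<inter> verts S = {}" "starrable (K \<union> collar S g) (collar_end S g)"
    using collar_starrable unfolding collar_starrable_def by blast
  let ?g = "map (map_prod f f) g"
  have "valid (verts (relabel f K)) (relabel f S) ?g" using valid_relabel[OF f g(1)] by (simp add: verts_relabel[OF f])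
  moreover have "verts (collar_end (relabel f S) ?g) \<inter> verts (relabel f S) = {}"
    unfolding collar_end_relabel[OF f, symmetric] verts_relabel[OF f] using g(2) f
    by (simp add: image_Int[OF bij_is_inj, symmetric])
  moreover have "starrable (relabel f K \<union> collar (relabel f S) ?g) (collar_end (relabel f S) ?g)"
    using starrable_relabel[OF f g(3)] by (simp add: relabel_Un collar_relabel[OF f] collar_end_relabel[OF f])
  ultimately show ?thesis unfolding collar_starrable_def by blast
qed

lemma collar_starrable_boundary_subdiv:
  fixes K :: "'a::infinite set set"
  assumes K: "cpx K" "cpx S" "S \<subseteq> K" and A: "A \<in> S" "A \<noteq> {}" and a: "a \<notin> verts K"
  shows "collar_starrable (subdiv A a K) (subdiv A a S) \<longleftrightarrow> collar_starrable K S"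
proof (cases "\<exists>x. A = {x}")
  case True
  then obtain x where x: "A = {x}" by blast
  have b: "bij (transpose x a)" by simp
  have aS: "a \<notin> verts S" using a verts_mono[OF K(3)] by blast
  have e: "subdiv A a K = relabel (transpose x a) K" "subdiv A a S = relabel (transpose x a) S"
    using subdiv_singleton_relabel[OF a, of x] subdiv_singleton_relabel[OF aS, of x] x by auto
  show ?thesis
    using collar_starrable_relabel[OF b, of K S] collar_starrable_relabel[OF b, of "relabel (transpose x a) K" "relabel (transpose x a) S"]
    unfolding e relabel_transpose_twice by blast
next
  case False
  then have big: "\<not> A \<subseteq> {x}" for x using A(2) by blast
  have SK: "verts S \<subseteq> verts K" by (rule verts_mono[OF K(3)])
  \<comment> \<open>The name \<open>a\<close> is reserved in advance, so that the collar of
    \<open>K\<close> does not use it.\<close>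
  let ?F = "insert a (verts K)"
  have fin: "finite ?F" using finite_verts[OF K(1)] by simp
  obtain g where g: "valid ?F S g" "verts (collar_end S g) \<inter> verts S = {}"
    by (rule ex_full_collar[OF K(2) _ fin finite.emptyI]) (use SK in auto)
  have vK: "verts K \<subseteq> ?F" "verts (subdiv A a K) \<subseteq> ?F" using verts_subdiv_subset[of A a K] by auto
  obtain g' where g': "valid ?F (subdiv A a S) g'"
     "verts (collar_end (subdiv A a S) g') \<subseteq> verts (collar_end S g) \<union> (if A \<subseteq> verts (collar_end S g) then {a} else - ?F)"
     "starrable (K \<union> collar S g) (collar_end S g) \<longleftrightarrow> starrable (subdiv A a K \<union> collar (subdiv A a S) g') (collar_end (subdiv A a S) g')"
    using starrable_collar_subdiv[OF K vK(1) fin g(1) A(1) big _ a collar_tame_good[OF K vK(1) g]] by blast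
  have d: "verts (collar_end S g) \<inter> ?F = {}" by (rule full_disjoint[OF _ g]) (use SK in auto)
  have "\<not> A \<subseteq> verts (collar_end S g)" using g(2) A face_verts[OF A(1)] by blast
  then have "verts (collar_end (subdiv A a S) g') \<inter> ?F = {}" using g'(2) d by auto
  moreover have "verts (subdiv A a S) \<subseteq> ?F" using verts_subdiv_subset[of A a S] SK by blast
  ultimately have full: "verts (collar_end (subdiv A a S) g') \<inter> verts (subdiv A a S) = {}" by blast
  have c: "cpx (subdiv A a K)" "cpx (subdiv A a S)" "subdiv A a S \<subseteq> subdiv A a K"
    using cpx_subdiv[OF K(1) A(2)] cpx_subdiv[OF K(2) A(2)] subdiv_mono[OF K(3)] by auto
  show ?thesis
  proof
    assume "collar_starrable (subdiv A a K) (subdiv A a S)"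
    from collar_starrable_all[OF c this g'(1) vK(2) full] show "collar_starrable K S" using collar_starrable_I[OF g(1) vK(1) g(2)] g'(3) by simp
  next
    assume "collar_starrable K S"
    from collar_starrable_all[OF K this g(1) vK(1) g(2)] show "collar_starrable (subdiv A a K) (subdiv A a S)"
      using collar_starrable_I[OF g'(1) vK(2) full] g'(3) by simp
  qed
qed

section \<open>Links and the boundary of a ball\<close>

text \<open>
  The parity of the number of faces, including the empty one, is invariant under stellar moves. It
  is even for balls and odd for spheres.
\<close>

definition bd :: "'a set set \<Rightarrow> 'a set set" where
  "bd K = {A \<in> K. even (card (lk A K))}"

text \<open>There are 2^|\<kappa>| - 1 proper subsets of \<kappa>, an odd number, and each is
  combined with each face of \<open>L\<close>.\<close>

lemma even_card_join_bd:
  assumes L: "cpx L" and \<kappa>: "finite \<kappa>" "\<kappa> \<noteq> {}" "verts L \<inter> \<kappa> = {}"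
  shows "even (card (join_bd \<kappa> L)) \<longleftrightarrow> even (card L)"
proof -
  let ?f = "\<lambda>(\<rho>, \<pi>). \<rho> \<union> \<pi>" let ?P = "(Pow \<kappa> - {\<kappa>}) \<times> L"
  have d: "\<pi> \<inter> \<kappa> = {}" if "\<pi> \<in> L" for \<pi> using \<kappa>(3) face_verts[OF that] by blast
  have "inj_on ?f ?P"
  proof (rule inj_onI)
    fix p q assume pq: "p \<in> ?P" "q \<in> ?P" "?f p = ?f q"
    obtain a b a' b' where s: "p = (a, b)" "q = (a', b')" by (cases p, cases q)
    have "a = (a \<union> b) \<inter> \<kappa>" "b = (a \<union> b) - \<kappa>" "a' = (a' \<union> b') \<inter> \<kappa>" "b' = (a' \<union> b') - \<kappa>"
      using pq s d[of b] d[of b'] by auto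
    then show "p = q" using pq(3) s by auto
  qed
  moreover have "?f ` ?P = join_bd \<kappa> L"
  proof
    show "?f ` ?P \<subseteq> join_bd \<kappa> L"
    proof
      fix \<tau> assume "\<tau> \<in> ?f ` ?P"
      then obtain \<rho> \<pi> where h: "\<rho> \<subseteq> \<kappa>" "\<rho> \<noteq> \<kappa>" "\<pi> \<in> L" "\<tau> = \<rho> \<union> \<pi>" by auto
      have "\<rho> \<union> \<pi> - \<kappa> = \<pi>" "\<not> \<kappa> \<subseteq> \<rho> \<union> \<pi>" using h d[OF h(3)] by blast+
      then show "\<tau> \<in> join_bd \<kappa> L" using h unfolding join_bd_def by simp
    qed
    show "join_bd \<kappa> L \<subseteq> ?f ` ?P"
    proof
      fix \<tau> assume t: "\<tau> \<in> join_bd \<kappa> L"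
      have "\<tau> = ?f (\<tau> \<inter> \<kappa>, \<tau> - \<kappa>)" by auto
      moreover have "(\<tau> \<inter> \<kappa>, \<tau> - \<kappa>) \<in> ?P" using t unfolding join_bd_def by auto
      ultimately show "\<tau> \<in> ?f ` ?P" by blast
    qed
  qed
  ultimately have "card (join_bd \<kappa> L) = card ?P" by (metis card_image)
  also have "\<dots> = (2 ^ card \<kappa> - 1) * card L"
    using \<kappa> by (simp add: card_cartesian_product card_Pow card_Diff_singleton)
  finally show ?thesis using \<kappa> by (simp add: card_gt_0_iff)
qed

text \<open>The faces not containing \<sigma> remain. Those containing \<sigma> are counted by the
  link of \<sigma>, the new ones by its join with \<partial>\<sigma>, and these numbers have the
  same parity.\<close>

lemma even_card_subdiv:
  assumes K: "cpx K" and \<sigma>: "\<sigma> \<in> K" "\<sigma> \<noteq> {}" "s \<notin> verts K"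
  shows "even (card (subdiv \<sigma> s K)) \<longleftrightarrow> even (card K)"
proof -
  let ?C = "{\<tau> \<in> K. \<not> \<sigma> \<subseteq> \<tau>}" let ?L = "lk \<sigma> K" let ?J = "join_bd \<sigma> ?L"
  have s: "s \<notin> \<tau>" if "\<tau> \<in> K" for \<tau> using that \<sigma>(3) face_verts by blast
  have fK: "finite K" using K unfolding cpx_def by blast
  have cL: "cpx ?L" by (rule cpx_lk[OF K \<sigma>(1)])
  have f\<sigma>: "finite \<sigma>" by (rule cpx_finite_face[OF K \<sigma>(1)])
  have cJ: "cpx ?J" by (rule cpx_join_bd[OF cL f\<sigma> \<sigma>(2)])
  have vJ: "s \<notin> \<tau>" if "\<tau> \<in> ?J" for \<tau>
    using face_verts[OF that] verts_join_bd_subset[of \<sigma> ?L] verts_lk_subset[of \<sigma> K] \<sigma> face_verts[OF \<sigma>(1)] by blast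
  have "K = ?C \<union> (\<lambda>\<pi>. \<pi> \<union> \<sigma>) ` ?L"
  proof
    show "K \<subseteq> ?C \<union> (\<lambda>\<pi>. \<pi> \<union> \<sigma>) ` ?L"
    proof
      fix \<tau> assume t: "\<tau> \<in> K"
      show "\<tau> \<in> ?C \<union> (\<lambda>\<pi>. \<pi> \<union> \<sigma>) ` ?L"
      proof (cases "\<sigma> \<subseteq> \<tau>")
        case True
        then have e: "\<tau> - \<sigma> \<union> \<sigma> = \<tau>" by blast
        then have "\<tau> - \<sigma> \<in> ?L" using t unfolding lk_def by auto
        then have "\<tau> \<in> (\<lambda>\<pi>. \<pi> \<union> \<sigma>) ` ?L" using e by (intro image_eqI[of _ _ "\<tau> - \<sigma>"]) auto
        then show ?thesis by blast
      qed (use t in blast)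
    qed
  qed (auto simp: lk_def)
  moreover have "card ((\<lambda>\<pi>. \<pi> \<union> \<sigma>) ` ?L) = card ?L"
  proof (rule card_image, rule inj_onI)
    fix p q assume "p \<in> ?L" "q \<in> ?L" "p \<union> \<sigma> = q \<union> \<sigma>"
    then show "p = q" unfolding lk_def by blast
  qed
  moreover have "?C \<inter> (\<lambda>\<pi>. \<pi> \<union> \<sigma>) ` ?L = {}" by blast
  ultimately have 1: "card K = card ?C + card ?L"
    using fK cL by (metis (no_types, lifting) card_Un_disjoint finite_Un)
  have "subdiv \<sigma> s K = ?C \<union> insert s ` ?J"
  proof (rule set_eqI)
    fix \<tau>
    show "\<tau> \<in> subdiv \<sigma> s K \<longleftrightarrow> \<tau> \<in> ?C \<union> insert s ` ?J"
    proof (cases "s \<in> \<tau>")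
      case True
      have e: "\<tau> - {s} - \<sigma> \<union> \<sigma> = \<tau> - {s} \<union> \<sigma>" "\<sigma> \<subseteq> \<tau> - {s} \<longleftrightarrow> \<sigma> \<subseteq> \<tau>" "(\<tau> - {s} - \<sigma>) \<inter> \<sigma> = {}"
        using s[OF \<sigma>(1)] by blast+
      have "\<tau> \<in> insert s ` ?J \<longleftrightarrow> \<tau> - {s} \<in> ?J"
      proof
        assume "\<tau> \<in> insert s ` ?J"
        then obtain \<rho> where "\<rho> \<in> ?J" "\<tau> = insert s \<rho>" by blast
        then show "\<tau> - {s} \<in> ?J" using vJ[of \<rho>] by simp
      next
        assume "\<tau> - {s} \<in> ?J"
        then show "\<tau> \<in> insert s ` ?J" using True by (metis image_eqI insert_Diff)
      qed
      moreover have "\<tau> \<notin> ?C" using True s by blast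
      moreover have "\<tau> \<in> subdiv \<sigma> s K \<longleftrightarrow> \<tau> - {s} \<in> ?J"
        unfolding mem_subdiv join_bd_def lk_def mem_Collect_eq e using True by auto
      ultimately show ?thesis by blast
    next
      case False
      then show ?thesis unfolding mem_subdiv by auto
    qed
  qed
  moreover have "card (insert s ` ?J) = card ?J"
  proof (rule card_image, rule inj_onI)
    fix p q assume "p \<in> ?J" "q \<in> ?J" "insert s p = insert s q"
    then show "p = q" using vJ by (metis insert_ident)
  qed
  moreover have "?C \<inter> insert s ` ?J = {}" using s by blast
  moreover have "finite (insert s ` ?J)" using cJ unfolding cpx_def by blast
  ultimately have 2: "card (subdiv \<sigma> s K) = card ?C + card ?J"
    using fK by (simp add: card_Un_disjoint)
  have "even (card ?J) \<longleftrightarrow> even (card ?L)"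
    by (rule even_card_join_bd[OF cL f\<sigma> \<sigma>(2)]) (use verts_lk_subset[of \<sigma> K] in blast)
  then show ?thesis using 1 2 by simp
qed

section \<open>Links in a subdivision and the parity boundary\<close>

lemma lk_subdiv_cases:
  assumes K: "cpx K" and \<sigma>: "\<sigma> \<in> K" "s \<notin> verts K" and A: "A \<in> K" "\<not> \<sigma> \<subseteq> A"
  shows "\<sigma> - A \<in> lk A K \<and> lk A (subdiv \<sigma> s K) = subdiv (\<sigma> - A) s (lk A K) \<or> lk A (subdiv \<sigma> s K) = lk A K"
proof -
  have sA: "s \<notin> A" using A \<sigma> face_verts by blast
  have e: "lk A (subdiv \<sigma> s K) = subdiv (\<sigma> - A) s (lk A K)" by (rule lk_subdiv[OF A(2) sA])
  show ?thesis
  proof (cases "\<sigma> - A \<in> lk A K")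
    case False
    have "\<not> \<sigma> - A \<subseteq> \<rho>" if "\<rho> \<in> lk A K" for \<rho>
      using cpx_down[OF cpx_lk[OF K A(1)] that, of "\<sigma> - A"] False by blast
    moreover have "s \<notin> verts (lk A K)" using \<sigma> verts_lk_subset[of A K] by blast
    ultimately have "subdiv (\<sigma> - A) s (lk A K) = lk A K" by (rule subdiv_id)
    then show ?thesis using e by simp
  qed (use e in simp)
qed

text \<open>A face through \<open>s\<close> stands for the face
  \<open>A - {s} \<union> \<sigma>\<close> of \<open>K\<close>; the vertices of \<sigma> missing
  from \<open>A\<close> contribute the boundary of a simplex.\<close>

lemma lk_subdiv_new:
  assumes \<sigma>: "\<sigma> \<in> K" "s \<notin> verts K" and A: "s \<in> A"
  shows "lk A (subdiv \<sigma> s K) = join_bd (\<sigma> - A) (lk (A - {s} \<union> \<sigma>) K)"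
proof (rule set_eqI)
  fix \<tau>
  have s\<sigma>: "s \<notin> \<sigma>" using \<sigma> face_verts by blast
  show "\<tau> \<in> lk A (subdiv \<sigma> s K) \<longleftrightarrow> \<tau> \<in> join_bd (\<sigma> - A) (lk (A - {s} \<union> \<sigma>) K)"
  proof (cases "s \<in> \<tau>")
    case True
    then have "s \<in> \<tau> - (\<sigma> - A) \<union> (A - {s} \<union> \<sigma>)" using s\<sigma> by blast
    then have "\<tau> - (\<sigma> - A) \<union> (A - {s} \<union> \<sigma>) \<notin> K" using \<sigma> face_verts by blast
    then show ?thesis using True A unfolding lk_def join_bd_def by blast
  next
    case False
    have e: "s \<in> \<tau> \<union> A \<longleftrightarrow> True" "\<tau> \<union> A - {s} \<union> \<sigma> = \<tau> - (\<sigma> - A) \<union> (A - {s} \<union> \<sigma>)"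
      "(\<tau> - (\<sigma> - A)) \<inter> (A - {s} \<union> \<sigma>) = {} \<longleftrightarrow> \<tau> \<inter> A = {}" "\<sigma> - A \<subseteq> \<tau> \<longleftrightarrow> \<sigma> \<subseteq> \<tau> \<union> A"
      using A s\<sigma> False by blast+
    show ?thesis unfolding lk_def join_bd_def mem_subdiv mem_Collect_eq e by auto
  qed
qed

lemma bd_subset: "bd K \<subseteq> K"
  unfolding bd_def by blast

text \<open>A subdivision alters links only by subdividing them or by joining them with the boundary
  of a simplex, and both keep the parity. Nothing about the shape of the links enters.\<close>

lemma bd_subdiv:
  assumes K: "cpx K" and \<sigma>: "\<sigma> \<in> K" "\<sigma> \<noteq> {}" "s \<notin> verts K"
  shows "bd (subdiv \<sigma> s K) = subdiv \<sigma> s (bd K)"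
proof (rule set_eqI)
  fix A
  show "A \<in> bd (subdiv \<sigma> s K) \<longleftrightarrow> A \<in> subdiv \<sigma> s (bd K)"
  proof (cases "A \<in> subdiv \<sigma> s K")
    case False
    then have "A \<notin> subdiv \<sigma> s (bd K)" using subdiv_mono[OF bd_subset, of \<sigma> s K] by blast
    then show ?thesis using False bd_subset by blast
  next
    case T: True
    then have nA: "\<not> \<sigma> \<subseteq> A" unfolding mem_subdiv by simp
    have "even (card (lk A (subdiv \<sigma> s K))) \<longleftrightarrow> even (card (lk (if s \<in> A then A - {s} \<union> \<sigma> else A) K))"
    proof (cases "s \<in> A")
      case True
      have AK: "A - {s} \<union> \<sigma> \<in> K" using T True unfolding mem_subdiv by simp
      have "even (card (join_bd (\<sigma> - A) (lk (A - {s} \<union> \<sigma>) K))) \<longleftrightarrow> even (card (lk (A - {s} \<union> \<sigma>) K))"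
        by (rule even_card_join_bd[OF cpx_lk[OF K AK]])
          (use cpx_finite_face[OF K \<sigma>(1)] nA verts_lk_subset[of "A - {s} \<union> \<sigma>" K] in auto)
      then show ?thesis using lk_subdiv_new[OF \<sigma>(1,3) True] True by simp
    next
      case False
      then have AK: "A \<in> K" using T unfolding mem_subdiv by simp
      have "even (card (subdiv (\<sigma> - A) s (lk A K))) \<longleftrightarrow> even (card (lk A K))" if "\<sigma> - A \<in> lk A K"
        by (rule even_card_subdiv[OF cpx_lk[OF K AK] that]) (use nA \<sigma> verts_lk_subset[of A K] in auto)
      then have "even (card (lk A (subdiv \<sigma> s K))) \<longleftrightarrow> even (card (lk A K))"
        using lk_subdiv_cases[OF K \<sigma>(1,3) AK nA] by metis
      then show ?thesis using False by simp
    qed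
    then have c1: "A \<in> bd (subdiv \<sigma> s K) \<longleftrightarrow> even (card (lk (if s \<in> A then A - {s} \<union> \<sigma> else A) K))"
      using T unfolding bd_def by blast
    have c2: "(if s \<in> A then A - {s} \<union> \<sigma> else A) \<in> K" using T unfolding mem_subdiv by simp
    show ?thesis unfolding c1 mem_subdiv using c2 nA by (cases "s \<in> A") (simp_all add: bd_def)
  qed
qed

lemma lk_bd: "lk A (bd K) = bd (lk A K)"
proof (rule set_eqI)
  fix \<tau>
  have "lk \<tau> (lk A K) = lk (\<tau> \<union> A) K" if "\<tau> \<inter> A = {}" using lk_lk[OF that, of K] by (simp add: Un_commute)
  then show "\<tau> \<in> lk A (bd K) \<longleftrightarrow> \<tau> \<in> bd (lk A K)" unfolding bd_def lk_def[of A] by auto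
qed

text \<open>For the weld direction, where only the subdivided boundary is known to be a complex. A
  face \<tau> containing \<sigma> is visible there through the faces
  \<open>insert s (\<tau> - {y})\<close> with \<open>y \<in> \<sigma>\<close>, and every subset of
  \<tau> is recovered from one of them.\<close>

lemma cpx_unsub:
  assumes K: "cpx K" "D \<subseteq> K" and \<sigma>: "\<sigma> \<noteq> {}" "s \<notin> verts K" "s \<notin> \<sigma>" and c: "cpx (subdiv \<sigma> s D)"
  shows "cpx D"
proof (rule cpxI)
  have sD: "s \<notin> \<tau>" if "\<tau> \<in> D" for \<tau> using that K \<sigma> face_verts by blast
  show "finite (verts K)" by (rule finite_verts[OF K(1)])
  show "\<tau> \<subseteq> verts K" if "\<tau> \<in> D" for \<tau> using that K face_verts by blast
  show "{} \<in> D" using cpx_empty[OF c] unfolding mem_subdiv by simp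
  show "\<rho> \<in> D" if t: "\<tau> \<in> D" and r: "\<rho> \<subseteq> \<tau>" for \<tau> \<rho>
  proof (cases "\<sigma> \<subseteq> \<tau>")
    case False
    then have "\<tau> \<in> subdiv \<sigma> s D" using t sD unfolding mem_subdiv by simp
    then have "\<rho> \<in> subdiv \<sigma> s D" using cpx_down[OF c _ r] by blast
    moreover have "s \<notin> \<rho>" using r sD[OF t] by blast
    ultimately show ?thesis unfolding mem_subdiv by simp
  next
    case True
    have in1: "insert s (\<tau> - {y}) \<in> subdiv \<sigma> s D" if "y \<in> \<sigma>" for y
    proof -
      have "insert s (\<tau> - {y}) - {s} \<union> \<sigma> = \<tau>" "\<not> \<sigma> \<subseteq> insert s (\<tau> - {y})" using True that \<sigma> sD[OF t] by blast+
      then show ?thesis using t unfolding mem_subdiv by simp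
    qed
    show ?thesis
    proof (cases "\<sigma> \<subseteq> \<rho>")
      case s: True
      obtain y where y: "y \<in> \<sigma>" using \<sigma> by blast
      have "insert s (\<rho> - {y}) \<in> subdiv \<sigma> s D" by (rule cpx_down[OF c in1[OF y]]) (use r in blast)
      moreover have "insert s (\<rho> - {y}) - {s} \<union> \<sigma> = \<rho>" using s y \<sigma> sD[OF t] r by blast
      ultimately show ?thesis unfolding mem_subdiv by simp
    next
      case False
      then obtain y where y: "y \<in> \<sigma>" "y \<notin> \<rho>" by blast
      have "\<rho> \<in> subdiv \<sigma> s D" by (rule cpx_down[OF c in1[OF y(1)]]) (use r y in blast)
      moreover have "s \<notin> \<rho>" using r sD[OF t] by blast
      ultimately show ?thesis unfolding mem_subdiv by simp
    qed
  qed
qed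

text \<open>The flag distinguishes spheres (\<open>True\<close>) from balls (\<open>False\<close>).\<close>

definition std :: "bool \<Rightarrow> 'a set \<Rightarrow> 'a set set" where
  "std b \<omega> = {\<tau>. \<tau> \<subseteq> \<omega> \<and> (b \<longrightarrow> \<tau> \<noteq> \<omega>)}"

text \<open>The number \<open>n\<close> counts the vertices of the model simplex, so balls have
  dimension \<open>n - 1\<close> and spheres dimension \<open>n - 2\<close>. The sphere with
  \<open>n = 1\<close> consists of the empty face alone.\<close>

definition stellar_class :: "bool \<Rightarrow> nat \<Rightarrow> 'a set set \<Rightarrow> bool" where
  "stellar_class b n K \<longleftrightarrow> 0 < n \<and> (\<exists>\<omega>. finite \<omega> \<and> card \<omega> = n \<and> eqv {} (std b \<omega>) K)"

lemma cpx_std: "finite \<omega> \<Longrightarrow> \<omega> \<noteq> {} \<Longrightarrow> cpx (std b \<omega>)"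
  by (rule cpxI[of \<omega>]) (auto simp: std_def)

lemma stellar_class_cpx: "stellar_class b n K \<Longrightarrow> cpx K"
  unfolding stellar_class_def using cpx_std eqv_cpx by (metis card.empty less_numeral_extra(3))

lemma stellar_class_eqv: "eqv {} K K' \<Longrightarrow> stellar_class b n K' \<longleftrightarrow> stellar_class b n K"
  unfolding stellar_class_def by (metis equivclp_sym equivclp_trans)

lemma relabel_std: "bij f \<Longrightarrow> relabel f (std b \<omega>) = std b (f ` \<omega>)"
proof -
  assume f: "bij f"
  have i: "f ` (f -` \<tau>) = \<tau>" for \<tau> using f by (simp add: bij_is_surj)
  have "f -` \<tau> \<subseteq> \<omega> \<longleftrightarrow> \<tau> \<subseteq> f ` \<omega>" for \<tau>
    using i[of \<tau>] inj_image_subset_iff[OF bij_is_inj[OF f], of "f -` \<tau>" \<omega>] by simp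
  moreover have "f -` \<tau> = \<omega> \<longleftrightarrow> \<tau> = f ` \<omega>" for \<tau>
    using i[of \<tau>] inj_image_eq_iff[OF bij_is_inj[OF f], of "f -` \<tau>" \<omega>] by simp
  ultimately show ?thesis unfolding relabel_def std_def by simp
qed

lemma verts_std: "verts (std b \<omega>) \<subseteq> \<omega>"
  unfolding std_def verts_def by blast

text \<open>Swapping a vertex in \<open>Z\<close> with a fresh one moves the model simplex and fixes
  \<open>K\<close>. This makes room for a join with \<partial>\<kappa> along the whole
  chain.\<close>

lemma stellar_class_avoid:
  fixes K :: "'a::infinite set set"
  assumes stellar_class: "stellar_class b n K" and Z: "finite Z" "Z \<inter> verts K = {}"
  shows "\<exists>\<omega>. finite \<omega> \<and> card \<omega> = n \<and> \<omega> \<inter> Z = {} \<and> eqv {} (std b \<omega>) K"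
proof -
  have cK: "cpx K" by (rule stellar_class_cpx[OF stellar_class])
  have "\<exists>\<omega>. finite \<omega> \<and> card \<omega> = n \<and> \<omega> \<inter> Y = {} \<and> eqv {} (std b \<omega>) K" if "Y \<subseteq> Z" "finite Y" for Y
    using that(2,1)
  proof (induction Y rule: finite_induct)
    case empty
    then show ?case using stellar_class unfolding stellar_class_def by auto
  next
    case (insert z Y)
    then obtain \<omega> where w: "finite \<omega>" "card \<omega> = n" "\<omega> \<inter> Y = {}" "eqv {} (std b \<omega>) K" by auto
    have "finite (\<omega> \<union> Z \<union> verts K)" using w Z finite_verts[OF cK] by simp
    then obtain z1 where z1: "z1 \<notin> \<omega> \<union> Z \<union> verts K" by (rule ex_fresh)
    let ?f = "transpose z z1"
    have f: "bij ?f" by simp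
    have zK: "z \<notin> verts K" using insert Z by blast
    have "relabel ?f K = K"
      by (rule relabel_fix[OF f], rule transpose_apply_other) (use z1 zK in auto)
    then have "eqv {} (std b (?f ` \<omega>)) K" using eqv_relabel[OF f w(4)] by (simp add: relabel_std[OF f])
    moreover have "?f ` \<omega> \<inter> insert z Y = {}"
    proof -
      have zz: "z \<noteq> z1" using z1 insert by blast
      have "?f u \<notin> insert z Y" if "u \<in> \<omega>" for u
        using that z1 w(3) insert zz by (auto simp: transpose_def)
      then show ?thesis by blast
    qed
    moreover have "finite (?f ` \<omega>)" "card (?f ` \<omega>) = n" using w by (simp_all add: card_image)
    ultimately show ?case by blast
  qed
  then show ?thesis using Z by blast
qed

text \<open>The join of \<partial>\<kappa> with the model on \<omega> is the model on
  \<open>\<kappa> \<union> (\<omega> - {x})\<close> subdivided at \<kappa> with apex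
  \<open>x\<close>, where \<open>x \<in> \<omega>\<close>. The vertex given up for the apex accounts
  for the \<open>- 1\<close>.\<close>

lemma stellar_class_join_bd:
  fixes L :: "'a::infinite set set"
  assumes stellar_class: "stellar_class b n L" and \<kappa>: "finite \<kappa>" "\<kappa> \<noteq> {}" "verts L \<inter> \<kappa> = {}"
  shows "stellar_class b (n + card \<kappa> - 1) (join_bd \<kappa> L)"
proof -
  obtain \<omega> where w: "finite \<omega>" "card \<omega> = n" "\<omega> \<inter> \<kappa> = {}" "eqv {} (std b \<omega>) L"
    using stellar_class_avoid[OF stellar_class \<kappa>(1)] \<kappa>(3) by blast
  have n: "0 < n" using stellar_class unfolding stellar_class_def by blast
  then have w0: "\<omega> \<noteq> {}" using w by auto
  have cw: "cpx (std b \<omega>)" by (rule cpx_std[OF w(1) w0])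
  have "eqv \<kappa> (std b \<omega>) L"
    by (rule eqv_freshen[OF w(4) cw \<kappa>(1)]) (use w(3) \<kappa> verts_std[of b \<omega>] in auto)
  then have "eqv \<kappa> (join_bd \<kappa> (std b \<omega>)) (join_bd \<kappa> L)"
    by (rule eqv_join_bd[OF _ cw \<kappa>(1,2)]) (use w(3) verts_std[of b \<omega>] in auto)
  then have 1: "eqv {} (join_bd \<kappa> (std b \<omega>)) (join_bd \<kappa> L)" by (rule eqv_mono) simp
  have "0 < card \<kappa>" using \<kappa> by (simp add: card_gt_0_iff)
  then have pos: "0 < n + card \<kappa> - 1" using n by linarith
  have "stellar_class b (n + card \<kappa> - 1) (join_bd \<kappa> (std b \<omega>))"
  proof (cases "b \<and> (\<exists>x. \<omega> = {x})")
    \<comment> \<open>Here \<partial>\<omega> is just the empty face and \<kappa> would be the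
      excluded top face, but the join is already \<partial>\<kappa>.\<close>
    case True
    then obtain x where x: "\<omega> = {x}" "b" by blast
    have "join_bd \<kappa> (std b \<omega>) = std b \<kappa>" using x w(3) unfolding join_bd_def std_def by auto
    moreover have "n + card \<kappa> - 1 = card \<kappa>" using x w(2) by simp
    ultimately show ?thesis using pos \<kappa>(1) unfolding stellar_class_def by auto
  next
    case False
    obtain x where x: "x \<in> \<omega>" using w0 by blast
    let ?o = "\<kappa> \<union> (\<omega> - {x})"
    have x\<kappa>: "x \<notin> ?o" using x w(3) by blast
    have eq: "join_bd \<kappa> (std b \<omega>) = subdiv \<kappa> x (std b ?o)"
    proof (rule set_eqI)
      fix \<tau>
      show "\<tau> \<in> join_bd \<kappa> (std b \<omega>) \<longleftrightarrow> \<tau> \<in> subdiv \<kappa> x (std b ?o)"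
      proof (cases "x \<in> \<tau>")
        case True
        have "\<tau> - {x} \<union> \<kappa> \<subseteq> ?o \<longleftrightarrow> \<tau> - \<kappa> \<subseteq> \<omega>" using x x\<kappa> by blast
        moreover have "\<tau> - {x} \<union> \<kappa> = ?o \<longleftrightarrow> \<tau> - \<kappa> = \<omega>" using x x\<kappa> w(3) True by blast
        ultimately show ?thesis using True unfolding join_bd_def mem_subdiv std_def by auto
      next
        case False
        have "\<tau> \<subseteq> ?o \<longleftrightarrow> \<tau> - \<kappa> \<subseteq> \<omega>" "\<tau> - \<kappa> \<noteq> \<omega>" "\<not> \<kappa> \<subseteq> \<tau> \<Longrightarrow> \<tau> \<noteq> ?o" using x False by blast+
        then show ?thesis using False unfolding join_bd_def mem_subdiv std_def by auto
      qed
    qed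
    have fo: "finite ?o" "?o \<noteq> {}" using w \<kappa> by auto
    have "b \<Longrightarrow> \<kappa> \<noteq> ?o"
    proof
      assume "b" "\<kappa> = ?o"
      then have "\<omega> - {x} = {}" using w(3) by blast
      then have "\<omega> = {x}" using x by blast
      then show False using False \<open>b\<close> by blast
    qed
    then have "\<kappa> \<in> std b ?o" unfolding std_def by auto
    then have "eqv {} (std b ?o) (subdiv \<kappa> x (std b ?o))"
      using cpx_std[OF fo] \<kappa>(2) x\<kappa> verts_std[of b ?o] by (intro eqv_subdiv) auto
    moreover have "card ?o = n + card \<kappa> - 1"
    proof -
      have "card ?o = card \<kappa> + card (\<omega> - {x})" by (rule card_Un_disjoint) (use w \<kappa> in auto)
      then show ?thesis using x w n by (simp add: card_Diff_singleton)
    qed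
    ultimately show ?thesis using pos fo(1) eq unfolding stellar_class_def by metis
  qed
  then show ?thesis using stellar_class_eqv[OF 1] by blast
qed

lemma join_bd_singleton: "y \<notin> verts L \<Longrightarrow> join_bd {y} L = L"
proof -
  assume "y \<notin> verts L"
  then have "y \<notin> \<tau>" if "\<tau> \<in> L" for \<tau> using that face_verts by blast
  moreover have "y \<notin> \<tau> \<Longrightarrow> \<tau> - {y} = \<tau>" for \<tau> by blast
  ultimately show ?thesis unfolding join_bd_def by auto
qed

text \<open>Along the chain a link changes by at most one move or becomes a join with the boundary
  of a simplex, so its class is kept. Truncated subtraction is harmless, since
  \<open>stellar_class\<close> demands a positive size: the link of a facet can only count as a
  sphere.\<close>

lemma ball_links:
  fixes K :: "'a::infinite set set"
  assumes "stellar_class False n K" "A \<in> K" "A \<noteq> {}"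
  shows "stellar_class False (n - card A) (lk A K) \<or> (\<exists>m. stellar_class True m (lk A K))"
proof -
  obtain \<omega> where w: "finite \<omega>" "card \<omega> = n" "0 < n" "eqv {} (std False \<omega>) K"
    using assms(1) unfolding stellar_class_def by blast
  have w0: "\<omega> \<noteq> {}" using w by auto
  let ?P = "\<lambda>n L. stellar_class False n L \<or> (\<exists>m. stellar_class True m L)"
  have P_eqv: "?P n L' \<longleftrightarrow> ?P n L" if "eqv {} L L'" for L L' :: "'a set set" and n
    using stellar_class_eqv[OF that] by blast
  have "\<forall>A\<in>K. A \<noteq> {} \<longrightarrow> ?P (n - card A) (lk A K)"
    using w(4) cpx_std[OF w(1) w0]
  proof (induction rule: eqv_induct)
    case base
    show ?case
    proof (intro ballI impI)
      fix A assume A: "A \<in> std False \<omega>" "A \<noteq> {}"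
      have As: "A \<subseteq> \<omega>" using A unfolding std_def by simp
      have l: "lk A (std False \<omega>) = std False (\<omega> - A)" using As unfolding lk_def std_def by auto
      have c: "card (\<omega> - A) = n - card A" using As w by (simp add: card_Diff_subset finite_subset)
      show "?P (n - card A) (lk A (std False \<omega>))"
      proof (cases "\<omega> - A = {}")
        case True
        obtain x where "x \<in> A" using A by blast
        have "lk A (std False \<omega>) = std True {x}" unfolding l True unfolding std_def by auto
        then have "stellar_class True 1 (lk A (std False \<omega>))" unfolding stellar_class_def by (auto intro!: exI[of _ "{x}"])
        then show ?thesis by blast
      next
        case False
        then have "0 < n - card A" using c w(1) by (metis card_gt_0_iff finite_Diff)
        then have "stellar_class False (n - card A) (lk A (std False \<omega>))"
          unfolding l stellar_class_def using c w(1) by (intro conjI exI[of _ "\<omega> - A"]) auto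
        then show ?thesis by blast
      qed
    qed
  next
    case (subdiv L \<sigma> s)
    have s0: "\<sigma> \<noteq> {}" using subdiv by blast
    show ?case
    proof (intro ballI impI)
      fix A assume A: "A \<in> subdiv \<sigma> s L" "A \<noteq> {}"
      have nA: "\<not> \<sigma> \<subseteq> A" using A(1) unfolding mem_subdiv by simp
      show "?P (n - card A) (lk A (subdiv \<sigma> s L))"
      proof (cases "s \<in> A")
        case False
        then have AL: "A \<in> L" using A(1) unfolding mem_subdiv by simp
        have cl: "cpx (lk A L)" by (rule cpx_lk[OF subdiv(2) AL])
        have "eqv {} (lk A L) (lk A (subdiv \<sigma> s L))"
          using lk_subdiv_cases[OF subdiv(2,3,6) AL nA]
        proof
          assume h: "\<sigma> - A \<in> lk A L \<and> lk A (subdiv \<sigma> s L) = subdiv (\<sigma> - A) s (lk A L)"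
          have "eqv {} (lk A L) (subdiv (\<sigma> - A) s (lk A L))"
            by (rule eqv_subdiv[OF cl]) (use h nA subdiv(6) verts_lk_subset[of A L] in auto)
          then show ?thesis using h by simp
        qed simp
        moreover have "?P (n - card A) (lk A L)" using subdiv(7) AL A(2) by simp
        ultimately show ?thesis using P_eqv[of "lk A L" "lk A (subdiv \<sigma> s L)" "n - card A"] by simp
      next
        case True
        let ?B = "A - {s} \<union> \<sigma>"
        have B: "?B \<in> L" "?B \<noteq> {}" using A(1) True s0 unfolding mem_subdiv by auto
        have fB: "finite ?B" by (rule cpx_finite_face[OF subdiv(2) B(1)])
        have k: "finite (\<sigma> - A)" "\<sigma> - A \<noteq> {}" "verts (lk ?B L) \<inter> (\<sigma> - A) = {}"
          using fB nA verts_lk_subset[of ?B L] by auto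
        have s\<sigma>: "s \<notin> \<sigma>" using face_not_fresh[OF subdiv(3,6)] .
        have "?B = (A - {s}) \<union> (\<sigma> - A)" using s\<sigma> by blast
        then have "card ?B = card (A - {s}) + card (\<sigma> - A)"
          using fB by (metis (no_types, lifting) Diff_disjoint Diff_subset card_Un_disjoint disjoint_iff finite_Un subsetD)
        moreover have "finite A" using fB by simp
        then have "card A = Suc (card (A - {s}))" using card_Suc_Diff1[OF _ True] by simp
        moreover have "0 < card (\<sigma> - A)" using k by (simp add: card_gt_0_iff)
        ultimately have cc: "0 < n - card ?B \<Longrightarrow> n - card ?B + card (\<sigma> - A) - 1 = n - card A" by linarith
        have "?P (n - card ?B) (lk ?B L)" using subdiv(7) B by simp
        then have "?P (n - card A) (join_bd (\<sigma> - A) (lk ?B L))"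
        proof
          assume h: "stellar_class False (n - card ?B) (lk ?B L)"
          then have "0 < n - card ?B" unfolding stellar_class_def by blast
          then show ?thesis using stellar_class_join_bd[OF h k] cc by simp
        next
          assume "\<exists>m. stellar_class True m (lk ?B L)"
          then show ?thesis using stellar_class_join_bd[OF _ k] by blast
        qed
        then show ?thesis using lk_subdiv_new[OF subdiv(3,6) True] by simp
      qed
    qed
  next
    case (weld L \<sigma> s)
    show ?case
    proof (intro ballI impI)
      fix A assume A: "A \<in> L" "A \<noteq> {}"
      have sA: "s \<notin> A" using face_not_fresh[OF A(1) weld(6)] .
      show "?P (n - card A) (lk A L)"
      proof (cases "\<sigma> \<subseteq> A")
        case nA: False
        have AL: "A \<in> subdiv \<sigma> s L" using A nA sA unfolding mem_subdiv by simp
        have cl: "cpx (lk A L)" by (rule cpx_lk[OF weld(2) A(1)])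
        have "eqv {} (lk A L) (lk A (subdiv \<sigma> s L))"
          using lk_subdiv_cases[OF weld(2,3,6) A(1) nA]
        proof
          assume h: "\<sigma> - A \<in> lk A L \<and> lk A (subdiv \<sigma> s L) = subdiv (\<sigma> - A) s (lk A L)"
          have "eqv {} (lk A L) (subdiv (\<sigma> - A) s (lk A L))"
            by (rule eqv_subdiv[OF cl]) (use h nA weld(6) verts_lk_subset[of A L] in auto)
          then show ?thesis using h by simp
        qed simp
        moreover have "?P (n - card A) (lk A (subdiv \<sigma> s L))" using weld(7) AL A(2) by simp
        ultimately show ?thesis using P_eqv[of "lk A L" "lk A (subdiv \<sigma> s L)" "n - card A"] by simp
      next
        case True
        obtain y where y: "y \<in> \<sigma>" using weld(4) by blast
        \<comment> \<open>The face \<open>A\<close> disappears in the subdivision, but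
          \<open>?B\<close> is a face there with the same number of vertices and the same
          link.\<close>
        let ?B = "insert s (A - {y})"
        have ys: "y \<noteq> s" using y True sA by blast
        have e: "?B - {s} \<union> \<sigma> = A" "\<not> \<sigma> \<subseteq> ?B" "\<sigma> - ?B = {y}" using True y sA ys by blast+
        have B: "?B \<in> subdiv \<sigma> s L" using A e unfolding mem_subdiv by simp
        have "finite A" by (rule cpx_finite_face[OF weld(2) A(1)])
        then have cB: "card ?B = card A" using sA y True by (metis Diff_iff card.remove card_insert_disjoint finite_Diff subsetD)
        have "lk ?B (subdiv \<sigma> s L) = join_bd {y} (lk A L)" using lk_subdiv_new[OF weld(3,6), of ?B] e by simp
        also have "\<dots> = lk A L" by (rule join_bd_singleton) (use verts_lk_subset[of A L] y True in auto)
        finally show ?thesis using weld(7)[rule_format, OF B] cB by simp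
      qed
    qed
  qed
  then show ?thesis using assms(2,3) by simp
qed

lemma even_card_eqv:
  assumes "eqv {} K K'" "cpx K"
  shows "even (card K') \<longleftrightarrow> even (card K)"
  using assms
proof (induction rule: eqv_induct)
  case (subdiv L \<sigma> s)
  then show ?case using even_card_subdiv[of L \<sigma> s] by blast
next
  case (weld L \<sigma> s)
  then show ?case using even_card_subdiv[of L \<sigma> s] by blast
qed simp

text \<open>The models have 2^n or 2^n - 1 faces with \<open>n > 0\<close>. In particular no complex
  is both a ball and a sphere.\<close>

lemma stellar_class_parity:
  assumes "stellar_class b n K"
  shows "even (card K) \<longleftrightarrow> \<not> b"
proof -
  obtain \<omega> where w: "finite \<omega>" "card \<omega> = n" "0 < n" "eqv {} (std b \<omega>) K"
    using assms unfolding stellar_class_def by blast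
  have w0: "\<omega> \<noteq> {}" using w by auto
  have "std b \<omega> = Pow \<omega> - (if b then {\<omega>} else {})" unfolding std_def by auto
  then have "card (std b \<omega>) = 2 ^ n - (if b then 1 else 0)" using w by (simp add: card_Pow card_Diff_singleton)
  then have "even (card (std b \<omega>)) \<longleftrightarrow> \<not> b" using w(3) by auto
  then show ?thesis using even_card_eqv[OF w(4) cpx_std[OF w(1) w0]] by simp
qed

lemma bd_std:
  assumes "finite \<omega>" "\<omega> \<noteq> {}"
  shows "bd (std False \<omega>) = std True \<omega>"
proof -
  have "even (card (lk A (std False \<omega>))) \<longleftrightarrow> A \<noteq> \<omega>" if A: "A \<subseteq> \<omega>" for A
  proof -
    have "lk A (std False \<omega>) = Pow (\<omega> - A)" using A unfolding lk_def std_def by auto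
    then have "card (lk A (std False \<omega>)) = 2 ^ card (\<omega> - A)" using assms by (simp add: card_Pow)
    then show ?thesis using A assms by (auto simp: card_gt_0_iff)
  qed
  then show ?thesis unfolding bd_def unfolding std_def[of _ \<omega>] by (auto simp: std_def)
qed

text \<open>Parity alone does not show that \<open>bd K\<close> is closed under subsets, so this is
  carried along the chain together with the main property. Each move is either a subdivision of the
  boundary or leaves the boundary unchanged.\<close>

lemma ball_bd_collar_starrable:
  fixes K :: "'a::infinite set set"
  assumes "stellar_class False n K"
  shows "cpx (bd K) \<and> collar_starrable K (bd K)"
proof -
  obtain \<omega> where w: "finite \<omega>" "card \<omega> = n" "0 < n" "eqv {} (std False \<omega>) K"
    using assms unfolding stellar_class_def by blast
  have w0: "\<omega> \<noteq> {}" using w by auto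
  have st: "collar_starrable (subdiv \<sigma> s L) (bd (subdiv \<sigma> s L)) \<longleftrightarrow> collar_starrable L (bd L)"
    if h: "cpx L" "\<sigma> \<in> L" "\<sigma> \<noteq> {}" "s \<notin> verts L" "cpx (bd L)" for L :: "'a set set" and \<sigma> s
  proof (cases "\<sigma> \<in> bd L")
    case True
    show ?thesis unfolding bd_subdiv[OF h(1-4)] by (rule collar_starrable_boundary_subdiv[OF h(1,5) bd_subset True h(3,4)])
  next
    case False
    have "subdiv \<sigma> s (bd L) = bd L"
    proof (rule subdiv_id)
      show "\<not> \<sigma> \<subseteq> \<tau>" if "\<tau> \<in> bd L" for \<tau> using cpx_down[OF h(5) that] False by blast
      show "s \<notin> verts (bd L)" using h(4) verts_mono[OF bd_subset, of L] by blast
    qed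
    then show ?thesis unfolding bd_subdiv[OF h(1-4)] using collar_starrable_interior_subdiv[OF h(1,5) bd_subset h(2) False h(4)] by simp
  qed
  show ?thesis
    using w(4) cpx_std[OF w(1) w0]
  proof (induction rule: eqv_induct)
    case base
    obtain v where v: "v \<notin> \<omega>" using ex_fresh[OF w(1)] by blast
    let ?S = "std True \<omega>"
    have c: "cpx (std False \<omega>)" "cpx ?S" using cpx_std[OF w(1) w0] by auto
    have vs: "v \<notin> verts ?S" "v \<notin> verts (std False \<omega>)" using v verts_std[of True \<omega>] verts_std[of False \<omega>] by auto
    \<comment> \<open>Starring the top face turns the simplex into a cone; this is an interior
      subdivision because \<omega> is not in its own boundary.\<close>
    have e: "subdiv \<omega> v (std False \<omega>) = cone v ?S"
    proof (rule set_eqI)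
      fix \<tau>
      have "\<not> \<omega> \<subseteq> \<tau> \<and> \<tau> - {v} \<subseteq> \<omega> \<longleftrightarrow> \<tau> - {v} \<subseteq> \<omega> \<and> \<tau> - {v} \<noteq> \<omega>" using v by blast
      then show "\<tau> \<in> subdiv \<omega> v (std False \<omega>) \<longleftrightarrow> \<tau> \<in> cone v ?S"
        unfolding mem_subdiv cone_def std_def by auto
    qed
    have "collar_starrable (subdiv \<omega> v (std False \<omega>)) ?S" unfolding e by (rule collar_starrable_cone[OF c(2) vs(1)])
    then have "collar_starrable (std False \<omega>) ?S"
      by (subst (asm) collar_starrable_interior_subdiv[OF c]) (use vs in \<open>auto simp: std_def\<close>)
    then show ?case using bd_std[OF w(1) w0] c by simp
  next
    case (subdiv L \<sigma> s)
    have s0: "\<sigma> \<noteq> {}" using subdiv by blast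
    have "cpx (bd (subdiv \<sigma> s L))" unfolding bd_subdiv[OF subdiv(2,3) s0 subdiv(6)] using cpx_subdiv[OF _ s0] subdiv(7) by simp
    then show ?case using st[OF subdiv(2,3) s0 subdiv(6)] subdiv(7) by blast
  next
    case (weld L \<sigma> s)
    have s0: "\<sigma> \<noteq> {}" using weld by blast
    have "cpx (subdiv \<sigma> s (bd L))" using weld(7) bd_subdiv[OF weld(2,3) s0 weld(6)] by simp
    then have "cpx (bd L)"
      by (rule cpx_unsub[OF weld(2) bd_subset s0 weld(6) face_not_fresh[OF weld(3,6)]])
    then show ?case using st[OF weld(2,3) s0 weld(6)] weld(7) by blast
  qed
qed

lemma bd_link_ball:
  fixes K :: "'a::infinite set set"
  assumes "stellar_class False n K" "A \<in> bd K" "A \<noteq> {}"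
  shows "stellar_class False (n - card A) (lk A K)"
proof -
  have A: "A \<in> K" "even (card (lk A K))" using assms(2) unfolding bd_def by auto
  show ?thesis using ball_links[OF assms(1) A(1) assms(3)] stellar_class_parity[of True _ "lk A K"] A(2) by blast
qed

lemma starring_tame_ball:
  fixes K :: "'a::infinite set set"
  assumes "stellar_class False n K" "tame_rel K (bd K)"
  shows "starrable K (bd K)"
  using assms
proof (induction n arbitrary: K rule: less_induct)
  case (less n)
  have c: "cpx K" "cpx (bd K)" "collar_starrable K (bd K)" using stellar_class_cpx[OF less.prems(1)] ball_bd_collar_starrable[OF less.prems(1)] by auto
  have "links_starrable K (bd K)"
    unfolding links_starrable_def
  proof (intro ballI impI)
    fix A assume A: "A \<in> bd K" "A \<noteq> {}"
    have "starrable (lk A K) (bd (lk A K))"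
    proof (rule less.IH)
      have "finite A" by (rule cpx_finite_face[OF c(2) A(1)])
      then have "0 < card A" using A(2) by (simp add: card_gt_0_iff)
      moreover have "0 < n" using less.prems(1) unfolding stellar_class_def by blast
      ultimately show "n - card A < n" by simp
      show "stellar_class False (n - card A) (lk A K)" by (rule bd_link_ball[OF less.prems(1) A])
      show "tame_rel (lk A K) (bd (lk A K))"
        unfolding lk_bd[symmetric] by (rule tame_rel_lk[OF c(1,2) A(1) less.prems(2)])
    qed
    then show "starrable (lk A K) (lk A (bd K))" by (simp add: lk_bd)
  qed
  then show ?case by (rule starrable_if_collar_starrable[OF c(1,2) bd_subset c(3) less.prems(2)])
qed

section \<open>Translation to stellar moves\<close>

lemma cpx_aug: "is_complex A \<Longrightarrow> finite A \<Longrightarrow> cpx (insert {} A)"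
  unfolding cpx_def is_complex_def by (metis finite.insertI insert_iff finite.emptyI subset_empty)

lemma is_complex_unaug: "cpx K \<Longrightarrow> is_complex (K - {{}}) \<and> finite (K - {{}})"
  unfolding cpx_def is_complex_def by blast

lemma empty_notin_complex: "is_complex A \<Longrightarrow> {} \<notin> A"
  unfolding is_complex_def by blast

lemma aug_unaug: "cpx K \<Longrightarrow> insert {} (K - {{}}) = K"
  using cpx_empty[of K] by blast

lemma is_complex_down: "is_complex A \<Longrightarrow> \<tau> \<in> A \<Longrightarrow> \<rho> \<subseteq> \<tau> \<Longrightarrow> \<rho> \<noteq> {} \<Longrightarrow> \<rho> \<in> A"
  unfolding is_complex_def by blast

lemma aug_inject: "{} \<notin> A \<Longrightarrow> {} \<notin> B \<Longrightarrow> insert {} A = insert {} B \<Longrightarrow> A = B"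
  by (simp add: insert_ident)

lemma verts_aug: "verts (insert {} A) = verts A"
  unfolding verts_def by simp

lemma verts_unaug: "verts (K - {{}}) = verts K"
  unfolding verts_def by blast

lemma aug_join: "insert {} (A \<star> B) = {\<alpha> \<union> \<beta> |\<alpha> \<beta>. \<alpha> \<in> insert {} A \<and> \<beta> \<in> insert {} B}"
  unfolding join_def by (rule set_eqI) (auto; metis Un_empty_left Un_empty_right)

lemma aug_simplex: "insert {} (simplex \<sigma>) = Pow \<sigma>"
  unfolding simplex_def by auto

lemma aug_simplex_bd: "\<sigma> \<noteq> {} \<Longrightarrow> insert {} (simplex_bd \<sigma>) = Pow \<sigma> - {\<sigma>}"
  unfolding simplex_bd_def simplex_def by auto

lemma aug_link:
  assumes A: "is_complex A" and \<sigma>: "\<sigma> \<in> A"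
  shows "insert {} (link \<sigma> A) = lk \<sigma> (insert {} A)"
proof (rule set_eqI)
  fix \<tau>
  have s0: "\<sigma> \<noteq> {}" using A \<sigma> empty_notin_complex by blast
  have d: "\<tau> \<in> A" if "\<sigma> \<union> \<tau> \<in> A" "\<tau> \<noteq> {}" using is_complex_down[OF A that(1) _ that(2)] by blast
  show "\<tau> \<in> insert {} (link \<sigma> A) \<longleftrightarrow> \<tau> \<in> lk \<sigma> (insert {} A)"
  proof (cases "\<tau> = {}")
    case True
    then show ?thesis using \<sigma> unfolding lk_def by simp
  next
    case False
    then show ?thesis using s0 d unfolding lk_def link_def by (auto simp: Un_commute)
  qed
qed

lemma link_empty_notin: "is_complex A \<Longrightarrow> {} \<notin> link \<sigma> A"
  unfolding link_def is_complex_def by blast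

lemma join_notin: "{} \<notin> A \<Longrightarrow> {} \<notin> B \<Longrightarrow> {} \<notin> A \<star> B"
  unfolding join_def by auto

text \<open>With the empty face present, the triple join is the set of all unions of three parts,
  and a face splits into its part in \<open>{a}\<close>, its part in \<sigma> and the rest.\<close>

lemma apply_subdiv:
  assumes A: "is_complex A" and e: "\<sigma> \<in> A" "a \<notin> verts A"
  shows "insert {} (apply_move (Subdiv \<sigma> a) A) = subdiv \<sigma> a (insert {} A)"
proof -
  let ?K = "insert {} A"
  have s0: "\<sigma> \<noteq> {}" using A e empty_notin_complex by blast
  have down: "\<rho> \<in> ?K" if "\<tau> \<in> ?K" "\<rho> \<subseteq> \<tau>" for \<tau> \<rho> using is_complex_down[OF A, of \<tau> \<rho>] that by blast
  have a\<sigma>: "a \<notin> \<sigma>" using e unfolding verts_def by blast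
  have aK: "a \<notin> \<tau>" if "\<tau> \<in> ?K" for \<tau> using e(2) that unfolding verts_def by blast
  have "insert {} (apply_move (Subdiv \<sigma> a) A) =
      (A - star \<sigma> A) \<union> insert {} (simplex {a} \<star> simplex_bd \<sigma> \<star> link \<sigma> A)"
    using e by simp
  also have "\<dots> = (A - star \<sigma> A) \<union> {\<alpha> \<union> \<beta> \<union> \<gamma> |\<alpha> \<beta> \<gamma>. \<alpha> \<subseteq> {a} \<and> \<beta> \<subseteq> \<sigma> \<and> \<beta> \<noteq> \<sigma> \<and> \<gamma> \<in> lk \<sigma> ?K}"
    unfolding aug_join[of "simplex {a} \<star> simplex_bd \<sigma>"] aug_join[of "simplex {a}"] aug_simplex aug_simplex_bd[OF s0]
      aug_link[OF A e(1)] by blast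
  also have "\<dots> = subdiv \<sigma> a ?K"
  proof
    show "(A - star \<sigma> A) \<union> {\<alpha> \<union> \<beta> \<union> \<gamma> |\<alpha> \<beta> \<gamma>. \<alpha> \<subseteq> {a} \<and> \<beta> \<subseteq> \<sigma> \<and> \<beta> \<noteq> \<sigma> \<and> \<gamma> \<in> lk \<sigma> ?K} \<subseteq> subdiv \<sigma> a ?K"
    proof
      fix \<tau> assume "\<tau> \<in> (A - star \<sigma> A) \<union> {\<alpha> \<union> \<beta> \<union> \<gamma> |\<alpha> \<beta> \<gamma>. \<alpha> \<subseteq> {a} \<and> \<beta> \<subseteq> \<sigma> \<and> \<beta> \<noteq> \<sigma> \<and> \<gamma> \<in> lk \<sigma> ?K}"
      then consider "\<tau> \<in> A - star \<sigma> A" | \<alpha> \<beta> \<gamma> where "\<tau> = \<alpha> \<union> \<beta> \<union> \<gamma>" "\<alpha> \<subseteq> {a}" "\<beta> \<subseteq> \<sigma>" "\<beta> \<noteq> \<sigma>" "\<gamma> \<in> lk \<sigma> ?K" by blast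
      then show "\<tau> \<in> subdiv \<sigma> a ?K"
      proof cases
        case 1
        then have "\<tau> \<in> A" "\<not> \<sigma> \<subseteq> \<tau>" unfolding star_def by auto
        moreover have "a \<notin> \<tau>" using aK calculation by blast
        ultimately show ?thesis unfolding mem_subdiv by simp
      next
        case 2
        have g: "\<gamma> \<inter> \<sigma> = {}" "\<gamma> \<union> \<sigma> \<in> ?K" using 2(5) unfolding lk_def by auto
        have n: "\<not> \<sigma> \<subseteq> \<tau>" using 2 g a\<sigma> by blast
        have ag: "a \<notin> \<gamma>" using aK[OF g(2)] by blast
        show ?thesis
        proof (cases "a \<in> \<tau>")
          case True
          have "\<tau> - {a} \<union> \<sigma> = \<gamma> \<union> \<sigma>" using 2 ag a\<sigma> by blast
          then show ?thesis using g n True unfolding mem_subdiv by simp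
        next
          case False
          have "\<tau> \<in> ?K" by (rule down[OF g(2)]) (use 2 False in blast)
          then show ?thesis using n False unfolding mem_subdiv by simp
        qed
      qed
    qed
    show "subdiv \<sigma> a ?K \<subseteq> (A - star \<sigma> A) \<union> {\<alpha> \<union> \<beta> \<union> \<gamma> |\<alpha> \<beta> \<gamma>. \<alpha> \<subseteq> {a} \<and> \<beta> \<subseteq> \<sigma> \<and> \<beta> \<noteq> \<sigma> \<and> \<gamma> \<in> lk \<sigma> ?K}"
    proof
      fix \<tau> assume t: "\<tau> \<in> subdiv \<sigma> a ?K"
      have n: "\<not> \<sigma> \<subseteq> \<tau>" using t unfolding mem_subdiv by simp
      show "\<tau> \<in> (A - star \<sigma> A) \<union> {\<alpha> \<union> \<beta> \<union> \<gamma> |\<alpha> \<beta> \<gamma>. \<alpha> \<subseteq> {a} \<and> \<beta> \<subseteq> \<sigma> \<and> \<beta> \<noteq> \<sigma> \<and> \<gamma> \<in> lk \<sigma> ?K}"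
      proof (cases "a \<in> \<tau> \<or> \<tau> = {}")
        case True
        let ?g = "\<tau> - {a} - \<sigma>"
        have "?g \<union> \<sigma> \<in> ?K"
        proof (cases "\<tau> = {}")
          case False
          then have "\<tau> - {a} \<union> \<sigma> \<in> ?K" using t True unfolding mem_subdiv by simp
          moreover have "?g \<union> \<sigma> = \<tau> - {a} \<union> \<sigma>" by blast
          ultimately show ?thesis by simp
        qed (use e in simp)
        then have "?g \<in> lk \<sigma> ?K" unfolding lk_def by blast
        moreover have "\<tau> = (\<tau> \<inter> {a}) \<union> (\<tau> \<inter> \<sigma>) \<union> ?g" by blast
        moreover have "\<tau> \<inter> \<sigma> \<noteq> \<sigma>" using n by blast
        ultimately show ?thesis by blast
      next
        case False
        then have "\<tau> \<in> A" using t unfolding mem_subdiv by simp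
        then show ?thesis using n unfolding star_def by blast
      qed
    qed
  qed
  finally show ?thesis .
qed

lemma join_bd_eq_join: "\<kappa> \<inter> verts L = {} \<Longrightarrow> join_bd \<kappa> L = {\<beta> \<union> \<gamma> |\<beta> \<gamma>. \<beta> \<subseteq> \<kappa> \<and> \<beta> \<noteq> \<kappa> \<and> \<gamma> \<in> L}"
proof
  assume d: "\<kappa> \<inter> verts L = {}"
  show "join_bd \<kappa> L \<subseteq> {\<beta> \<union> \<gamma> |\<beta> \<gamma>. \<beta> \<subseteq> \<kappa> \<and> \<beta> \<noteq> \<kappa> \<and> \<gamma> \<in> L}"
  proof
    fix \<tau> assume "\<tau> \<in> join_bd \<kappa> L"
    then have "\<tau> = (\<tau> \<inter> \<kappa>) \<union> (\<tau> - \<kappa>)" "\<tau> \<inter> \<kappa> \<noteq> \<kappa>" "\<tau> - \<kappa> \<in> L" unfolding join_bd_def by blast+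
    then show "\<tau> \<in> {\<beta> \<union> \<gamma> |\<beta> \<gamma>. \<beta> \<subseteq> \<kappa> \<and> \<beta> \<noteq> \<kappa> \<and> \<gamma> \<in> L}" by blast
  qed
  show "{\<beta> \<union> \<gamma> |\<beta> \<gamma>. \<beta> \<subseteq> \<kappa> \<and> \<beta> \<noteq> \<kappa> \<and> \<gamma> \<in> L} \<subseteq> join_bd \<kappa> L"
  proof
    fix \<tau> assume "\<tau> \<in> {\<beta> \<union> \<gamma> |\<beta> \<gamma>. \<beta> \<subseteq> \<kappa> \<and> \<beta> \<noteq> \<kappa> \<and> \<gamma> \<in> L}"
    then obtain \<beta> \<gamma> where t: "\<tau> = \<beta> \<union> \<gamma>" "\<beta> \<subseteq> \<kappa>" "\<beta> \<noteq> \<kappa>" "\<gamma> \<in> L" by blast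
    have "\<gamma> \<inter> \<kappa> = {}" using d face_verts[OF t(4)] by blast
    then have "\<tau> - \<kappa> = \<gamma>" "\<not> \<kappa> \<subseteq> \<tau>" using t by blast+
    then show "\<tau> \<in> join_bd \<kappa> L" using t(4) unfolding join_bd_def by simp
  qed
qed

lemma aug_weld_result:
  assumes A: "is_complex A" and s: "\<sigma> \<noteq> {}" and L: "weld_cofactor \<sigma> a A L" and e: "essential (Weld \<sigma> a) A"
  shows "insert {} (apply_move (Weld \<sigma> a) A) =
    {\<tau> \<in> insert {} A. a \<notin> \<tau>} \<union> {\<beta> \<union> \<gamma> |\<beta> \<gamma>. \<beta> \<subseteq> \<sigma> \<and> \<gamma> \<in> insert {} L}"
proof -
  have "(THE L. weld_cofactor \<sigma> a A L) = L" by (rule the_equality, rule L, rule weld_cofactor_unique[OF _ L])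
  then have "insert {} (apply_move (Weld \<sigma> a) A) = (A - star {a} A) \<union> insert {} (simplex \<sigma> \<star> L)" using e by simp
  also have "\<dots> = (A - star {a} A) \<union> {\<beta> \<union> \<gamma> |\<beta> \<gamma>. \<beta> \<subseteq> \<sigma> \<and> \<gamma> \<in> insert {} L}"
    unfolding aug_join aug_simplex by simp
  also have "\<dots> = {\<tau> \<in> insert {} A. a \<notin> \<tau>} \<union> {\<beta> \<union> \<gamma> |\<beta> \<gamma>. \<beta> \<subseteq> \<sigma> \<and> \<gamma> \<in> insert {} L}"
    unfolding star_def by blast
  finally show ?thesis .
qed

text \<open>The cofactor of the weld is the link of \<sigma>, because the link of the new vertex is
  its join with \<partial>\<sigma>.\<close>

lemma apply_weld_subdiv:
  assumes K: "cpx K" and \<sigma>: "\<sigma> \<in> K" "\<sigma> \<noteq> {}" "s \<notin> verts K"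
  shows "essential (Weld \<sigma> s) (subdiv \<sigma> s K - {{}})" "apply_move (Weld \<sigma> s) (subdiv \<sigma> s K - {{}}) = K - {{}}"
proof -
  let ?A = "subdiv \<sigma> s K - {{}}" let ?L = "lk \<sigma> K - {{}}"
  have cs: "cpx (subdiv \<sigma> s K)" by (rule cpx_subdiv[OF K \<sigma>(2)])
  have A: "is_complex ?A" using is_complex_unaug[OF cs] by blast
  have aug: "insert {} ?A = subdiv \<sigma> s K" by (rule aug_unaug[OF cs])
  have cl: "cpx (lk \<sigma> K)" by (rule cpx_lk[OF K \<sigma>(1)])
  have augL: "insert {} ?L = lk \<sigma> K" by (rule aug_unaug[OF cl])
  have s\<sigma>: "s \<notin> \<sigma>" by (rule face_not_fresh[OF \<sigma>(1,3)])
  have sA: "{s} \<in> ?A" using \<sigma> s\<sigma> unfolding mem_subdiv Diff_iff by auto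
  have d: "\<sigma> \<inter> verts (lk \<sigma> K) = {}" using verts_lk_subset[of \<sigma> K] by blast
  have L: "weld_cofactor \<sigma> s ?A ?L"
    unfolding weld_cofactor_def
  proof (intro conjI)
    show "is_complex ?L" using is_complex_unaug[OF cl] by blast
    show "verts ?L \<inter> \<sigma> = {}" using d by (simp add: verts_unaug Int_commute)
    have "insert {} (link {s} ?A) = join_bd \<sigma> (lk \<sigma> K)"
      using aug_link[OF A sA] lk_new_vertex[OF \<sigma>(3,1)] aug by simp
    also have "\<dots> = insert {} (simplex_bd \<sigma> \<star> ?L)"
      unfolding join_bd_eq_join[OF d] aug_join aug_simplex_bd[OF \<sigma>(2)] augL by blast
    finally have 1: "insert {} (link {s} ?A) = insert {} (simplex_bd \<sigma> \<star> ?L)" .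
    have 2: "{} \<notin> simplex_bd \<sigma> \<star> ?L" by (rule join_notin) (auto simp: simplex_bd_def simplex_def)
    show "link {s} ?A = simplex_bd \<sigma> \<star> ?L" by (rule aug_inject[OF link_empty_notin[OF A] 2 1])
  qed
  have fin: "finite \<sigma>" by (rule cpx_finite_face[OF K \<sigma>(1)])
  have "\<sigma> \<notin> ?A" unfolding mem_subdiv Diff_iff by simp
  moreover have "s \<in> verts ?A" using sA unfolding verts_def by blast
  ultimately show e: "essential (Weld \<sigma> s) ?A" using fin \<sigma>(2) L by auto
  have sK: "s \<notin> \<tau>" if "\<tau> \<in> K" for \<tau> using that \<sigma>(3) face_verts by blast
  have "insert {} (apply_move (Weld \<sigma> s) ?A) = {\<tau> \<in> subdiv \<sigma> s K. s \<notin> \<tau>} \<union> {\<beta> \<union> \<gamma> |\<beta> \<gamma>. \<beta> \<subseteq> \<sigma> \<and> \<gamma> \<in> lk \<sigma> K}"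
    using aug_weld_result[OF A \<sigma>(2) L e] unfolding aug augL .
  also have "\<dots> = K"
  proof
    show "{\<tau> \<in> subdiv \<sigma> s K. s \<notin> \<tau>} \<union> {\<beta> \<union> \<gamma> |\<beta> \<gamma>. \<beta> \<subseteq> \<sigma> \<and> \<gamma> \<in> lk \<sigma> K} \<subseteq> K"
    proof
      fix \<tau> assume "\<tau> \<in> {\<tau> \<in> subdiv \<sigma> s K. s \<notin> \<tau>} \<union> {\<beta> \<union> \<gamma> |\<beta> \<gamma>. \<beta> \<subseteq> \<sigma> \<and> \<gamma> \<in> lk \<sigma> K}"
      then consider "\<tau> \<in> subdiv \<sigma> s K" "s \<notin> \<tau>" | \<beta> \<gamma> where "\<tau> = \<beta> \<union> \<gamma>" "\<beta> \<subseteq> \<sigma>" "\<gamma> \<in> lk \<sigma> K" by blast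
      then show "\<tau> \<in> K"
      proof cases
        case 1
        then show ?thesis unfolding mem_subdiv by simp
      next
        case 2
        then have "\<gamma> \<union> \<sigma> \<in> K" unfolding lk_def by simp
        then show ?thesis by (rule cpx_down[OF K]) (use 2 in blast)
      qed
    qed
    show "K \<subseteq> {\<tau> \<in> subdiv \<sigma> s K. s \<notin> \<tau>} \<union> {\<beta> \<union> \<gamma> |\<beta> \<gamma>. \<beta> \<subseteq> \<sigma> \<and> \<gamma> \<in> lk \<sigma> K}"
    proof
      fix \<tau> assume t: "\<tau> \<in> K"
      show "\<tau> \<in> {\<tau> \<in> subdiv \<sigma> s K. s \<notin> \<tau>} \<union> {\<beta> \<union> \<gamma> |\<beta> \<gamma>. \<beta> \<subseteq> \<sigma> \<and> \<gamma> \<in> lk \<sigma> K}"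
      proof (cases "\<sigma> \<subseteq> \<tau>")
        case True
        then have e: "\<tau> - \<sigma> \<union> \<sigma> = \<tau>" by blast
        then have "\<tau> - \<sigma> \<in> lk \<sigma> K" using t unfolding lk_def by auto
        moreover have "\<tau> = \<sigma> \<union> (\<tau> - \<sigma>)" using True by blast
        ultimately show ?thesis by blast
      next
        case False
        then show ?thesis using t sK[OF t] unfolding mem_subdiv by simp
      qed
    qed
  qed
  finally have "insert {} (apply_move (Weld \<sigma> s) ?A) = K" .
  moreover have "{} \<notin> apply_move (Weld \<sigma> s) ?A"
    using is_complex_apply_move[OF A] empty_notin_complex by blast
  ultimately show "apply_move (Weld \<sigma> s) ?A = K - {{}}" by blast
qed

text \<open>This makes subdivisions the only moves to be studied: an essential weld is undone by
  subdividing its result. As \<sigma> is not a face before the weld, the faces containing \<sigma>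
  afterwards are exactly the ones the subdivision removes.\<close>

lemma weld_inverse:
  assumes A: "is_complex A" and e: "essential (Weld \<sigma> a) A"
  defines "K \<equiv> insert {} (apply_move (Weld \<sigma> a) A)"
  shows "\<sigma> \<in> K" "a \<notin> verts K" "insert {} A = subdiv \<sigma> a K"
proof -
  obtain L where L: "weld_cofactor \<sigma> a A L" using e by auto
  have h: "finite \<sigma>" "\<sigma> \<noteq> {}" "\<sigma> \<notin> A" "a \<in> verts A" using e by auto
  have Lc: "is_complex L" "verts L \<inter> \<sigma> = {}" "link {a} A = simplex_bd \<sigma> \<star> L" using L unfolding weld_cofactor_def by auto
  have aA: "{a} \<in> A"
  proof -
    obtain \<tau> where "\<tau> \<in> A" "a \<in> \<tau>" using h(4) unfolding verts_def by blast
    then show ?thesis using is_complex_down[OF A, of \<tau> "{a}"] by simp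
  qed
  have down: "\<rho> \<in> insert {} A" if "\<tau> \<in> insert {} A" "\<rho> \<subseteq> \<tau>" for \<tau> \<rho> using is_complex_down[OF A, of \<tau> \<rho>] that by blast
  have J: "join_bd \<sigma> (insert {} L) = lk {a} (insert {} A)"
  proof -
    have "\<sigma> \<inter> verts (insert {} L) = {}" using Lc(2) by (simp add: verts_aug Int_commute)
    then have "join_bd \<sigma> (insert {} L) = insert {} (simplex_bd \<sigma> \<star> L)"
      unfolding aug_join aug_simplex_bd[OF h(2)] by (subst join_bd_eq_join) blast+
    then show ?thesis using aug_link[OF A aA] Lc(3) by simp
  qed
  have aJ: "a \<notin> \<tau>" if "\<tau> \<in> join_bd \<sigma> (insert {} L)" for \<tau> using that unfolding J lk_def by blast
  \<comment> \<open>If \<open>a\<close> were in \<sigma>, then either \<sigma> would be the face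
    \<open>{a}\<close>, or \<open>a\<close> would lie in its own link.\<close>
  have a\<sigma>: "a \<notin> \<sigma>"
  proof
    assume a: "a \<in> \<sigma>"
    show False
    proof (cases "\<sigma> = {a}")
      case True
      then show ?thesis using aA h(3) by simp
    next
      case False
      then have "{a} \<in> join_bd \<sigma> (insert {} L)" using a unfolding join_bd_def by auto
      then show ?thesis using aJ by blast
    qed
  qed
  have aL: "a \<notin> \<gamma>" "\<gamma> \<inter> \<sigma> = {}" if g: "\<gamma> \<in> insert {} L" for \<gamma>
  proof -
    show d: "\<gamma> \<inter> \<sigma> = {}" using g Lc(2) face_verts[of \<gamma> L] by auto
    then have "\<gamma> - \<sigma> = \<gamma>" "\<not> \<sigma> \<subseteq> \<gamma>" using h(2) by blast+
    then have "\<gamma> \<in> join_bd \<sigma> (insert {} L)" using g unfolding join_bd_def by auto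
    then show "a \<notin> \<gamma>" by (rule aJ)
  qed
  have K: "K = {\<tau> \<in> insert {} A. a \<notin> \<tau>} \<union> {\<beta> \<union> \<gamma> |\<beta> \<gamma>. \<beta> \<subseteq> \<sigma> \<and> \<gamma> \<in> insert {} L}"
    unfolding K_def by (rule aug_weld_result[OF A h(2) L e])
  show "\<sigma> \<in> K" unfolding K by blast
  have "a \<notin> \<tau>" if "\<tau> \<in> K" for \<tau>
  proof -
    have "a \<notin> \<tau> \<or> (\<exists>\<beta> \<gamma>. \<tau> = \<beta> \<union> \<gamma> \<and> \<beta> \<subseteq> \<sigma> \<and> \<gamma> \<in> insert {} L)"
      using that unfolding K Un_iff mem_Collect_eq by argo
    then show ?thesis
    proof
      assume "\<exists>\<beta> \<gamma>. \<tau> = \<beta> \<union> \<gamma> \<and> \<beta> \<subseteq> \<sigma> \<and> \<gamma> \<in> insert {} L"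
      then obtain \<beta> \<gamma> where g: "\<tau> = \<beta> \<union> \<gamma>" "\<beta> \<subseteq> \<sigma>" "\<gamma> \<in> insert {} L" by (elim exE conjE)
      then show ?thesis using aL(1)[OF g(3)] a\<sigma> by blast
    qed
  qed
  then show "a \<notin> verts K" unfolding verts_def by blast
  have n\<sigma>: "\<not> \<sigma> \<subseteq> \<tau>" if "\<tau> \<in> insert {} A" for \<tau> using down[OF that, of \<sigma>] h by blast
  show "insert {} A = subdiv \<sigma> a K"
  proof (rule set_eqI)
    fix \<tau>
    have Lk: "\<tau>' \<in> join_bd \<sigma> (insert {} L) \<longleftrightarrow> a \<notin> \<tau>' \<and> insert a \<tau>' \<in> insert {} A" for \<tau>'
      unfolding J lk_def by auto
    show "\<tau> \<in> insert {} A \<longleftrightarrow> \<tau> \<in> subdiv \<sigma> a K"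
    proof (cases "a \<in> \<tau>")
      case True
      have "\<tau> - {a} \<union> \<sigma> \<in> K \<longleftrightarrow> \<tau> - {a} - \<sigma> \<in> insert {} L"
      proof
        assume "\<tau> - {a} \<union> \<sigma> \<in> K"
        moreover have "\<tau> - {a} \<union> \<sigma> \<notin> insert {} A" using n\<sigma> by blast
        ultimately obtain \<beta> \<gamma> where g: "\<tau> - {a} \<union> \<sigma> = \<beta> \<union> \<gamma>" "\<beta> \<subseteq> \<sigma>" "\<gamma> \<in> insert {} L" unfolding K by blast
        then have "\<tau> - {a} - \<sigma> = \<gamma>" using aL(2)[OF g(3)] by blast
        then show "\<tau> - {a} - \<sigma> \<in> insert {} L" using g by simp
      next
        assume g: "\<tau> - {a} - \<sigma> \<in> insert {} L"
        have "\<tau> - {a} \<union> \<sigma> = \<sigma> \<union> (\<tau> - {a} - \<sigma>)" by blast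
        then show "\<tau> - {a} \<union> \<sigma> \<in> K" using g unfolding K by blast
      qed
      moreover have "\<sigma> \<subseteq> \<tau> - {a} \<longleftrightarrow> \<sigma> \<subseteq> \<tau>" using a\<sigma> by blast
      ultimately have "\<tau> \<in> subdiv \<sigma> a K \<longleftrightarrow> \<tau> - {a} \<in> join_bd \<sigma> (insert {} L)"
        using True unfolding mem_subdiv join_bd_def by auto
      moreover have "insert a (\<tau> - {a}) = \<tau>" using True by blast
      ultimately show ?thesis using Lk[of "\<tau> - {a}"] by auto
    next
      case False
      have "\<tau> \<in> insert {} A" if t: "\<tau> \<in> K" "\<not> \<sigma> \<subseteq> \<tau>"
      proof (rule ccontr)
        assume "\<tau> \<notin> insert {} A"
        then obtain \<beta> \<gamma> where g: "\<tau> = \<beta> \<union> \<gamma>" "\<beta> \<subseteq> \<sigma>" "\<gamma> \<in> insert {} L" using t unfolding K by blast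
        have "\<tau> - \<sigma> = \<gamma>" using g aL(2)[OF g(3)] by blast
        then have "\<tau> \<in> join_bd \<sigma> (insert {} L)" using g(3) t(2) unfolding join_bd_def by auto
        then have "insert a \<tau> \<in> insert {} A" using Lk by blast
        then have "\<tau> \<in> insert {} A" by (rule down) blast
        then show False using \<open>\<tau> \<notin> insert {} A\<close> by blast
      qed
      moreover have "\<tau> \<in> K" if "\<tau> \<in> insert {} A" using that False unfolding K by blast
      ultimately show ?thesis using False n\<sigma>[of \<tau>] unfolding mem_subdiv by auto
    qed
  qed
qed

lemma apply_subdiv_subdiv:
  assumes K: "cpx K" and \<sigma>: "\<sigma> \<in> K" "\<sigma> \<noteq> {}" "s \<notin> verts K"
  shows "essential (Subdiv \<sigma> s) (K - {{}})" "apply_move (Subdiv \<sigma> s) (K - {{}}) = subdiv \<sigma> s K - {{}}"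
proof -
  have A: "is_complex (K - {{}})" using is_complex_unaug[OF K] by blast
  have h: "\<sigma> \<in> K - {{}}" "s \<notin> verts (K - {{}})" using \<sigma> by (simp_all add: verts_unaug)
  then show "essential (Subdiv \<sigma> s) (K - {{}})" by simp
  have 1: "insert {} (apply_move (Subdiv \<sigma> s) (K - {{}})) = subdiv \<sigma> s K"
    using apply_subdiv[OF A h] aug_unaug[OF K] by simp
  have "{} \<notin> apply_move (Subdiv \<sigma> s) (K - {{}})"
    by (rule empty_notin_complex[OF is_complex_apply_move[OF A]])
  then show "apply_move (Subdiv \<sigma> s) (K - {{}}) = subdiv \<sigma> s K - {{}}" unfolding 1[symmetric] by simp
qed

lemma stellar_step_cases:
  assumes "stellar_step A B"
  shows "A = B \<or> (\<exists>\<sigma> s. \<sigma> \<in> insert {} A \<and> \<sigma> \<noteq> {} \<and> s \<notin> verts (insert {} A) \<and> insert {} B = subdiv \<sigma> s (insert {} A)) \<or>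
    (\<exists>\<sigma> s. \<sigma> \<in> insert {} B \<and> \<sigma> \<noteq> {} \<and> s \<notin> verts (insert {} B) \<and> insert {} A = subdiv \<sigma> s (insert {} B))"
proof -
  obtain \<delta> where A: "is_complex A" "is_complex B" and \<delta>: "B = apply_move \<delta> A" using assms unfolding stellar_step_def by blast
  show ?thesis
  proof (cases "essential \<delta> A")
    case False
    then have "B = A" unfolding \<delta> by (cases \<delta>) auto
    then show ?thesis by simp
  next
    case True
    show ?thesis
    proof (cases \<delta>)
      case (Subdiv \<sigma> s)
      have h: "\<sigma> \<in> A" "s \<notin> verts A" using True Subdiv by auto
      have "insert {} B = subdiv \<sigma> s (insert {} A)" unfolding \<delta> Subdiv by (rule apply_subdiv[OF A(1) h])
      moreover have "\<sigma> \<noteq> {}" using h empty_notin_complex[OF A(1)] by blast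
      ultimately show ?thesis using h by (auto simp: verts_aug)
    next
      case (Weld \<sigma> s)
      have e: "essential (Weld \<sigma> s) A" using True Weld by simp
      have "\<sigma> \<noteq> {}" using e by simp
      then show ?thesis using weld_inverse[OF A(1) e] unfolding \<delta> Weld by blast
    qed
  qed
qed

text \<open>Finiteness is not part of \<open>is_complex\<close>, so it has to be carried across
  welds. Faces containing \<sigma> are controlled through the faces
  \<open>insert s (\<tau> - {y})\<close> of the subdivision.\<close>

lemma finite_unsub:
  assumes f: "finite (subdiv \<sigma> s K)" "\<And>\<tau>. \<tau> \<in> subdiv \<sigma> s K \<Longrightarrow> finite \<tau>" and \<sigma>: "finite \<sigma>" "\<sigma> \<noteq> {}" "s \<notin> verts K" "s \<notin> \<sigma>"
  shows "finite K"
proof -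
  let ?X = "verts (subdiv \<sigma> s K) \<union> \<sigma>"
  have "finite ?X" using f \<sigma> unfolding verts_def by blast
  moreover have "K \<subseteq> Pow ?X"
  proof
    fix \<tau> assume t: "\<tau> \<in> K"
    have st: "s \<notin> \<tau>" using t \<sigma> face_verts by blast
    show "\<tau> \<in> Pow ?X"
    proof (cases "\<sigma> \<subseteq> \<tau>")
      case False
      then have "\<tau> \<in> subdiv \<sigma> s K" using t st unfolding mem_subdiv by simp
      then show ?thesis using face_verts by blast
    next
      case True
      obtain y where y: "y \<in> \<sigma>" using \<sigma> by blast
      have "insert s (\<tau> - {y}) - {s} \<union> \<sigma> = \<tau>" "\<not> \<sigma> \<subseteq> insert s (\<tau> - {y})" using True y \<sigma> st by blast+
      then have "insert s (\<tau> - {y}) \<in> subdiv \<sigma> s K" using t unfolding mem_subdiv by simp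
      from face_verts[OF this] show ?thesis using y by blast
    qed
  qed
  ultimately show ?thesis by (meson finite_Pow_iff finite_subset)
qed

lemma stellar_equiv_eqv:
  assumes "stellar_equiv A B" "is_complex A" "finite A"
  shows "eqv {} (insert {} A) (insert {} B) \<and> is_complex B \<and> finite B"
  using assms(1)
proof (induction rule: equivclp_induct)
  case base
  show ?case using assms by simp
next
  case (step y z)
  have y: "is_complex y" "finite y" "eqv {} (insert {} A) (insert {} y)" using step by auto
  have z: "is_complex z" using step(2) unfolding stellar_step_def by blast
  have cy: "cpx (insert {} y)" by (rule cpx_aug[OF y(1,2)])
  have "eqv {} (insert {} y) (insert {} z) \<and> finite z"
  proof -
    consider "y = z" | \<sigma> s where "\<sigma> \<in> insert {} y" "\<sigma> \<noteq> {}" "s \<notin> verts (insert {} y)" "insert {} z = subdiv \<sigma> s (insert {} y)"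
      | \<sigma> s where "\<sigma> \<in> insert {} z" "\<sigma> \<noteq> {}" "s \<notin> verts (insert {} z)" "insert {} y = subdiv \<sigma> s (insert {} z)"
      using step(2) stellar_step_cases by metis
    then show ?thesis
    proof cases
      case 1
      then show ?thesis using y by simp
    next
      case 2
      have "finite (insert {} z)" using cpx_subdiv[OF cy 2(2)] unfolding 2(4) cpx_def by blast
      then have "finite z" by simp
      moreover have "eqv {} (insert {} y) (subdiv \<sigma> s (insert {} y))" by (rule eqv_subdiv[OF cy 2(1)]) (use 2 in auto)
      ultimately show ?thesis using 2(4) by simp
    next
      case 3
      have s\<sigma>: "s \<notin> \<sigma>" by (rule face_not_fresh[OF 3(1,3)])
      have f\<sigma>: "finite \<sigma>" using 3(1,2) z unfolding is_complex_def by auto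
      have "finite (insert {} z)"
        by (rule finite_unsub[OF _ _ f\<sigma> 3(2,3) s\<sigma>]) (use cy 3(4) in \<open>auto simp: cpx_def\<close>)
      then have fz: "finite z" by simp
      have cz: "cpx (insert {} z)" by (rule cpx_aug[OF z fz])
      have "eqv {} (insert {} z) (subdiv \<sigma> s (insert {} z))" by (rule eqv_subdiv[OF cz 3(1)]) (use 3 in auto)
      then show ?thesis using fz 3(4) equivclp_sym by metis
    qed
  qed
  then show ?case using y(3) z equivclp_trans[of "step {}" "insert {} A" "insert {} y"] by blast
qed

lemma eqv_stellar_equiv:
  assumes "eqv {} K K'" "cpx K"
  shows "stellar_equiv (K - {{}}) (K' - {{}})"
proof -
  have st: "stellar_step (L - {{}}) (subdiv \<sigma> s L - {{}})" if h: "cpx L" "\<sigma> \<in> L" "\<not> \<sigma> \<subseteq> {}" "s \<notin> verts L" for L :: "'a set set" and \<sigma> s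
  proof -
    have s0: "\<sigma> \<noteq> {}" using h by blast
    have "subdiv \<sigma> s L - {{}} = apply_move (Subdiv \<sigma> s) (L - {{}})" using apply_subdiv_subdiv(2)[OF h(1,2) s0 h(4)] by simp
    then show ?thesis
      unfolding stellar_step_def using is_complex_unaug[OF h(1)] is_complex_unaug[OF cpx_subdiv[OF h(1) s0, of s]] by blast
  qed
  show ?thesis
    using assms
  proof (induction rule: eqv_induct)
    case base
    show ?case by simp
  next
    case (subdiv L \<sigma> s)
    have "stellar_equiv (L - {{}}) (subdiv \<sigma> s L - {{}})" by (rule r_into_equivclp, rule st[OF subdiv(2-4,6)])
    then show ?case by (rule equivclp_trans[OF subdiv(7)])
  next
    case (weld L \<sigma> s)
    have "stellar_equiv (L - {{}}) (subdiv \<sigma> s L - {{}})" by (rule r_into_equivclp, rule st[OF weld(2-4,6)])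
    then show ?case by (rule equivclp_trans[OF weld(7) equivclp_sym])
  qed
qed

lemma aug_simplex_std: "insert {} (simplex \<sigma>) = std False \<sigma>"
  unfolding aug_simplex std_def by auto

lemma aug_simplex_bd_std: "\<sigma> \<noteq> {} \<Longrightarrow> insert {} (simplex_bd \<sigma>) = std True \<sigma>"
  by (simp add: aug_simplex_bd std_def) blast

lemma stellar_ball_stellar_class:
  assumes "stellar_ball n B"
  shows "stellar_class False (n + 1) (insert {} B)" "is_complex B" "finite B"
proof -
  obtain \<sigma> where s: "finite \<sigma>" "card \<sigma> = n + 1" "stellar_equiv (simplex \<sigma>) B" using assms unfolding stellar_ball_def by blast
  have "finite (simplex \<sigma>)" using s(1) unfolding simplex_def by simp
  then have "eqv {} (insert {} (simplex \<sigma>)) (insert {} B) \<and> is_complex B \<and> finite B"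
    by (rule stellar_equiv_eqv[OF s(3) is_complex_simplex[OF s(1)]])
  then show "stellar_class False (n + 1) (insert {} B)" "is_complex B" "finite B"
    unfolding aug_simplex_std stellar_class_def using s by auto
qed

lemma stellar_sphere_stellar_class:
  assumes "is_complex X" "finite X"
  shows "(\<exists>d. stellar_sphere d X) \<longleftrightarrow> (\<exists>m. stellar_class True m (insert {} X))"
proof
  assume "\<exists>d. stellar_sphere d X"
  then obtain n \<sigma> where s: "finite \<sigma>" "card \<sigma> = n + 1" "stellar_equiv (simplex_bd \<sigma>) X" unfolding stellar_sphere_def by blast
  have s0: "\<sigma> \<noteq> {}" using s by auto
  have "finite (simplex_bd \<sigma>)" using s(1) unfolding simplex_bd_def simplex_def by simp
  then have "eqv {} (insert {} (simplex_bd \<sigma>)) (insert {} X)"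
    using stellar_equiv_eqv[OF s(3) is_complex_simplex_bd[OF s(1)]] by blast
  then have "stellar_class True (n + 1) (insert {} X)" unfolding aug_simplex_bd_std[OF s0] stellar_class_def using s by auto
  then show "\<exists>m. stellar_class True m (insert {} X)" by blast
next
  assume "\<exists>m. stellar_class True m (insert {} X)"
  then obtain m \<sigma> where s: "0 < m" "finite \<sigma>" "card \<sigma> = m" "eqv {} (std True \<sigma>) (insert {} X)" unfolding stellar_class_def by blast
  have s0: "\<sigma> \<noteq> {}" using s by auto
  have "stellar_equiv (std True \<sigma> - {{}}) (insert {} X - {{}})" by (rule eqv_stellar_equiv[OF s(4) cpx_std[OF s(2) s0]])
  moreover have "insert {} X - {{}} = X" using empty_notin_complex[OF assms(1)] by simp
  moreover have "std True \<sigma> - {{}} = simplex_bd \<sigma>" unfolding std_def simplex_bd_def simplex_def by auto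
  ultimately have "stellar_equiv (simplex_bd \<sigma>) X" by simp
  \<comment> \<open>A model with \<open>m\<close> vertices has \<open>n = m - 1\<close> in the
    definition of \<open>stellar_sphere\<close>.\<close>
  then have "stellar_sphere (int (m - 1) - 1) X" unfolding stellar_sphere_def using s by (intro exI[of _ "m - 1"] exI[of _ \<sigma>]) auto
  then show "\<exists>d. stellar_sphere d X" by blast
qed

text \<open>By \<open>ball_links\<close> the link of a nonempty face is a ball or a sphere, and its
  parity decides which.\<close>

lemma boundary_eq_bd:
  fixes K :: "'a::infinite set set"
  assumes stellar_class: "stellar_class False n K"
  shows "boundary (K - {{}}) = bd K - {{}}"
proof (rule set_eqI)
  fix A
  have K: "cpx K" by (rule stellar_class_cpx[OF stellar_class])
  have iK: "is_complex (K - {{}})" "finite (K - {{}})" using is_complex_unaug[OF K] by auto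
  show "A \<in> boundary (K - {{}}) \<longleftrightarrow> A \<in> bd K - {{}}"
  proof (cases "A \<in> K - {{}}")
    case False
    then show ?thesis unfolding boundary_def bd_def by auto
  next
    case True
    have l: "insert {} (link A (K - {{}})) = lk A K" using aug_link[OF iK(1) True] aug_unaug[OF K] by simp
    have "finite (link A (K - {{}}))" by (rule finite_subset[OF _ iK(2)]) (auto simp: link_def)
    then have "(\<exists>d. stellar_sphere d (link A (K - {{}}))) \<longleftrightarrow> (\<exists>m. stellar_class True m (lk A K))"
      using stellar_sphere_stellar_class[OF is_complex_link[OF iK(1)]] l by simp
    moreover have "(\<exists>m. stellar_class True m (lk A K)) \<longleftrightarrow> odd (card (lk A K))"
    proof
      assume "\<exists>m. stellar_class True m (lk A K)"
      then show "odd (card (lk A K))" using stellar_class_parity by blast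
    next
      assume o: "odd (card (lk A K))"
      have "A \<in> K" "A \<noteq> {}" using True by auto
      then show "\<exists>m. stellar_class True m (lk A K)" using ball_links[OF stellar_class, of A] stellar_class_parity[of False _ "lk A K"] o by blast
    qed
    ultimately show ?thesis using True unfolding boundary_def bd_def by auto
  qed
qed

section \<open>From equivalence rel the boundary to sequences of internal moves\<close>

lemma apply_moves_cong: "(\<And>j. j < i \<Longrightarrow> \<delta> j = \<delta>' j) \<Longrightarrow> apply_moves \<delta> i A = apply_moves \<delta>' i A"
  by (induction i) auto

text \<open>Both notions of internality refer to the current ball, so its class and its boundary are
  carried along. A base not inside the boundary vertices gives strong internality. A subdivision is
  not essential for the boundary since its base is not there, a weld since its apex is not
  there.\<close>

lemma eqv_moves:
  fixes K :: "'a::infinite set set"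
  assumes "eqv (verts (bd K)) K K'" "stellar_class False n K"
  shows "stellar_class False n K' \<and> bd K' = bd K \<and> (\<exists>m \<delta>. (\<forall>i<m. internal (\<delta> i) (apply_moves \<delta> i (K - {{}})) \<and>
     strongly_internal (\<delta> i) (apply_moves \<delta> i (K - {{}}))) \<and> apply_moves \<delta> m (K - {{}}) = K' - {{}})"
proof -
  let ?S = "bd K" let ?V = "verts (bd K)"
  let ?R = "\<lambda>L. \<exists>m \<delta>. (\<forall>i<m. internal (\<delta> i) (apply_moves \<delta> i (K - {{}})) \<and>
     strongly_internal (\<delta> i) (apply_moves \<delta> i (K - {{}}))) \<and> apply_moves \<delta> m (K - {{}}) = L - {{}}"
  have cS: "cpx ?S" using ball_bd_collar_starrable[OF assms(2)] by blast
  have ext: "?R L'" if R: "?R L" and d: "internal d (L - {{}})" "strongly_internal d (L - {{}})" "apply_move d (L - {{}}) = L' - {{}}" for L L' d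
  proof -
    obtain m \<delta> where h: "\<forall>i<m. internal (\<delta> i) (apply_moves \<delta> i (K - {{}})) \<and> strongly_internal (\<delta> i) (apply_moves \<delta> i (K - {{}}))"
      "apply_moves \<delta> m (K - {{}}) = L - {{}}" using R by blast
    let ?d = "\<delta>(m := d)"
    have e: "apply_moves ?d i (K - {{}}) = apply_moves \<delta> i (K - {{}})" if "i \<le> m" for i
      by (rule apply_moves_cong) (use that in auto)
    have "internal (?d i) (apply_moves ?d i (K - {{}})) \<and> strongly_internal (?d i) (apply_moves ?d i (K - {{}}))" if "i < Suc m" for i
      using that h d e[of i] by (cases "i = m") auto
    moreover have "apply_moves ?d (Suc m) (K - {{}}) = L' - {{}}" using e[of m] h d by simp
    ultimately show ?thesis by blast
  qed
  have vb: "verts (boundary (L - {{}})) = ?V" "boundary (L - {{}}) = ?S - {{}}" if "stellar_class False n L" "bd L = ?S" for L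
    using boundary_eq_bd[OF that(1)] that(2) by (simp_all add: verts_unaug)
  show ?thesis
    using assms(1) stellar_class_cpx[OF assms(2)]
  proof (induction rule: eqv_induct)
    case base
    show ?case using assms(2) by (auto intro!: exI[of _ 0])
  next
    case (subdiv L \<sigma> s)
    have s0: "\<sigma> \<noteq> {}" using subdiv by blast
    have "eqv {} L (subdiv \<sigma> s L)" by (rule eqv_subdiv[OF subdiv(2,3)]) (use s0 subdiv in auto)
    then have stellar_class: "stellar_class False n (subdiv \<sigma> s L)" using stellar_class_eqv[of L "subdiv \<sigma> s L" False n] subdiv(7) by simp
    have "subdiv \<sigma> s ?S = ?S"
    proof (rule subdiv_id[OF _ subdiv(5)])
      fix \<tau> assume "\<tau> \<in> ?S"
      from face_verts[OF this] show "\<not> \<sigma> \<subseteq> \<tau>" using subdiv(4) by blast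
    qed
    then have b: "bd (subdiv \<sigma> s L) = ?S" using bd_subdiv[OF subdiv(2,3) s0 subdiv(6)] subdiv(7) by simp
    have \<sigma>S: "\<sigma> \<notin> ?S" using subdiv(4) face_verts[of \<sigma> ?S] by blast
    have L: "stellar_class False n L" "bd L = ?S" "?R L" using subdiv(7) by auto
    have "internal (Subdiv \<sigma> s) (L - {{}})"
      unfolding internal_def using apply_subdiv_subdiv(1)[OF subdiv(2,3) s0 subdiv(6)] vb[OF L(1,2)] \<sigma>S by simp
    moreover have "strongly_internal (Subdiv \<sigma> s) (L - {{}})"
      unfolding strongly_internal_def using vb[OF L(1,2)] subdiv(4) by simp
    ultimately have "?R (subdiv \<sigma> s L)" using ext[OF L(3)] apply_subdiv_subdiv(2)[OF subdiv(2,3) s0 subdiv(6)] by blast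
    then show ?case using stellar_class b by blast
  next
    case (weld L \<sigma> s)
    have s0: "\<sigma> \<noteq> {}" using weld by blast
    have "eqv {} L (subdiv \<sigma> s L)" by (rule eqv_subdiv[OF weld(2,3)]) (use s0 weld in auto)
    then have stellar_class: "stellar_class False n L" using stellar_class_eqv[of L "subdiv \<sigma> s L" False n] weld(7) by simp
    have cb: "cpx (bd L)" using ball_bd_collar_starrable[OF stellar_class] by blast
    have e: "subdiv \<sigma> s (bd L) = ?S" using bd_subdiv[OF weld(2,3) s0 weld(6)] weld(7) by simp
    have s\<sigma>: "s \<notin> \<sigma>" by (rule face_not_fresh[OF weld(3,6)])
    \<comment> \<open>Otherwise \<open>s\<close> would be a vertex of the boundary of the subdivided
      ball, which is the protected set.\<close>
    have "\<sigma> \<notin> bd L"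
    proof
      assume "\<sigma> \<in> bd L"
      then have "s \<in> verts (subdiv \<sigma> s (bd L))" by (rule new_vertex_subdiv[OF _ s0 s\<sigma>])
      then show False using e weld(5) by simp
    qed
    then have "\<not> \<sigma> \<subseteq> \<tau>" if "\<tau> \<in> bd L" for \<tau> using cpx_down[OF cb that] by blast
    moreover have "s \<notin> verts (bd L)" using weld(6) verts_mono[OF bd_subset, of L] by blast
    ultimately have "subdiv \<sigma> s (bd L) = bd L" by (rule subdiv_id)
    then have b: "bd L = ?S" using e by simp
    have L: "stellar_class False n (subdiv \<sigma> s L)" "bd (subdiv \<sigma> s L) = ?S" "?R (subdiv \<sigma> s L)" using weld(7) by auto
    have "\<not> essential (Weld \<sigma> s) (boundary (subdiv \<sigma> s L - {{}}))" using vb[OF L(1,2)] weld(5) by simp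
    then have "internal (Weld \<sigma> s) (subdiv \<sigma> s L - {{}})"
      unfolding internal_def using apply_weld_subdiv(1)[OF weld(2,3) s0 weld(6)] by blast
    moreover have "strongly_internal (Weld \<sigma> s) (subdiv \<sigma> s L - {{}})"
      unfolding strongly_internal_def using vb[OF L(1,2)] weld(4) by simp
    ultimately have "?R L" using ext[OF L(3)] apply_weld_subdiv(2)[OF weld(2,3) s0 weld(6)] by blast
    then show ?case using stellar_class b by blast
  qed
qed

lemma cone_eq_join:
  assumes S: "cpx S" and v: "v \<notin> verts S"
  shows "simplex {v} \<star> (S - {{}}) = cone v S - {{}}"
proof -
  have "insert {} (simplex {v} \<star> (S - {{}})) = {\<alpha> \<union> \<beta> |\<alpha> \<beta>. \<alpha> \<subseteq> {v} \<and> \<beta> \<in> S}"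
    unfolding aug_join aug_simplex aug_unaug[OF S] by simp
  also have "\<dots> = cone v S"
  proof
    show "{\<alpha> \<union> \<beta> |\<alpha> \<beta>. \<alpha> \<subseteq> {v} \<and> \<beta> \<in> S} \<subseteq> cone v S"
    proof
      fix \<tau> assume "\<tau> \<in> {\<alpha> \<union> \<beta> |\<alpha> \<beta>. \<alpha> \<subseteq> {v} \<and> \<beta> \<in> S}"
      then obtain \<alpha> \<beta> where h: "\<tau> = \<alpha> \<union> \<beta>" "\<alpha> \<subseteq> {v}" "\<beta> \<in> S" by blast
      have "\<tau> - {v} \<subseteq> \<beta>" using h by blast
      then show "\<tau> \<in> cone v S" using cpx_down[OF S h(3)] unfolding cone_def by simp
    qed
    show "cone v S \<subseteq> {\<alpha> \<union> \<beta> |\<alpha> \<beta>. \<alpha> \<subseteq> {v} \<and> \<beta> \<in> S}"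
    proof
      fix \<tau> assume "\<tau> \<in> cone v S"
      then have "\<tau> - {v} \<in> S" unfolding cone_def by simp
      moreover have "\<tau> = (\<tau> \<inter> {v}) \<union> (\<tau> - {v})" by blast
      ultimately show "\<tau> \<in> {\<alpha> \<union> \<beta> |\<alpha> \<beta>. \<alpha> \<subseteq> {v} \<and> \<beta> \<in> S}" by blast
    qed
  qed
  finally have "insert {} (simplex {v} \<star> (S - {{}})) = cone v S" .
  moreover have "{} \<notin> simplex {v} \<star> (S - {{}})" by (rule join_notin) (auto simp: simplex_def)
  ultimately show ?thesis by (metis Diff_insert_absorb)
qed

theorem theorem5p4:
  fixes B :: "'a::infinite set set" and n :: nat
  assumes "stellar_ball n B" and "tame B"
  shows "\<exists>(k::nat) (\<delta> :: nat \<Rightarrow> 'a move) v.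
           (\<forall>i\<le>k. internal (\<delta> i) (apply_moves \<delta> i B) \<and>
                   strongly_internal (\<delta> i) (apply_moves \<delta> i B)) \<and>
           v \<notin> verts (boundary B) \<and>
           apply_moves \<delta> (k + 1) B = simplex {v} \<star> boundary B"
proof -
  let ?K = "insert {} B" let ?S = "bd ?K"
  note B = stellar_ball_stellar_class[OF assms(1)]
  have BK: "?K - {{}} = B" using empty_notin_complex[OF B(2)] by simp
  have bB: "boundary B = ?S - {{}}" using boundary_eq_bd[OF B(1)] BK by simp
  have vB: "verts (boundary B) = verts ?S" unfolding bB by (rule verts_unaug)
  have cS: "cpx ?S" using ball_bd_collar_starrable[OF B(1)] by blast
  have "tame_rel ?K ?S"
    unfolding tame_rel_def
  proof (intro ballI impI)
    fix \<tau> assume t: "\<tau> \<in> ?K" "\<tau> \<subseteq> verts ?S"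
    show "\<tau> \<in> ?S"
    proof (cases "\<tau> = {}")
      case True
      then show ?thesis using cpx_empty[OF cS] by simp
    next
      case False
      then have "\<tau> \<in> boundary B" using t assms(2) vB unfolding tame_def by auto
      then show ?thesis unfolding bB by blast
    qed
  qed
  then have "starrable ?K ?S" by (rule starring_tame_ball[OF B(1)])
  then obtain v where v: "v \<notin> verts ?S" "eqv (verts ?S) ?K (cone v ?S)" unfolding starrable_def by blast
  obtain m \<delta> where m: "\<forall>i<m. internal (\<delta> i) (apply_moves \<delta> i B) \<and> strongly_internal (\<delta> i) (apply_moves \<delta> i B)"
    "apply_moves \<delta> m B = cone v ?S - {{}}" and stellar_class: "stellar_class False (n + 1) (cone v ?S)" "bd (cone v ?S) = ?S"
    using eqv_moves[OF v(2) B(1)] unfolding BK by blast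
  have "finite (insert v (verts ?S))" using finite_verts[OF cS] by simp
  then obtain v' where v': "v' \<notin> insert v (verts ?S)" by (rule ex_fresh)
  \<comment> \<open>The number of moves must be positive, so the apex is renamed once more.\<close>
  let ?d = "\<delta>(m := Subdiv {v} v')"
  have cC: "cpx (cone v ?S)" by (rule cpx_cone[OF cS])
  have vC: "{v} \<in> cone v ?S" "v' \<notin> verts (cone v ?S)"
    using cpx_empty[OF cS] v' verts_cone[OF cS] by (auto simp: cone_def)
  have e: "apply_moves ?d i B = apply_moves \<delta> i B" if "i \<le> m" for i
    by (rule apply_moves_cong) (use that in auto)
  have bC: "boundary (cone v ?S - {{}}) = ?S - {{}}" using boundary_eq_bd[OF stellar_class(1)] stellar_class(2) by simp
  have "{v} \<notin> ?S" using v(1) in_verts_iff[OF cS] by simp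
  then have "internal (Subdiv {v} v') (cone v ?S - {{}})"
    unfolding internal_def bC using apply_subdiv_subdiv(1)[OF cC vC(1) _ vC(2)] by simp
  moreover have "strongly_internal (Subdiv {v} v') (cone v ?S - {{}})"
    unfolding strongly_internal_def bC using v(1) by (simp add: verts_unaug)
  ultimately have "internal (?d i) (apply_moves ?d i B) \<and> strongly_internal (?d i) (apply_moves ?d i B)" if "i \<le> m" for i
    using that m e[of i] by (cases "i = m") auto
  moreover have "subdiv {v} v' (cone v ?S) = cone v' ?S" by (rule cone_rename[OF cS v(1)]) (use v' in auto)
  then have "apply_moves ?d (m + 1) B = cone v' ?S - {{}}"
    using e[of m] m(2) apply_subdiv_subdiv(2)[OF cC vC(1) _ vC(2)] by simp
  then have "apply_moves ?d (m + 1) B = simplex {v'} \<star> boundary B"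
    unfolding bB using cone_eq_join[OF cS, of v'] v' by simp
  moreover have "v' \<notin> verts (boundary B)" unfolding vB using v' by blast
  ultimately show ?thesis by blast
qed

end
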